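(* Let $K$ be a commutative Frobenius ring, let $A$ be a non projective Frobenius $K$-algebra with Frobenius functional $\epsilon: A\to K$, and let $\sigma$ be a $K$-algebra automorphism of $A$. Let $S=A[x;\sigma]$ be the skew polynomial ring, and let $f=\sum_{i=0}^m f_ix^i\in S$ be a monic polynomial of degree $m$ such that $Sf=fS$ and such that $f_0$ is a unit of $A$. Let $\mathcal{R}=S/Sf$, whose elements are identified with the polynomials in $S$ of degree less than $m$, with operations made modulo $f$, and for $g\in\mathcal{R}$ let $g_0\in A$ denote its term of degree $0$. Then $\mathcal{R}$ is a non projective Frobenius $K$-algebra with non degenerate associative $K$-bilinear form $$\langle -,-\rangle:\mathcal{R}\times\mathcal{R}\to K,\qquad \langle g,h\rangle=\epsilon((gh)_0).$$ Therefore, $\mathcal{R}$ is a Frobenius ring.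
   Context: All rings are unital and possibly noncommutative. A left and right artinian ring $A$ with Jacobson radical $J$ is called Frobenius if $\operatorname{Soc}({}_AA)\cong A/J$ as left $A$-modules and $\operatorname{Soc}(A_A)\cong A/J$ as right $A$-modules, where $\operatorname{Soc}$ denotes the socle. Let $R$ be an algebra over a commutative Frobenius ring $K$. A $K$-bilinear form $\langle -,-\rangle : R\times R\to K$ is associative if $\langle bb',b''\rangle=\langle b,b'b''\rangle$ for all $b,b',b''\in R$. It is non degenerate if both maps $\alpha,\beta: R\to R^*=\operatorname{Hom}_K(R,K)$, $\alpha(b)(b')=\langle b,b'\rangle=\beta(b')(b)$, are injective. The algebra $R$ is called non projective Frobenius over $K$ if $R$ is finitely generated as a $K$-module and there exists an associative non degenerate $K$-bilinear form $R\times R\to K$ ("non projective" means "not necessarily projective" as a $K$-module). In that case the associated Frobenius functional is the $K$-linear map $\epsilon:R\to K$, $\epsilon(b)=\langle 1,b\rangle=\langle b,1\rangle$, so that $\langle b,b'\rangle=\epsilon(bb')$ for all $b,b'\in R$. In the skew polynomial ring $A[x;\sigma]$ elements are written as left polynomials $\sum a_ix^i$ with $a_i \in A$, and multiplication is determined by $xa=\sigma(a)x$ for $a\in A$. Since $f$ is monic, every $g\in S$ can be written uniquely as $g=qf+r$ with $q,r\in S$ and $\deg r<m$, which gives the identification of $\mathcal{R}$ with polynomials of degree less than $m$. *)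

theory Defs
  imports "HOL-Algebra.QuotRing" "HOL-Algebra.UnivPoly"
begin

section \<open>Modules over noncommutative rings\<close>

text \<open>
  The library locale \<^locale>\<open>module\<close> requires commutative scalars. The definitions below only use
  the record type of modules and the locale \<^locale>\<open>submodule\<close>, neither of which does. They are
  applied to the regular module of a ring, with right modules treated as left modules over the
  opposite ring.
\<close>

definition opposite :: "('a, 'z) ring_scheme \<Rightarrow> ('a, 'z) ring_scheme" where
  "opposite R = R\<lparr>mult := (\<lambda>x y. y \<otimes>\<^bsub>R\<^esub> x)\<rparr>"

definition regular_module :: "('a, 'z) ring_scheme \<Rightarrow> ('a, 'a) module" where
  "regular_module R =
    \<lparr>carrier = carrier R, mult = mult R, one = \<one>\<^bsub>R\<^esub>, zero = \<zero>\<^bsub>R\<^esub>, add = add R,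
     smult = mult R\<rparr>"

text \<open>
  Serves both as the quotient of a module by a submodule (its multiplication is then irrelevant) and
  as the quotient of an algebra by a two-sided ideal.
\<close>

definition quotient_module ::
    "[('k, 'a, 'z) module_scheme, 'a set] \<Rightarrow> ('k, 'a set) module" where
  "quotient_module M N =
    ring.extend (M Quot N) \<lparr>smult = (\<lambda>k X. \<Union>x\<in>X. N +>\<^bsub>M\<^esub> (k \<odot>\<^bsub>M\<^esub> x))\<rparr>"

definition module_isomorphic ::
    "[('k, 'y) ring_scheme, ('k, 'a, 'u) module_scheme, ('k, 'b, 'v) module_scheme] \<Rightarrow> bool" where
  "module_isomorphic R M N \<longleftrightarrow>
    (\<exists>\<phi>. bij_betw \<phi> (carrier M) (carrier N) \<and>
         (\<forall>x\<in>carrier M. \<forall>y\<in>carrier M. \<phi> (x \<oplus>\<^bsub>M\<^esub> y) = \<phi> x \<oplus>\<^bsub>N\<^esub> \<phi> y) \<and>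
         (\<forall>a\<in>carrier R. \<forall>x\<in>carrier M. \<phi> (a \<odot>\<^bsub>M\<^esub> x) = a \<odot>\<^bsub>N\<^esub> \<phi> x))"

definition artinian_module ::
    "[('k, 'y) ring_scheme, ('k, 'a, 'u) module_scheme] \<Rightarrow> bool" where
  "artinian_module R M \<longleftrightarrow>
    (\<forall>C :: nat \<Rightarrow> 'a set. (\<forall>n. submodule (C n) R M \<and> C (Suc n) \<subseteq> C n) \<longrightarrow>
      (\<exists>n. \<forall>k\<ge>n. C k = C n))"

definition simple_submodule ::
    "['a set, ('k, 'y) ring_scheme, ('k, 'a, 'u) module_scheme] \<Rightarrow> bool" where
  "simple_submodule N R M \<longleftrightarrow>
    submodule N R M \<and> N \<noteq> {\<zero>\<^bsub>M\<^esub>} \<and>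
    (\<forall>L. submodule L R M \<and> L \<subseteq> N \<longrightarrow> L = {\<zero>\<^bsub>M\<^esub>} \<or> L = N)"

definition maximal_submodule ::
    "['a set, ('k, 'y) ring_scheme, ('k, 'a, 'u) module_scheme] \<Rightarrow> bool" where
  "maximal_submodule N R M \<longleftrightarrow>
    submodule N R M \<and> N \<noteq> carrier M \<and>
    (\<forall>L. submodule L R M \<and> N \<subseteq> L \<longrightarrow> L = N \<or> L = carrier M)"

text \<open>The sum of all simple submodules, i.e. the least submodule containing each of them.\<close>

definition socle :: "[('k, 'y) ring_scheme, ('k, 'a, 'u) module_scheme] \<Rightarrow> 'a set" where
  "socle R M = \<Inter>{N. submodule N R M \<and> (\<forall>L. simple_submodule L R M \<longrightarrow> L \<subseteq> N)}"

section \<open>Frobenius rings\<close>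

text \<open>
  The intersection of all maximal left ideals. The intersection with the carrier matters
  only for the zero ring, which has no maximal left ideal.
\<close>

definition jacobson_radical :: "('a, 'z) ring_scheme \<Rightarrow> 'a set" where
  "jacobson_radical R = carrier R \<inter> \<Inter>{N. maximal_submodule N R (regular_module R)}"

text \<open>
  \<open>Soc(\<^sub>RR) \<cong> R/J\<close> as left \<open>R\<close>-modules for a given \<open>J\<close>; for \<open>opposite R\<close> in place of \<open>R\<close>
  this reads \<open>Soc(R\<^sub>R) \<cong> R/J\<close> as right \<open>R\<close>-modules.
\<close>

definition socle_isomorphic_quotient :: "[('a, 'z) ring_scheme, 'a set] \<Rightarrow> bool" where
  "socle_isomorphic_quotient R J \<longleftrightarrow>
    module_isomorphic R
      ((regular_module R)\<lparr>carrier := socle R (regular_module R)\<rparr>)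
      (quotient_module (regular_module R) J)"

definition Frobenius_ring :: "('a, 'z) ring_scheme \<Rightarrow> bool" where
  "Frobenius_ring R \<longleftrightarrow>
    ring R \<and>
    artinian_module R (regular_module R) \<and>
    artinian_module (opposite R) (regular_module (opposite R)) \<and>
    socle_isomorphic_quotient R (jacobson_radical R) \<and>
    socle_isomorphic_quotient (opposite R) (jacobson_radical R)"

section \<open>Non projective Frobenius algebras\<close>

text \<open>The library locale \<^locale>\<open>algebra\<close> is restricted to commutative algebras.\<close>

locale assoc_algebra = module + ring M +
  assumes smult_assoc2:
      "\<lbrakk>a \<in> carrier R; x \<in> carrier M; y \<in> carrier M\<rbrakk> \<Longrightarrow>
       (a \<odot>\<^bsub>M\<^esub> x) \<otimes>\<^bsub>M\<^esub> y = a \<odot>\<^bsub>M\<^esub> (x \<otimes>\<^bsub>M\<^esub> y)"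
    and smult_assoc3:
      "\<lbrakk>a \<in> carrier R; x \<in> carrier M; y \<in> carrier M\<rbrakk> \<Longrightarrow>
       x \<otimes>\<^bsub>M\<^esub> (a \<odot>\<^bsub>M\<^esub> y) = a \<odot>\<^bsub>M\<^esub> (x \<otimes>\<^bsub>M\<^esub> y)"

definition algebra_automorphism ::
    "[('k, 'y) ring_scheme, ('k, 'a, 'u) module_scheme, 'a \<Rightarrow> 'a] \<Rightarrow> bool" where
  "algebra_automorphism K A \<sigma> \<longleftrightarrow>
    \<sigma> \<in> ring_iso A A \<and> (\<forall>k\<in>carrier K. \<forall>a\<in>carrier A. \<sigma> (k \<odot>\<^bsub>A\<^esub> a) = k \<odot>\<^bsub>A\<^esub> \<sigma> a)"

definition fin_gen_module ::
    "[('k, 'y) ring_scheme, ('k, 'a, 'u) module_scheme] \<Rightarrow> bool" where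
  "fin_gen_module K M \<longleftrightarrow>
    (\<exists>B. finite B \<and> B \<subseteq> carrier M \<and>
      (\<forall>x\<in>carrier M. \<exists>c\<in>B \<rightarrow> carrier K. x = (\<Oplus>\<^bsub>M\<^esub>b\<in>B. c b \<odot>\<^bsub>M\<^esub> b)))"

definition bilinear_form ::
    "[('k, 'y) ring_scheme, ('k, 'a, 'u) module_scheme, 'a \<Rightarrow> 'a \<Rightarrow> 'k] \<Rightarrow> bool" where
  "bilinear_form K M F \<longleftrightarrow>
    (\<forall>x\<in>carrier M. \<forall>y\<in>carrier M. F x y \<in> carrier K) \<and>
    (\<forall>x\<in>carrier M. \<forall>y\<in>carrier M. \<forall>z\<in>carrier M.
      F (x \<oplus>\<^bsub>M\<^esub> y) z = F x z \<oplus>\<^bsub>K\<^esub> F y z \<and> F x (y \<oplus>\<^bsub>M\<^esub> z) = F x y \<oplus>\<^bsub>K\<^esub> F x z) \<and>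
    (\<forall>k\<in>carrier K. \<forall>x\<in>carrier M. \<forall>y\<in>carrier M.
      F (k \<odot>\<^bsub>M\<^esub> x) y = k \<otimes>\<^bsub>K\<^esub> F x y \<and> F x (k \<odot>\<^bsub>M\<^esub> y) = k \<otimes>\<^bsub>K\<^esub> F x y)"

definition associative_form :: "[('a, 'z) ring_scheme, 'a \<Rightarrow> 'a \<Rightarrow> 'k] \<Rightarrow> bool" where
  "associative_form R F \<longleftrightarrow>
    (\<forall>x\<in>carrier R. \<forall>y\<in>carrier R. \<forall>z\<in>carrier R. F (x \<otimes>\<^bsub>R\<^esub> y) z = F x (y \<otimes>\<^bsub>R\<^esub> z))"

text \<open>
  Injectivity of both maps from \<open>R\<close> to its dual; elements of the dual are represented by
  functions restricted to the carrier, so that equality is equality on the carrier.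
\<close>

definition nondegenerate_form :: "[('a, 'z) ring_scheme, 'a \<Rightarrow> 'a \<Rightarrow> 'k] \<Rightarrow> bool" where
  "nondegenerate_form R F \<longleftrightarrow>
    inj_on (\<lambda>x. \<lambda>y\<in>carrier R. F x y) (carrier R) \<and>
    inj_on (\<lambda>y. \<lambda>x\<in>carrier R. F x y) (carrier R)"

definition Frobenius_form ::
    "[('k, 'y) ring_scheme, ('k, 'a, 'u) module_scheme, 'a \<Rightarrow> 'a \<Rightarrow> 'k] \<Rightarrow> bool" where
  "Frobenius_form K R F \<longleftrightarrow>
    bilinear_form K R F \<and> associative_form R F \<and> nondegenerate_form R F"

definition nonprojective_Frobenius_algebra ::
    "[('k, 'y) ring_scheme, ('k, 'a, 'u) module_scheme] \<Rightarrow> bool" where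
  "nonprojective_Frobenius_algebra K R \<longleftrightarrow>
    assoc_algebra K R \<and> fin_gen_module K R \<and> (\<exists>F. Frobenius_form K R F)"

text \<open>By associativity \<open>F \<one> b = F b \<one>\<close>, so \<open>\<epsilon>\<close> is also given by the other formula.\<close>

definition Frobenius_functional ::
    "[('k, 'y) ring_scheme, ('k, 'a, 'u) module_scheme, 'a \<Rightarrow> 'k] \<Rightarrow> bool" where
  "Frobenius_functional K R \<epsilon> \<longleftrightarrow>
    (\<exists>F. Frobenius_form K R F \<and> (\<forall>b\<in>carrier R. \<epsilon> b = F \<one>\<^bsub>R\<^esub> b))"

section \<open>Skew polynomials\<close>

text \<open>
  As in the library's \<^const>\<open>UP\<close>, a polynomial \<open>\<Sum> a\<^sub>i x\<^sup>i\<close> is its coefficient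
  function. The product is forced by \<open>(a x\<^sup>i) (b x\<^sup>j) = a \<sigma>\<^sup>i(b) x\<^sup>i\<^sup>+\<^sup>j\<close>,
  i.e. by \<open>x a = \<sigma>(a) x\<close>.
\<close>

definition skew_poly :: "[('k, 'a, 'u) module_scheme, 'a \<Rightarrow> 'a] \<Rightarrow> ('k, nat \<Rightarrow> 'a) module" where
  "skew_poly A \<sigma> =
    \<lparr>carrier = up A,
     mult = (\<lambda>p q n. \<Oplus>\<^bsub>A\<^esub>i\<in>{..n}. p i \<otimes>\<^bsub>A\<^esub> (\<sigma> ^^ i) (q (n - i))),
     one = (\<lambda>i. if i = 0 then \<one>\<^bsub>A\<^esub> else \<zero>\<^bsub>A\<^esub>),
     zero = (\<lambda>i. \<zero>\<^bsub>A\<^esub>),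
     add = (\<lambda>p q i. p i \<oplus>\<^bsub>A\<^esub> q i),
     smult = (\<lambda>k p i. k \<odot>\<^bsub>A\<^esub> p i)\<rparr>"

definition monic_of_degree :: "[('a, 'z) ring_scheme, nat, nat \<Rightarrow> 'a] \<Rightarrow> bool" where
  "monic_of_degree A m f \<longleftrightarrow> f m = \<one>\<^bsub>A\<^esub> \<and> (\<forall>i>m. f i = \<zero>\<^bsub>A\<^esub>)"

text \<open>
  The polynomial of degree less than \<open>m\<close> that represents a coset of \<open>Sf\<close>, for \<open>f\<close>
  monic of degree \<open>m\<close>; it is unique by right division by \<open>f\<close>.
\<close>

definition reduced_rep :: "[('a, 'z) ring_scheme, nat, (nat \<Rightarrow> 'a) set] \<Rightarrow> nat \<Rightarrow> 'a" where
  "reduced_rep A m X = (THE r. r \<in> X \<and> (\<forall>i\<ge>m. r i = \<zero>\<^bsub>A\<^esub>))"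

end

(*
The form is nondegenerate because the class of x in S/Sf is a unit (f_0 is one): pairing with
constants shows that the constant coefficient of an element of the radical of the form vanishes, and
dividing by x repeats the argument for the other coefficients.

That a non projective Frobenius algebra R over K is a Frobenius ring rests on the double orthogonal
property of the form. For a maximal ideal m of a commutative Frobenius ring K the annihilator of m is
at most one-dimensional over K/m, so taking orthogonals turns a simple subquotient of the K-module R
into a simple or zero one. R has finite length over K, and counting lengths along a composition
series shows that no factor collapses. Hence N |-> N^perp is an anti-isomorphism of lattices, which
exchanges left and right ideals. Choose e_1, ..., e_n in R representing orthogonal primitive
idempotents with sum 1 of the semisimple ring R/J. The orthogonals M_i of the maximal right ideals
{x. e_i x in J} are simple left ideals with e_i M_i nonzero. For nonzero n_i in e_i M_i the element
s = n_1 + ... + n_n generates the left socle and has left annihilator J, so Soc(R) = Rs is isomorphic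
to R/J. Passing to the opposite ring gives the other side.
*)

theory Submission
  imports Defs
begin

section \<open>Modules and left ideals\<close>

text \<open>The length count replaces them. Finite length itself is obtained from descending chains
  alone: below \<open>X\<close>, every proper submodule \<open>Y\<close> is contained in some
  \<open>Z\<close> with \<open>X/Z\<close> simple, and the chain condition stops the descent from
  \<open>X\<close> to \<open>Y\<close>. The representatives e_i are idempotent and orthogonal only
  modulo J. They are never lifted to idempotents: they are applied to elements killed by J, on which
  congruent ring elements act equally. The radical is defined by maximal left ideals, so maximality
  of the right ideals {x. e_i x in J} is not automatic. It comes from the division ring e_i(R/J)e_i,
  in which left inverses are two-sided. Both halves of the definition of a Frobenius ring refer to
  the same J, the radical of the left side. Passing to the opposite ring therefore also requires
  that \<open>R\<close> and its opposite have the same radical.\<close>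

lemma artinian_module_minimal:
  assumes "artinian_module R M" "\<N> \<noteq> {}" "\<And>N. N \<in> \<N> \<Longrightarrow> submodule N R M"
  obtains N where "N \<in> \<N>" "\<And>L. L \<in> \<N> \<Longrightarrow> L \<subseteq> N \<Longrightarrow> L = N"
proof (rule ccontr)
  assume "\<not> thesis"
  with that have "\<forall>N\<in>\<N>. \<exists>L\<in>\<N>. L \<subset> N"
    by blast
  then obtain g where g: "\<And>N. N \<in> \<N> \<Longrightarrow> g N \<in> \<N> \<and> g N \<subset> N"
    by metis
  obtain N0 where N0: "N0 \<in> \<N>"
    using assms(2) by blast
  define C where "C n = (g ^^ n) N0" for n
  have C: "C n \<in> \<N>" for n
    by (induction n) (use N0 g in \<open>auto simp: C_def\<close>)
  have Suc: "C (Suc n) \<subset> C n" for n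
    using g[OF C[of n]] by (simp add: C_def)
  then obtain n where "\<forall>k\<ge>n. C k = C n"
    using assms(1,3) C unfolding artinian_module_def by (meson less_imp_le)
  with Suc[of n] show False
    by (metis le_SucI order_refl psubset_eq)
qed

lemma (in abelian_monoid) finsum_mem:
  assumes "finite I" "\<And>i. i \<in> I \<Longrightarrow> g i \<in> N" "N \<subseteq> carrier G" "\<zero> \<in> N"
    "\<And>x y. x \<in> N \<Longrightarrow> y \<in> N \<Longrightarrow> x \<oplus> y \<in> N"
  shows "(\<Oplus>i\<in>I. g i) \<in> N"
  using assms(1,2)
proof (induction I rule: finite_induct)
  case (insert i I)
  then have "g \<in> I \<rightarrow> carrier G" "g i \<in> carrier G"
    using assms(3) by auto
  with insert assms(5) show ?case
    by simp
qed (use assms(4) in simp)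

section \<open>Submodules and finite generation over a commutative ring\<close>

context module
begin

text \<open>Closure under negation needs no separate check: it is multiplication by the scalar
  \<open>\<ominus> \<one>\<close>.\<close>

lemma submodule_iff:
  "submodule N R M \<longleftrightarrow> N \<subseteq> carrier M \<and> \<zero>\<^bsub>M\<^esub> \<in> N \<and> (\<forall>x\<in>N. \<forall>y\<in>N. x \<oplus>\<^bsub>M\<^esub> y \<in> N) \<and>
     (\<forall>k\<in>carrier R. \<forall>x\<in>N. k \<odot>\<^bsub>M\<^esub> x \<in> N)" (is "_ \<longleftrightarrow> ?rhs")
proof
  assume N: "submodule N R M"
  have "\<zero>\<^bsub>M\<^esub> \<in> N"
    using submoduleE(1,2,4)[OF N] smult_l_null
    by (metis R.zero_closed all_not_in_conv subsetD)
  then show ?rhs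
    using submoduleE[OF N] by auto
next
  assume N: ?rhs
  then show "submodule N R M"
  proof (intro submoduleI)
    fix a assume "a \<in> N"
    then have "(\<ominus> \<one>) \<odot>\<^bsub>M\<^esub> a \<in> N" "a \<in> carrier M"
      using N by auto
    then show "\<ominus>\<^bsub>M\<^esub> a \<in> N"
      by (simp add: smult_l_minus)
  qed auto
qed

lemma submodule_minus:
  assumes "submodule N R M" "x \<in> N" "y \<in> N"
  shows "x \<ominus>\<^bsub>M\<^esub> y \<in> N"
  using submoduleE(3,5)[OF assms(1)] assms(2,3) by (simp add: a_minus_def)

lemma submodule_finsum:
  assumes "submodule N R M" "finite I" "\<And>i. i \<in> I \<Longrightarrow> g i \<in> N"
  shows "(\<Oplus>\<^bsub>M\<^esub>i\<in>I. g i) \<in> N"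
  by (rule M.finsum_mem) (use assms in \<open>auto simp: submodule_iff\<close>)

lemma submodule_Int:
  assumes "submodule N R M" "submodule P R M"
  shows "submodule (N \<inter> P) R M"
  using assms by (auto simp: submodule_iff)

lemma submodule_zero: "submodule {\<zero>\<^bsub>M\<^esub>} R M"
  by (simp add: submodule_iff)

lemma submodule_add_cyclic:
  assumes N: "submodule N R M" and b: "b \<in> carrier M"
  shows "submodule {x \<oplus>\<^bsub>M\<^esub> k \<odot>\<^bsub>M\<^esub> b | x k. x \<in> N \<and> k \<in> carrier R} R M" (is "submodule ?P R M")
  unfolding submodule_iff
proof (intro conjI ballI)
  have NM: "N \<subseteq> carrier M"
    using N by (simp add: submodule_iff)
  show "?P \<subseteq> carrier M"
    using NM b by auto
  show "\<zero>\<^bsub>M\<^esub> \<in> ?P"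
    using N b by (force simp: submodule_iff intro!: exI[of _ "\<zero>\<^bsub>M\<^esub>"] exI[of _ "\<zero>"])
next
  fix u v assume "u \<in> ?P" "v \<in> ?P"
  then obtain x k y l where u: "u = x \<oplus>\<^bsub>M\<^esub> k \<odot>\<^bsub>M\<^esub> b" "x \<in> N" "k \<in> carrier R"
    and v: "v = y \<oplus>\<^bsub>M\<^esub> l \<odot>\<^bsub>M\<^esub> b" "y \<in> N" "l \<in> carrier R"
    by blast
  have xy: "x \<in> carrier M" "y \<in> carrier M"
    using N u v by (auto simp: submodule_iff)
  have "u \<oplus>\<^bsub>M\<^esub> v = (x \<oplus>\<^bsub>M\<^esub> y) \<oplus>\<^bsub>M\<^esub> (k \<oplus> l) \<odot>\<^bsub>M\<^esub> b"
    using u v xy b by (simp add: smult_l_distr M.add.m_ac)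
  moreover have "x \<oplus>\<^bsub>M\<^esub> y \<in> N" "k \<oplus> l \<in> carrier R"
    using u v N by (auto simp: submodule_iff)
  ultimately show "u \<oplus>\<^bsub>M\<^esub> v \<in> ?P"
    by blast
next
  fix l u assume l: "l \<in> carrier R" and "u \<in> ?P"
  then obtain x k where u: "u = x \<oplus>\<^bsub>M\<^esub> k \<odot>\<^bsub>M\<^esub> b" "x \<in> N" "k \<in> carrier R"
    by blast
  have x: "x \<in> carrier M"
    using N u by (auto simp: submodule_iff)
  have "l \<odot>\<^bsub>M\<^esub> u = l \<odot>\<^bsub>M\<^esub> x \<oplus>\<^bsub>M\<^esub> (l \<otimes> k) \<odot>\<^bsub>M\<^esub> b"
    using u x b l by (simp add: smult_r_distr smult_assoc1)
  moreover have "l \<odot>\<^bsub>M\<^esub> x \<in> N" "l \<otimes> k \<in> carrier R"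
    using u l N by (auto simp: submodule_iff)
  ultimately show "l \<odot>\<^bsub>M\<^esub> u \<in> ?P"
    by blast
qed

lemma submodule_add_cyclicI:
  assumes "submodule N R M" "b \<in> carrier M"
  shows "N \<subseteq> {x \<oplus>\<^bsub>M\<^esub> k \<odot>\<^bsub>M\<^esub> b | x k. x \<in> N \<and> k \<in> carrier R}" (is "_ \<subseteq> ?P")
    and "b \<in> {x \<oplus>\<^bsub>M\<^esub> k \<odot>\<^bsub>M\<^esub> b | x k. x \<in> N \<and> k \<in> carrier R}"
proof -
  have N: "N \<subseteq> carrier M" "\<zero>\<^bsub>M\<^esub> \<in> N"
    using assms(1) by (auto simp: submodule_iff)
  show "N \<subseteq> ?P"
  proof
    fix x assume "x \<in> N"
    then show "x \<in> ?P"
      using N assms(2) by (force intro!: exI[of _ x] exI[of _ "\<zero>"])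
  qed
  show "b \<in> ?P"
    using N assms(2) by (force intro!: exI[of _ "\<zero>\<^bsub>M\<^esub>"] exI[of _ "\<one>"])
qed

lemma submodule_span:
  assumes B: "finite B" "B \<subseteq> carrier M"
  shows "submodule {(\<Oplus>\<^bsub>M\<^esub>b\<in>B. c b \<odot>\<^bsub>M\<^esub> b) | c. c \<in> B \<rightarrow> carrier R} R M" (is "submodule ?P R M")
  unfolding submodule_iff
proof (intro conjI ballI)
  have cl: "(\<lambda>b. c b \<odot>\<^bsub>M\<^esub> b) \<in> B \<rightarrow> carrier M" if "c \<in> B \<rightarrow> carrier R" for c
    using that B by auto
  show "?P \<subseteq> carrier M"
    using cl by (auto intro!: M.finsum_closed)
  have "(\<Oplus>\<^bsub>M\<^esub>b\<in>B. \<zero> \<odot>\<^bsub>M\<^esub> b) = \<zero>\<^bsub>M\<^esub>"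
    by (rule M.add.finprod_one_eqI) (use B in auto)
  then show "\<zero>\<^bsub>M\<^esub> \<in> ?P"
    by (force intro: exI[of _ "\<lambda>_. \<zero>"])
next
  fix u v assume "u \<in> ?P" "v \<in> ?P"
  then obtain c d where c: "u = (\<Oplus>\<^bsub>M\<^esub>b\<in>B. c b \<odot>\<^bsub>M\<^esub> b)" "c \<in> B \<rightarrow> carrier R"
    and d: "v = (\<Oplus>\<^bsub>M\<^esub>b\<in>B. d b \<odot>\<^bsub>M\<^esub> b)" "d \<in> B \<rightarrow> carrier R"
    by blast
  have "u \<oplus>\<^bsub>M\<^esub> v = (\<Oplus>\<^bsub>M\<^esub>b\<in>B. c b \<odot>\<^bsub>M\<^esub> b \<oplus>\<^bsub>M\<^esub> d b \<odot>\<^bsub>M\<^esub> b)"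
    unfolding c d by (rule M.finsum_addf[symmetric]) (use B c d in auto)
  also have "\<dots> = (\<Oplus>\<^bsub>M\<^esub>b\<in>B. (c b \<oplus> d b) \<odot>\<^bsub>M\<^esub> b)"
    by (rule M.finsum_cong') (use B c d in \<open>auto simp: smult_l_distr Pi_iff subset_iff\<close>)
  finally show "u \<oplus>\<^bsub>M\<^esub> v \<in> ?P"
    using c d by (force intro!: exI[of _ "\<lambda>b. c b \<oplus> d b"])
next
  fix k u assume k: "k \<in> carrier R" and "u \<in> ?P"
  then obtain c where c: "u = (\<Oplus>\<^bsub>M\<^esub>b\<in>B. c b \<odot>\<^bsub>M\<^esub> b)" "c \<in> B \<rightarrow> carrier R"
    by blast
  have "k \<odot>\<^bsub>M\<^esub> u = (\<Oplus>\<^bsub>M\<^esub>b\<in>B. k \<odot>\<^bsub>M\<^esub> (c b \<odot>\<^bsub>M\<^esub> b))"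
    unfolding c by (rule finsum_smult_ldistr) (use B c k in auto)
  also have "\<dots> = (\<Oplus>\<^bsub>M\<^esub>b\<in>B. (k \<otimes> c b) \<odot>\<^bsub>M\<^esub> b)"
    by (rule M.finsum_cong') (use B c k in \<open>auto simp: smult_assoc1 Pi_iff subset_iff\<close>)
  finally show "k \<odot>\<^bsub>M\<^esub> u \<in> ?P"
    using c k by (force intro!: exI[of _ "\<lambda>b. k \<otimes> c b"])
qed

lemma span_base:
  assumes B: "finite B" "B \<subseteq> carrier M" and b: "b \<in> B"
  shows "b \<in> {(\<Oplus>\<^bsub>M\<^esub>b\<in>B. c b \<odot>\<^bsub>M\<^esub> b) | c. c \<in> B \<rightarrow> carrier R}"
proof -
  have "(\<Oplus>\<^bsub>M\<^esub>x\<in>B. (if x = b then \<one> else \<zero>) \<odot>\<^bsub>M\<^esub> x) = (\<Oplus>\<^bsub>M\<^esub>x\<in>B. if b = x then x else \<zero>\<^bsub>M\<^esub>)"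
    by (rule M.finsum_cong') (use B in auto)
  also have "\<dots> = b"
    by (rule M.finsum_singleton) (use B b in auto)
  finally show ?thesis
    by (force intro!: exI[of _ "\<lambda>x. if x = b then \<one> else \<zero>"])
qed

text \<open>The span of \<open>B\<close> is a submodule containing \<open>B\<close>. Phrasing
  generation through submodules lets \<open>fin_gen_quotient\<close> avoid explicit linear
  combinations.\<close>

lemma fin_gen_moduleI:
  assumes "finite B" "B \<subseteq> carrier M"
    "\<And>N. submodule N R M \<Longrightarrow> B \<subseteq> N \<Longrightarrow> carrier M \<subseteq> N"
  shows "fin_gen_module R M"
  unfolding fin_gen_module_def
proof (intro exI[of _ B] conjI ballI)
  fix x assume "x \<in> carrier M"
  moreover have "carrier M \<subseteq> {(\<Oplus>\<^bsub>M\<^esub>b\<in>B. c b \<odot>\<^bsub>M\<^esub> b) | c. c \<in> B \<rightarrow> carrier R}"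
    using assms(3)[OF submodule_span[OF assms(1,2)]] span_base[OF assms(1,2)] by blast
  ultimately show "\<exists>c\<in>B \<rightarrow> carrier R. x = (\<Oplus>\<^bsub>M\<^esub>b\<in>B. c b \<odot>\<^bsub>M\<^esub> b)"
    by blast
qed (use assms in auto)

lemma fin_gen_moduleE:
  assumes "fin_gen_module R M"
  obtains B where "finite B" "B \<subseteq> carrier M"
    "\<And>N. submodule N R M \<Longrightarrow> B \<subseteq> N \<Longrightarrow> carrier M \<subseteq> N"
proof -
  obtain B where B: "finite B" "B \<subseteq> carrier M"
    "\<forall>x\<in>carrier M. \<exists>c\<in>B \<rightarrow> carrier R. x = (\<Oplus>\<^bsub>M\<^esub>b\<in>B. c b \<odot>\<^bsub>M\<^esub> b)"
    using assms unfolding fin_gen_module_def by blast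
  have "carrier M \<subseteq> N" if N: "submodule N R M" "B \<subseteq> N" for N
  proof
    fix x assume "x \<in> carrier M"
    then obtain c where "c \<in> B \<rightarrow> carrier R" "x = (\<Oplus>\<^bsub>M\<^esub>b\<in>B. c b \<odot>\<^bsub>M\<^esub> b)"
      using B by blast
    moreover have "(\<Oplus>\<^bsub>M\<^esub>b\<in>B. c b \<odot>\<^bsub>M\<^esub> b) \<in> N"
      by (rule submodule_finsum[OF N(1) B(1)])
        (use N \<open>c \<in> _\<close> in \<open>auto simp: submodule_iff Pi_iff subset_iff\<close>)
    ultimately show "x \<in> N"
      by simp
  qed
  with B that show ?thesis
    by blast
qed

end

section \<open>One-sided ideals as submodules of the regular module\<close>

lemma regular_module_simps [simp]:
  "carrier (regular_module R) = carrier R" "mult (regular_module R) = mult R"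
  "one (regular_module R) = one R" "zero (regular_module R) = zero R"
  "add (regular_module R) = add R" "smult (regular_module R) = mult R"
  by (simp_all add: regular_module_def)

lemma (in ring) regular_module_abelian_group: "abelian_group (regular_module R)"
  by (rule abelian_groupI) (auto simp: a_ac intro: l_neg)

lemma (in cring) regular_module_is_module: "module R (regular_module R)"
  by (intro moduleI)
    (auto simp: is_cring regular_module_abelian_group l_distr r_distr m_assoc)

abbreviation (in ring) left_ideal :: "'a set \<Rightarrow> bool" where
  "left_ideal N \<equiv> submodule N R (regular_module R)"

abbreviation (in ring) maximal_left_ideal :: "'a set \<Rightarrow> bool" where
  "maximal_left_ideal L \<equiv> maximal_submodule L R (regular_module R)"

text \<open>The locale \<open>module\<close> fixes commutative scalars, so
  \<open>submodule_iff\<close> does not reach the regular module of a noncommutative ring; this is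
  its counterpart there.\<close>

lemma (in ring) left_ideal_iff:
  "left_ideal N \<longleftrightarrow> N \<subseteq> carrier R \<and> \<zero> \<in> N \<and> (\<forall>x\<in>N. \<forall>y\<in>N. x \<oplus> y \<in> N) \<and>
     (\<forall>a\<in>carrier R. \<forall>x\<in>N. a \<otimes> x \<in> N)" (is "_ \<longleftrightarrow> ?rhs")
proof
  assume "left_ideal N"
  then interpret submodule N R "regular_module R" .
  show ?rhs
    using subset one_closed m_closed smult_closed by simp
next
  assume N: ?rhs
  have "\<ominus> x \<in> N" if "x \<in> N" for x
  proof -
    have "(\<ominus> \<one>) \<otimes> x \<in> N" "x \<in> carrier R"
      using N that by auto
    then show ?thesis
      by (simp add: l_minus)
  qed
  then show "left_ideal N"
    using N
    by unfold_locales
      (auto simp: a_inv_def m_inv_def intro!: subgroup.intro)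
qed

lemma (in ring) left_ideal_minus:
  assumes "left_ideal N" "x \<in> N" "y \<in> N"
  shows "x \<ominus> y \<in> N"
proof -
  have "y \<in> carrier R" "(\<ominus> \<one>) \<otimes> y \<in> N"
    using assms by (auto simp: left_ideal_iff)
  then show ?thesis
    using assms by (simp add: left_ideal_iff a_minus_def l_minus)
qed

lemma (in ring) left_ideal_mem_cong:
  assumes "left_ideal N" "x \<ominus> y \<in> N" "x \<in> carrier R" "y \<in> carrier R"
  shows "x \<in> N \<longleftrightarrow> y \<in> N"
proof
  assume "x \<in> N"
  then have "x \<ominus> (x \<ominus> y) \<in> N"
    using left_ideal_minus assms by blast
  also have "x \<ominus> (x \<ominus> y) = y"
    using assms by algebra
  finally show "y \<in> N" .
next
  assume "y \<in> N"
  then have "(x \<ominus> y) \<oplus> y \<in> N"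
    using assms by (simp add: left_ideal_iff)
  also have "(x \<ominus> y) \<oplus> y = x"
    using assms by algebra
  finally show "x \<in> N" .
qed

lemma (in ring) left_ideal_add_principal:
  assumes N: "left_ideal N" and a: "a \<in> carrier R"
  shows "left_ideal {x \<oplus> r \<otimes> a | x r. x \<in> N \<and> r \<in> carrier R}" (is "submodule ?P _ _")
    and "N \<subseteq> {x \<oplus> r \<otimes> a | x r. x \<in> N \<and> r \<in> carrier R}"
    and "a \<in> {x \<oplus> r \<otimes> a | x r. x \<in> N \<and> r \<in> carrier R}"
proof -
  have NR: "x \<in> carrier R" if "x \<in> N" for x
    using that N by (auto simp: left_ideal_iff)
  show *: "N \<subseteq> ?P"
  proof
    fix x assume "x \<in> N"
    then have "x = x \<oplus> \<zero> \<otimes> a"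
      using a NR by simp
    with \<open>x \<in> N\<close> show "x \<in> ?P"
      by blast
  qed
  have "a = \<zero> \<oplus> \<one> \<otimes> a" "\<zero> \<in> N"
    using a N by (auto simp: left_ideal_iff)
  then show "a \<in> ?P"
    by blast
  show "left_ideal ?P"
    unfolding left_ideal_iff
  proof (intro conjI ballI)
    show "?P \<subseteq> carrier R"
      using NR a by auto
    show "\<zero> \<in> ?P"
      using * \<open>\<zero> \<in> N\<close> by blast
  next
    fix u v assume "u \<in> ?P" "v \<in> ?P"
    then obtain x r y t where u: "u = x \<oplus> r \<otimes> a" "x \<in> N" "r \<in> carrier R"
      and v: "v = y \<oplus> t \<otimes> a" "y \<in> N" "t \<in> carrier R"
      by blast
    have "x \<in> carrier R" "y \<in> carrier R"
      using u v NR by auto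
    then have "u \<oplus> v = (x \<oplus> y) \<oplus> (r \<oplus> t) \<otimes> a"
      using u v a by (simp add: l_distr a_ac)
    moreover have "x \<oplus> y \<in> N" "r \<oplus> t \<in> carrier R"
      using u v N by (auto simp: left_ideal_iff)
    ultimately show "u \<oplus> v \<in> ?P"
      by blast
  next
    fix t u assume t: "t \<in> carrier R" and "u \<in> ?P"
    then obtain x r where u: "u = x \<oplus> r \<otimes> a" "x \<in> N" "r \<in> carrier R"
      by blast
    have "t \<otimes> u = t \<otimes> x \<oplus> (t \<otimes> r) \<otimes> a"
      using u t a NR by (simp add: r_distr m_assoc)
    moreover have "t \<otimes> x \<in> N" "t \<otimes> r \<in> carrier R"
      using u t N by (auto simp: left_ideal_iff)
    ultimately show "t \<otimes> u \<in> ?P"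
      by blast
  qed
qed

lemma (in ring) principal_left_ideal:
  assumes a: "a \<in> carrier R"
  shows "left_ideal {r \<otimes> a | r. r \<in> carrier R}"
    and "a \<in> {r \<otimes> a | r. r \<in> carrier R}"
proof -
  have "{x \<oplus> r \<otimes> a | x r. x \<in> {\<zero>} \<and> r \<in> carrier R} = {r \<otimes> a | r. r \<in> carrier R}"
    using a by force
  moreover have "left_ideal {\<zero>}"
    by (simp add: left_ideal_iff)
  ultimately show "left_ideal {r \<otimes> a | r. r \<in> carrier R}"
    "a \<in> {r \<otimes> a | r. r \<in> carrier R}"
    using left_ideal_add_principal(1,3)[of "{\<zero>}" a] a by auto
qed

text \<open>For \<open>a\<close> outside \<open>L\<close>, maximality means
  \<open>L + Ra = R\<close>, that is, \<open>a\<close> has a left inverse modulo \<open>L\<close>.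
  This elementwise form is the one used throughout.\<close>

lemma (in ring) maximal_left_ideal_iff:
  "maximal_left_ideal L \<longleftrightarrow> left_ideal L \<and> \<one> \<notin> L \<and>
     (\<forall>a\<in>carrier R - L. \<exists>r\<in>carrier R. \<one> \<ominus> r \<otimes> a \<in> L)"
proof -
  have eq: "N = carrier R \<longleftrightarrow> \<one> \<in> N" if "left_ideal N" for N
    using that by (auto simp: left_ideal_iff) (metis r_one)
  show ?thesis
  proof (intro iffI conjI ballI)
    assume L: "maximal_left_ideal L"
    then show sub: "left_ideal L"
      by (simp add: maximal_submodule_def)
    with L eq show "\<one> \<notin> L"
      by (auto simp: maximal_submodule_def)
    fix a assume a: "a \<in> carrier R - L"
    let ?P = "{x \<oplus> r \<otimes> a | x r. x \<in> L \<and> r \<in> carrier R}"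
    note P = left_ideal_add_principal[OF sub, of a]
    have "?P = carrier R"
    proof -
      have "?P \<noteq> L"
        using P(3) a by (metis DiffE)
      moreover have "?P = L \<or> ?P = carrier R"
        using L P(1,2) a unfolding maximal_submodule_def by simp
      ultimately show ?thesis
        by simp
    qed
    then have "\<one> \<in> ?P"
      by simp
    then obtain x r where x: "\<one> = x \<oplus> r \<otimes> a" "x \<in> L" "r \<in> carrier R"
      by blast
    have "x \<in> carrier R"
      using x sub by (auto simp: left_ideal_iff)
    then have eq: "\<one> \<ominus> r \<otimes> a = x"
      unfolding x(1) using x(2,3) a by (simp add: a_minus_def a_assoc r_neg)
    show "\<exists>r\<in>carrier R. \<one> \<ominus> r \<otimes> a \<in> L"
      using eq x(2,3) by auto
  next
    assume L: "left_ideal L \<and> \<one> \<notin> L \<and>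
      (\<forall>a\<in>carrier R - L. \<exists>r\<in>carrier R. \<one> \<ominus> r \<otimes> a \<in> L)"
    show "maximal_left_ideal L"
      unfolding maximal_submodule_def
    proof (intro conjI allI impI)
      fix N assume N: "left_ideal N \<and> L \<subseteq> N"
      show "N = L \<or> N = carrier (regular_module R)"
      proof (cases "N = L")
        case False
        with N obtain a where a: "a \<in> N" "a \<notin> L" "a \<in> carrier R"
          by (auto simp: left_ideal_iff)
        with L obtain r where r: "r \<in> carrier R" "\<one> \<ominus> r \<otimes> a \<in> N"
          using N by blast
        moreover have "r \<otimes> a \<in> N"
          using N a r by (auto simp: left_ideal_iff)
        ultimately have "\<one> \<in> N"
          using N left_ideal_mem_cong[of N \<one> "r \<otimes> a"] a by blast
        with N eq show ?thesis
          by simp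
      qed simp
    qed (use L in auto)
  qed
qed

section \<open>Finitely generated modules over an artinian ring\<close>

context module
begin

text \<open>Extension argument for \<open>P\<close> inside \<open>P + Rb\<close>: a chain is
  controlled by its traces on \<open>P\<close> and by the ideals of coefficients of \<open>b\<close>
  modulo \<open>P\<close>, and both sequences stabilise.\<close>

lemma chain_stable_add_cyclic:
  assumes art: "artinian_module R (regular_module R)"
    and P: "submodule P R M" and b: "b \<in> carrier M"
    and stable: "\<And>C. (\<forall>n::nat. submodule (C n) R M \<and> C (Suc n) \<subseteq> C n \<and> C n \<subseteq> P) \<Longrightarrow>
      \<exists>n. \<forall>k\<ge>n. C k = C n"
    and C: "\<And>n::nat. submodule (C n) R M" "\<And>n. C (Suc n) \<subseteq> C n"
      "\<And>n. C n \<subseteq> {x \<oplus>\<^bsub>M\<^esub> k \<odot>\<^bsub>M\<^esub> b | x k. x \<in> P \<and> k \<in> carrier R}"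
  shows "\<exists>n. \<forall>k\<ge>n. C k = C n"
proof -
  have Cn: "C n \<subseteq> C k" if "k \<le> n" for k n
    by (rule lift_Suc_antimono_le[of C, OF C(2) that])
  have CM: "C n \<subseteq> carrier M" and PM: "P \<subseteq> carrier M" for n
    using C(1)[of n] P by (auto simp: submodule_iff)
  \<comment> \<open>The coefficients of \<open>b\<close> that occur in \<open>C n\<close> up to a
    summand from \<open>P\<close>.\<close>
  define I where "I n = {k \<in> carrier R. \<exists>x\<in>P. k \<odot>\<^bsub>M\<^esub> b \<oplus>\<^bsub>M\<^esub> x \<in> C n}" for n
  have "submodule (I n) R (regular_module R)" for n
    unfolding R.left_ideal_iff
  proof (intro conjI ballI)
    show "\<zero> \<in> I n"
      using b P C(1)[of n] by (force simp: I_def submodule_iff intro!: bexI[of _ "\<zero>\<^bsub>M\<^esub>"])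
    fix k l assume "k \<in> I n" "l \<in> I n"
    then obtain x y where xy: "k \<in> carrier R" "l \<in> carrier R" "x \<in> P" "y \<in> P"
      "k \<odot>\<^bsub>M\<^esub> b \<oplus>\<^bsub>M\<^esub> x \<in> C n" "l \<odot>\<^bsub>M\<^esub> b \<oplus>\<^bsub>M\<^esub> y \<in> C n"
      by (auto simp: I_def)
    then have "(k \<odot>\<^bsub>M\<^esub> b \<oplus>\<^bsub>M\<^esub> x) \<oplus>\<^bsub>M\<^esub> (l \<odot>\<^bsub>M\<^esub> b \<oplus>\<^bsub>M\<^esub> y) \<in> C n"
      using C(1)[of n] by (simp add: submodule_iff)
    also have "(k \<odot>\<^bsub>M\<^esub> b \<oplus>\<^bsub>M\<^esub> x) \<oplus>\<^bsub>M\<^esub> (l \<odot>\<^bsub>M\<^esub> b \<oplus>\<^bsub>M\<^esub> y) = (k \<oplus> l) \<odot>\<^bsub>M\<^esub> b \<oplus>\<^bsub>M\<^esub> (x \<oplus>\<^bsub>M\<^esub> y)"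
      using xy PM b by (simp add: smult_l_distr M.add.m_ac subset_iff)
    finally show "k \<oplus> l \<in> I n"
      using xy P by (auto simp: I_def submodule_iff)
  next
    fix l k assume l: "l \<in> carrier R" and "k \<in> I n"
    then obtain x where x: "k \<in> carrier R" "x \<in> P" "k \<odot>\<^bsub>M\<^esub> b \<oplus>\<^bsub>M\<^esub> x \<in> C n"
      by (auto simp: I_def)
    then have "l \<odot>\<^bsub>M\<^esub> (k \<odot>\<^bsub>M\<^esub> b \<oplus>\<^bsub>M\<^esub> x) \<in> C n"
      using l C(1)[of n] by (simp add: submodule_iff)
    also have "l \<odot>\<^bsub>M\<^esub> (k \<odot>\<^bsub>M\<^esub> b \<oplus>\<^bsub>M\<^esub> x) = (l \<otimes> k) \<odot>\<^bsub>M\<^esub> b \<oplus>\<^bsub>M\<^esub> l \<odot>\<^bsub>M\<^esub> x"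
      using x l PM b by (simp add: smult_r_distr smult_assoc1 subset_iff)
    finally show "l \<otimes> k \<in> I n"
      using x l P by (auto simp: I_def submodule_iff)
  qed (auto simp: I_def)
  moreover have "I (Suc n) \<subseteq> I n" for n
    using C(2)[of n] by (auto simp: I_def)
  ultimately obtain p where p: "\<And>k. k \<ge> p \<Longrightarrow> I k = I p"
    using art unfolding artinian_module_def by meson
  have "\<forall>n. submodule (C n \<inter> P) R M \<and> C (Suc n) \<inter> P \<subseteq> C n \<inter> P \<and> C n \<inter> P \<subseteq> P"
    using C P submodule_Int by blast
  then obtain q where q: "\<And>k. k \<ge> q \<Longrightarrow> C k \<inter> P = C q \<inter> P"
    using stable[of "\<lambda>n. C n \<inter> P"] by meson
  define n where "n = max p q"
  \<comment> \<open>An element of \<open>C n\<close> and one of \<open>C k\<close> with the same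
    coefficient of \<open>b\<close> differ by an element of \<open>C n \<inter> P\<close>, which
    equals \<open>C k \<inter> P\<close>.\<close>
  have "C n \<subseteq> C k" if k: "k \<ge> n" for k
  proof
    fix x assume x: "x \<in> C n"
    with C(3)[of n] obtain y l where y: "y \<in> P" "l \<in> carrier R" "x = y \<oplus>\<^bsub>M\<^esub> l \<odot>\<^bsub>M\<^esub> b"
      by blast
    note yM = subsetD[OF PM y(1)]
    have "l \<in> I n"
      using x y b yM by (auto simp: I_def M.a_comm intro!: bexI[of _ y])
    then have "l \<in> I k"
      using p[of n] p[of k] k by (simp add: n_def)
    then obtain z where z: "z \<in> P" "l \<odot>\<^bsub>M\<^esub> b \<oplus>\<^bsub>M\<^esub> z \<in> C k"
      by (auto simp: I_def)
    note zM = subsetD[OF PM z(1)]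
    have "x \<ominus>\<^bsub>M\<^esub> (l \<odot>\<^bsub>M\<^esub> b \<oplus>\<^bsub>M\<^esub> z) \<in> C n"
      using submodule_minus[OF C(1) x] z(2) Cn[OF k] by blast
    moreover have eq: "x \<ominus>\<^bsub>M\<^esub> (l \<odot>\<^bsub>M\<^esub> b \<oplus>\<^bsub>M\<^esub> z) = y \<ominus>\<^bsub>M\<^esub> z"
      using y yM zM b by (simp add: a_minus_def M.minus_add M.add.m_ac M.r_neg M.r_neg1)
    moreover have "y \<ominus>\<^bsub>M\<^esub> z \<in> P"
      using submodule_minus[OF P] y z by blast
    ultimately have "x \<ominus>\<^bsub>M\<^esub> (l \<odot>\<^bsub>M\<^esub> b \<oplus>\<^bsub>M\<^esub> z) \<in> C k"
      using q[of n] q[of k] k unfolding n_def by auto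
    with z(2) have "(x \<ominus>\<^bsub>M\<^esub> (l \<odot>\<^bsub>M\<^esub> b \<oplus>\<^bsub>M\<^esub> z)) \<oplus>\<^bsub>M\<^esub> (l \<odot>\<^bsub>M\<^esub> b \<oplus>\<^bsub>M\<^esub> z) \<in> C k"
      using C(1)[of k] by (simp add: submodule_iff)
    also have "(x \<ominus>\<^bsub>M\<^esub> (l \<odot>\<^bsub>M\<^esub> b \<oplus>\<^bsub>M\<^esub> z)) \<oplus>\<^bsub>M\<^esub> (l \<odot>\<^bsub>M\<^esub> b \<oplus>\<^bsub>M\<^esub> z) = x"
      using x z(2) CM by (simp add: a_minus_def M.a_assoc M.l_neg subset_iff)
    finally show "x \<in> C k" .
  qed
  then show ?thesis
    using Cn by blast
qed

lemma fin_gen_artinian: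
  assumes art: "artinian_module R (regular_module R)" and fg: "fin_gen_module R M"
  shows "artinian_module R M"
proof -
  let ?span = "\<lambda>B. {(\<Oplus>\<^bsub>M\<^esub>b\<in>B. c b \<odot>\<^bsub>M\<^esub> b) | c. c \<in> B \<rightarrow> carrier R}"
  obtain B where B: "finite B" "B \<subseteq> carrier M"
    "\<And>N. submodule N R M \<Longrightarrow> B \<subseteq> N \<Longrightarrow> carrier M \<subseteq> N"
    using fin_gen_moduleE[OF fg] by blast
  have stab: "\<exists>n. \<forall>k\<ge>n. C k = C n"
    if "finite B" "B \<subseteq> carrier M"
      "\<forall>n::nat. submodule (C n) R M \<and> C (Suc n) \<subseteq> C n \<and> C n \<subseteq> ?span B" for B C
    using that
  proof (induction B arbitrary: C rule: finite_induct)
    case empty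
    then have "C n = {\<zero>\<^bsub>M\<^esub>}" for n
      by (force simp: submodule_iff)
    then show ?case
      by auto
  next
    case (insert b B)
    have "?span (insert b B) \<subseteq> {x \<oplus>\<^bsub>M\<^esub> k \<odot>\<^bsub>M\<^esub> b | x k. x \<in> ?span B \<and> k \<in> carrier R}"
    proof
      fix x assume "x \<in> ?span (insert b B)"
      then obtain c where c: "c \<in> insert b B \<rightarrow> carrier R" "x = (\<Oplus>\<^bsub>M\<^esub>b\<in>insert b B. c b \<odot>\<^bsub>M\<^esub> b)"
        by blast
      have cl: "(\<lambda>b. c b \<odot>\<^bsub>M\<^esub> b) \<in> B \<rightarrow> carrier M"
        using c insert.prems by auto
      have "x = (\<Oplus>\<^bsub>M\<^esub>b\<in>B. c b \<odot>\<^bsub>M\<^esub> b) \<oplus>\<^bsub>M\<^esub> c b \<odot>\<^bsub>M\<^esub> b"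
        using insert.hyps insert.prems c cl
        by (subst M.a_comm) (auto intro!: M.finsum_closed)
      then show "x \<in> {x \<oplus>\<^bsub>M\<^esub> k \<odot>\<^bsub>M\<^esub> b | x k. x \<in> ?span B \<and> k \<in> carrier R}"
        using c by (intro CollectI exI[of _ "\<Oplus>\<^bsub>M\<^esub>b\<in>B. c b \<odot>\<^bsub>M\<^esub> b"] exI[of _ "c b"]) auto
    qed
    then have sub: "C n \<subseteq> {x \<oplus>\<^bsub>M\<^esub> k \<odot>\<^bsub>M\<^esub> b | x k. x \<in> ?span B \<and> k \<in> carrier R}" for n
      using insert.prems(2) by (meson subset_trans)
    have span: "submodule (?span B) R M" and b: "b \<in> carrier M"
      using insert by (auto intro!: submodule_span)
    have stable: "\<exists>n. \<forall>k\<ge>n. D k = D n"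
      if "\<forall>n::nat. submodule (D n) R M \<and> D (Suc n) \<subseteq> D n \<and> D n \<subseteq> ?span B" for D
      by (rule insert.IH[OF _ that]) (use insert.prems(1) in simp)
    have "submodule (C n) R M" "C (Suc n) \<subseteq> C n" for n
      using insert.prems(2) by simp_all
    with art span b stable show ?case
      by (rule chain_stable_add_cyclic[where C = C]) (assumption, rule sub)
  qed
  have span: "C n \<subseteq> ?span B" if "submodule (C n) R M" for C :: "nat \<Rightarrow> 'c set" and n
  proof -
    have "B \<subseteq> ?span B"
      using span_base[OF B(1,2)] by (rule subsetI)
    then have "carrier M \<subseteq> ?span B"
      by (rule B(3)[OF submodule_span[OF B(1,2)]])
    moreover have "C n \<subseteq> carrier M"
      using that by (simp add: submodule_iff)
    ultimately show ?thesis
      by (rule order_trans[rotated])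
  qed
  show ?thesis
    unfolding artinian_module_def
  proof (intro allI impI)
    fix C :: "nat \<Rightarrow> 'c set"
    assume "\<forall>n. submodule (C n) R M \<and> C (Suc n) \<subseteq> C n"
    then have "\<forall>n. submodule (C n) R M \<and> C (Suc n) \<subseteq> C n \<and> C n \<subseteq> ?span B"
      using span by simp
    then show "\<exists>n. \<forall>k\<ge>n. C k = C n"
      by (rule stab[OF B(1,2)])
  qed
qed

text \<open>Zorn's lemma for the submodules between \<open>P\<close> and \<open>X\<close> that avoid
  \<open>y\<close>; unions of nonempty chains stay in this family.\<close>

lemma exists_submodule_maximal_without:
  assumes X: "submodule X R M" and P: "submodule P R M" "P \<subseteq> X" and y: "y \<in> X" "y \<notin> P"
  obtains N where "submodule N R M" "P \<subseteq> N" "N \<subseteq> X" "y \<notin> N"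
    "\<And>L. submodule L R M \<Longrightarrow> N \<subseteq> L \<Longrightarrow> L \<subseteq> X \<Longrightarrow> y \<notin> L \<Longrightarrow> L = N"
proof -
  let ?A = "{N. submodule N R M \<and> P \<subseteq> N \<and> N \<subseteq> X \<and> y \<notin> N}"
  have ex: "\<exists>N\<in>?A. \<forall>L\<in>?A. N \<subseteq> L \<longrightarrow> L = N"
  proof (rule subset_Zorn_nonempty)
    fix C assume C: "C \<noteq> {}" "subset.chain ?A C"
    then have CA: "C \<subseteq> ?A" and tot: "\<And>U V. U \<in> C \<Longrightarrow> V \<in> C \<Longrightarrow> U \<subseteq> V \<or> V \<subseteq> U"
      by (auto simp: subset.chain_def)
    have "submodule (\<Union>C) R M"
      unfolding submodule_iff
    proof (intro conjI ballI)
      fix u v assume "u \<in> \<Union>C" "v \<in> \<Union>C"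
      then obtain U V where UV: "U \<in> C" "V \<in> C" "u \<in> U" "v \<in> V"
        by blast
      with tot obtain W where "W \<in> C" "u \<in> W" "v \<in> W"
        by blast
      moreover from this CA have "submodule W R M"
        by blast
      ultimately show "u \<oplus>\<^bsub>M\<^esub> v \<in> \<Union>C"
        by (auto simp: submodule_iff)
    next
      fix k u assume "k \<in> carrier R" "u \<in> \<Union>C"
      with CA show "k \<odot>\<^bsub>M\<^esub> u \<in> \<Union>C"
        unfolding submodule_iff by blast
    next
      show "\<Union>C \<subseteq> carrier M"
        using CA by (auto simp: submodule_iff)
      obtain U where "U \<in> C"
        using C(1) by blast
      then show "\<zero>\<^bsub>M\<^esub> \<in> \<Union>C"
        using CA by (auto simp: submodule_iff)
    qed
    then show "\<Union>C \<in> ?A"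
      using C(1) CA by auto
  qed (use P y in auto)
  from ex show ?thesis
  proof (elim bexE)
    fix N assume N: "N \<in> ?A" "\<forall>L\<in>?A. N \<subseteq> L \<longrightarrow> L = N"
    show ?thesis
    proof (rule that[of N])
      fix L assume "submodule L R M" "N \<subseteq> L" "L \<subseteq> X" "y \<notin> L"
      moreover from this have "P \<subseteq> L"
        using N by auto
      ultimately show "L = N"
        using N by simp
    qed (use N in simp_all)
  qed
qed

end

text \<open>\<open>cover K M X Z\<close> states that \<open>X/Z\<close> is zero or simple.\<close>

definition cover ::
    "[('k, 'y) ring_scheme, ('k, 'a, 'u) module_scheme, 'a set, 'a set] \<Rightarrow> bool" where
  "cover K M X Z \<longleftrightarrow> submodule X K M \<and> submodule Z K M \<and> Z \<subseteq> X \<and>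
    (\<forall>u\<in>X - Z. \<forall>v\<in>X. \<exists>k\<in>carrier K. v \<ominus>\<^bsub>M\<^esub> k \<odot>\<^bsub>M\<^esub> u \<in> Z)"

text \<open>An ideal that is maximal among those above \<open>A\<close> and avoiding 1 is a maximal
  ideal, because an ideal containing 1 is everything.\<close>

lemma (in cring) exists_maximal_ideal:
  assumes A: "submodule A R (regular_module R)" "\<one> \<notin> A"
  shows "\<exists>I. maximal_submodule I R (regular_module R) \<and> A \<subseteq> I"
proof -
  interpret reg: module R "regular_module R"
    by (rule regular_module_is_module)
  have carr: "submodule (carrier R) R (regular_module R)"
    using reg.carrier_is_submodule by simp
  have AR: "A \<subseteq> carrier R"
    using A by (simp add: left_ideal_iff)
  show ?thesis
  proof (rule reg.exists_submodule_maximal_without[OF carr A(1) AR one_closed A(2)])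
    fix I
    assume I: "submodule I R (regular_module R)" "A \<subseteq> I" "\<one> \<notin> I"
      and Imax: "\<And>L. submodule L R (regular_module R) \<Longrightarrow> I \<subseteq> L \<Longrightarrow> L \<subseteq> carrier R \<Longrightarrow> \<one> \<notin> L \<Longrightarrow> L = I"
    have "maximal_submodule I R (regular_module R)"
      unfolding maximal_submodule_def
    proof (intro conjI allI impI)
      show "I \<noteq> carrier (regular_module R)"
        using I(3) by auto
      fix L assume L: "submodule L R (regular_module R) \<and> I \<subseteq> L"
      show "L = I \<or> L = carrier (regular_module R)"
      proof (cases "\<one> \<in> L")
        case True
        then have "x \<in> L" if "x \<in> carrier R" for x
          using L that r_one[of x] unfolding left_ideal_iff by metis
        then show ?thesis
          using L by (auto simp: left_ideal_iff)
      next
        case False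
        then show ?thesis
          using L Imax by (simp add: left_ideal_iff)
      qed
    qed (use I in auto)
    with I(2) show ?thesis
      by blast
  qed
qed

section \<open>Covers and their existence\<close>

context module
begin

lemma coverD:
  assumes "cover R M X Z"
  shows "submodule X R M" "submodule Z R M" "Z \<subseteq> X" "X \<subseteq> carrier M"
    "\<And>u v. u \<in> X \<Longrightarrow> u \<notin> Z \<Longrightarrow> v \<in> X \<Longrightarrow> \<exists>k\<in>carrier R. v \<ominus>\<^bsub>M\<^esub> k \<odot>\<^bsub>M\<^esub> u \<in> Z"
  using assms by (auto simp: cover_def submodule_iff)

text \<open>Transitivity of congruence up to scalars: modulo \<open>N\<close>, \<open>w\<close> is
  \<open>l v\<close> and hence \<open>(l k) u\<close>.\<close>

lemma diff_smult_trans: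
  assumes N: "submodule N R M" and M: "u \<in> carrier M" "v \<in> carrier M" "w \<in> carrier M"
    and R: "k \<in> carrier R" "l \<in> carrier R"
    and "v \<ominus>\<^bsub>M\<^esub> k \<odot>\<^bsub>M\<^esub> u \<in> N" "w \<ominus>\<^bsub>M\<^esub> l \<odot>\<^bsub>M\<^esub> v \<in> N"
  shows "w \<ominus>\<^bsub>M\<^esub> (l \<otimes> k) \<odot>\<^bsub>M\<^esub> u \<in> N"
proof -
  have "(w \<ominus>\<^bsub>M\<^esub> l \<odot>\<^bsub>M\<^esub> v) \<oplus>\<^bsub>M\<^esub> l \<odot>\<^bsub>M\<^esub> (v \<ominus>\<^bsub>M\<^esub> k \<odot>\<^bsub>M\<^esub> u) \<in> N"
    using assms by (simp add: submodule_iff)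
  also have "(w \<ominus>\<^bsub>M\<^esub> l \<odot>\<^bsub>M\<^esub> v) \<oplus>\<^bsub>M\<^esub> l \<odot>\<^bsub>M\<^esub> (v \<ominus>\<^bsub>M\<^esub> k \<odot>\<^bsub>M\<^esub> u) =
    w \<oplus>\<^bsub>M\<^esub> (\<ominus>\<^bsub>M\<^esub> (l \<odot>\<^bsub>M\<^esub> v) \<oplus>\<^bsub>M\<^esub> (l \<odot>\<^bsub>M\<^esub> v \<oplus>\<^bsub>M\<^esub> \<ominus>\<^bsub>M\<^esub> (l \<odot>\<^bsub>M\<^esub> (k \<odot>\<^bsub>M\<^esub> u))))"
    using M R by (simp add: a_minus_def smult_r_distr smult_r_minus M.a_assoc)
  also have "\<dots> = w \<ominus>\<^bsub>M\<^esub> (l \<otimes> k) \<odot>\<^bsub>M\<^esub> u"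
    using M R by (simp add: a_minus_def smult_assoc1 M.r_neg1)
  finally show ?thesis .
qed

text \<open>Since \<open>I X\<close> lies in \<open>P\<close>, the quotient \<open>X/P\<close> is a
  vector space over the field \<open>R/I\<close>. A submodule \<open>N\<close> maximal among those
  omitting \<open>y\<close> is then a hyperplane, and the class of \<open>y\<close> spans
  \<open>X/N\<close>.\<close>

lemma exists_cover:
  assumes max: "maximal_submodule I R (regular_module R)"
    and X: "submodule X R M" and P: "submodule P R M" "P \<subseteq> X"
    and I: "\<And>p x. p \<in> I \<Longrightarrow> x \<in> X \<Longrightarrow> p \<odot>\<^bsub>M\<^esub> x \<in> P"
    and y: "y \<in> X" "y \<notin> P"
  shows "\<exists>N. cover R M X N \<and> P \<subseteq> N \<and> N \<noteq> X"
proof -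
  obtain N where N: "submodule N R M" "P \<subseteq> N" "N \<subseteq> X" "y \<notin> N"
    and Nmax: "\<And>L. submodule L R M \<Longrightarrow> N \<subseteq> L \<Longrightarrow> L \<subseteq> X \<Longrightarrow> y \<notin> L \<Longrightarrow> L = N"
    using exists_submodule_maximal_without[OF X P y] by blast
  have XM: "x \<in> carrier M" if "x \<in> X" for x
    using that X by (auto simp: submodule_iff)
  have NM: "x \<in> carrier M" if "x \<in> N" for x
    using that N XM by auto
  have I': "I \<subseteq> carrier R" "\<And>k. k \<in> carrier R \<Longrightarrow> k \<notin> I \<Longrightarrow> \<exists>l\<in>carrier R. \<one> \<ominus> l \<otimes> k \<in> I"
    using max unfolding R.maximal_left_ideal_iff R.left_ideal_iff by auto
  have y_cong: "\<exists>k\<in>carrier R. y \<ominus>\<^bsub>M\<^esub> k \<odot>\<^bsub>M\<^esub> u \<in> N" if u: "u \<in> X" "u \<notin> N" for u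
  proof -
    let ?L = "{x \<oplus>\<^bsub>M\<^esub> k \<odot>\<^bsub>M\<^esub> u | x k. x \<in> N \<and> k \<in> carrier R}"
    note L = submodule_add_cyclic[OF N(1) XM[OF u(1)]] submodule_add_cyclicI[OF N(1) XM[OF u(1)]]
    have "?L \<subseteq> X"
      using N(3) X u by (auto simp: submodule_iff)
    moreover have "?L \<noteq> N"
      using L(3) u(2) by metis
    ultimately have "y \<in> ?L"
      using Nmax[OF L(1,2)] by metis
    then obtain n k where n: "y = n \<oplus>\<^bsub>M\<^esub> k \<odot>\<^bsub>M\<^esub> u" "n \<in> N" "k \<in> carrier R"
      by blast
    then have "y \<ominus>\<^bsub>M\<^esub> k \<odot>\<^bsub>M\<^esub> u = n"
      using NM XM[OF u(1)] by (simp add: a_minus_def M.a_assoc M.r_neg)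
    then show ?thesis
      using n(2,3) by auto
  qed
  \<comment> \<open>The scalar \<open>k\<close> with \<open>y\<close> congruent to
    \<open>k u\<close> is not in \<open>I\<close>, since otherwise \<open>k u\<close> and with it
    \<open>y\<close> would lie in \<open>N\<close>. An inverse \<open>l\<close> of \<open>k\<close>
    modulo \<open>I\<close> then gives \<open>u\<close> congruent to \<open>l y\<close>.\<close>
  have cong_y: "\<exists>l\<in>carrier R. u \<ominus>\<^bsub>M\<^esub> l \<odot>\<^bsub>M\<^esub> y \<in> N" if u: "u \<in> X" "u \<notin> N" for u
  proof -
    obtain k where k: "k \<in> carrier R" "y \<ominus>\<^bsub>M\<^esub> k \<odot>\<^bsub>M\<^esub> u \<in> N"
      using y_cong[OF u] by blast
    have "k \<notin> I"
    proof
      assume "k \<in> I"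
      then have "k \<odot>\<^bsub>M\<^esub> u \<in> N"
        using I u N by blast
      then have "(y \<ominus>\<^bsub>M\<^esub> k \<odot>\<^bsub>M\<^esub> u) \<oplus>\<^bsub>M\<^esub> k \<odot>\<^bsub>M\<^esub> u \<in> N"
        using k N by (simp add: submodule_iff)
      then show False
        using N(4) k y u XM by (simp add: a_minus_def M.a_assoc M.l_neg)
    qed
    then obtain l where l: "l \<in> carrier R" "\<one> \<ominus> l \<otimes> k \<in> I"
      using I' k by blast
    have "(\<one> \<ominus> l \<otimes> k) \<odot>\<^bsub>M\<^esub> u \<in> N"
      using I l u N by blast
    then have 1: "u \<ominus>\<^bsub>M\<^esub> (l \<otimes> k) \<odot>\<^bsub>M\<^esub> u \<in> N"
      using l k XM[OF u(1)] by (simp add: a_minus_def smult_l_distr smult_l_minus)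
    have "l \<odot>\<^bsub>M\<^esub> (y \<ominus>\<^bsub>M\<^esub> k \<odot>\<^bsub>M\<^esub> u) \<in> N"
      using k l N by (simp add: submodule_iff)
    then have "(u \<ominus>\<^bsub>M\<^esub> (l \<otimes> k) \<odot>\<^bsub>M\<^esub> u) \<ominus>\<^bsub>M\<^esub> l \<odot>\<^bsub>M\<^esub> (y \<ominus>\<^bsub>M\<^esub> k \<odot>\<^bsub>M\<^esub> u) \<in> N"
      using submodule_minus[OF N(1) 1] by blast
    also have "(u \<ominus>\<^bsub>M\<^esub> (l \<otimes> k) \<odot>\<^bsub>M\<^esub> u) \<ominus>\<^bsub>M\<^esub> l \<odot>\<^bsub>M\<^esub> (y \<ominus>\<^bsub>M\<^esub> k \<odot>\<^bsub>M\<^esub> u) = u \<ominus>\<^bsub>M\<^esub> l \<odot>\<^bsub>M\<^esub> y"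
      using l k XM[OF u(1)] XM[OF y(1)]
      by (simp add: a_minus_def smult_r_distr smult_r_minus smult_assoc1 M.minus_add M.add.m_ac
          M.r_neg M.r_neg1)
    finally show ?thesis
      using l by blast
  qed
  have "cover R M X N"
    unfolding cover_def
  proof (intro conjI ballI)
    fix u v assume u: "u \<in> X - N" and v: "v \<in> X"
    show "\<exists>k\<in>carrier R. v \<ominus>\<^bsub>M\<^esub> k \<odot>\<^bsub>M\<^esub> u \<in> N"
    proof (cases "v \<in> N")
      case True
      then show ?thesis
        using submodule_minus[OF N(1) True, of "\<zero>\<^bsub>M\<^esub>"] N(1) u XM
        by (intro bexI[of _ \<zero>]) (auto simp: submodule_iff)
    next
      case False
      then show ?thesis
        using diff_smult_trans[OF N(1)] y_cong[of u] cong_y[of v] u v y XM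
        by (metis Diff_iff R.m_closed)
    qed
  qed (use N X in auto)
  then show ?thesis
    using N y by blast
qed

text \<open>
  A maximal ideal \<open>I\<close> with \<open>IX + Y \<noteq> X\<close> yields the required \<open>Z\<close>. If there were none, choose an ideal
  minimal among those \<open>L\<close> with \<open>LX\<close> not contained in \<open>Y\<close>; it is generated by some \<open>l\<close>. A maximal ideal
  \<open>I\<close> containing the annihilator of \<open>l\<close> then satisfies \<open>l \<in> Il\<close>, which is impossible.
\<close>

lemma exists_cover_above:
  assumes art: "artinian_module R (regular_module R)"
    and X: "submodule X R M" and Y: "submodule Y R M" "Y \<subseteq> X" "Y \<noteq> X"
  shows "\<exists>Z. cover R M X Z \<and> Y \<subseteq> Z \<and> Z \<noteq> X"
proof (rule ccontr)
  assume "\<not> ?thesis"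
  then have nocover: "\<And>Z. cover R M X Z \<Longrightarrow> Y \<subseteq> Z \<Longrightarrow> Z = X"
    by blast
  interpret reg: module R "regular_module R"
    by (rule R.regular_module_is_module)
  let ?\<N> = "{L. submodule L R (regular_module R) \<and> (\<exists>l\<in>L. \<exists>x\<in>X. l \<odot>\<^bsub>M\<^esub> x \<notin> Y)}"
  have XM: "x \<in> carrier M" if "x \<in> X" for x
    using that X by (auto simp: submodule_iff)
  obtain x0 where x0: "x0 \<in> X" "x0 \<notin> Y"
    using Y by blast
  have "carrier R \<in> ?\<N>"
    using reg.carrier_is_submodule x0 XM
    by (auto intro!: bexI[of _ \<one>] bexI[of _ x0])
  then obtain L where L: "L \<in> ?\<N>" and Lmin: "\<And>N. N \<in> ?\<N> \<Longrightarrow> N \<subseteq> L \<Longrightarrow> N = L"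
    using artinian_module_minimal[OF art, of ?\<N>] by blast
  from L obtain l x where l: "l \<in> L" "x \<in> X" "l \<odot>\<^bsub>M\<^esub> x \<notin> Y"
    by blast
  have L': "submodule L R (regular_module R)"
    using L by blast
  have lR: "l \<in> carrier R"
    using l L' by (auto simp: R.left_ideal_iff)
  have gen: "{k \<otimes> a | k. k \<in> carrier R} = L" if "a \<in> L" "\<exists>x\<in>X. a \<odot>\<^bsub>M\<^esub> x \<notin> Y" for a
  proof (rule Lmin)
    have "a \<in> carrier R"
      using that L' by (auto simp: R.left_ideal_iff)
    then show "{k \<otimes> a | k. k \<in> carrier R} \<in> ?\<N>"
      using R.principal_left_ideal[of a] that(2) by blast
    show "{k \<otimes> a | k. k \<in> carrier R} \<subseteq> L"
      using L' that(1) by (auto simp: R.left_ideal_iff)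
  qed
  let ?A = "{k \<in> carrier R. k \<otimes> l = \<zero>}"
  have A: "submodule ?A R (regular_module R)"
    using lR by (auto simp: R.left_ideal_iff R.l_distr R.m_assoc)
  have "\<one> \<notin> ?A"
    using l XM Y lR by (auto simp: submodule_iff)
  then obtain I where max: "maximal_submodule I R (regular_module R)" and AI: "?A \<subseteq> I"
    using R.exists_maximal_ideal[OF A] by blast
  have I: "submodule I R (regular_module R)" "?A \<subseteq> I" "\<one> \<notin> I"
    using max AI by (simp_all add: R.maximal_left_ideal_iff)
  have IR: "i \<in> carrier R" if "i \<in> I" for i
    using that I(1) by (auto simp: R.left_ideal_iff)
  let ?P = "{x \<in> X. l \<odot>\<^bsub>M\<^esub> x \<in> Y}"
  have P: "submodule ?P R M"
    unfolding submodule_iff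
  proof (intro conjI ballI)
    fix k u assume ku: "k \<in> carrier R" "u \<in> ?P"
    then have "l \<odot>\<^bsub>M\<^esub> (k \<odot>\<^bsub>M\<^esub> u) = k \<odot>\<^bsub>M\<^esub> (l \<odot>\<^bsub>M\<^esub> u)"
      using lR XM by (metis (no_types, lifting) R.m_comm mem_Collect_eq smult_assoc1)
    then show "k \<odot>\<^bsub>M\<^esub> u \<in> ?P"
      using ku X Y by (auto simp: submodule_iff)
  qed (use X Y lR XM in \<open>auto simp: submodule_iff smult_r_distr\<close>)
  \<comment> \<open>This leads to \<open>l\<close> in \<open>I l\<close>. If \<open>I X\<close> were
    inside \<open>?P\<close>, \<open>exists_cover\<close> would produce a cover that
    \<open>nocover\<close> excludes. So some \<open>(p l) u\<close> with \<open>p\<close> in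
    \<open>I\<close> avoids \<open>Y\<close>, and by minimality \<open>p l\<close> generates
    \<open>L\<close>, which contains \<open>l\<close>.\<close>
  have "\<exists>p\<in>I. \<exists>u\<in>X. p \<odot>\<^bsub>M\<^esub> u \<notin> ?P"
  proof (rule ccontr)
    assume "\<not> ?thesis"
    then have "\<And>p u. p \<in> I \<Longrightarrow> u \<in> X \<Longrightarrow> p \<odot>\<^bsub>M\<^esub> u \<in> ?P"
      by blast
    moreover have "x \<notin> ?P" "?P \<subseteq> X" "Y \<subseteq> ?P"
      using l Y lR by (auto simp: submodule_iff)
    ultimately obtain N where "cover R M X N" "?P \<subseteq> N" "N \<noteq> X"
      using exists_cover[OF max X P, of x] l(2) by blast
    then show False
      using nocover \<open>Y \<subseteq> ?P\<close> by blast
  qed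
  then obtain p u where p: "p \<in> I" "u \<in> X" "l \<odot>\<^bsub>M\<^esub> (p \<odot>\<^bsub>M\<^esub> u) \<notin> Y"
    using X IR by (auto simp: submodule_iff)
  have pl: "(p \<otimes> l) \<odot>\<^bsub>M\<^esub> u \<notin> Y"
    using p lR IR XM by (metis R.m_comm smult_assoc1)
  have "p \<otimes> l \<in> L"
    using l L' p IR by (simp add: R.left_ideal_iff)
  with gen[of "p \<otimes> l"] p(2) pl l(1) obtain k where k: "k \<in> carrier R" "l = k \<otimes> (p \<otimes> l)"
    by blast
  have "(\<one> \<ominus> k \<otimes> p) \<otimes> l = l \<ominus> k \<otimes> (p \<otimes> l)"
    using k(1) lR IR[OF p(1)] by algebra
  also have "\<dots> = \<zero>"
    using k lR by (metis R.minus_eq R.r_neg)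
  finally have "\<one> \<ominus> k \<otimes> p \<in> I"
    using I(2) k(1) IR[OF p(1)] by auto
  moreover have "k \<otimes> p \<in> I"
    using I(1) p(1) k(1) by (simp add: R.left_ideal_iff)
  ultimately have "\<one> \<in> I"
    using R.left_ideal_mem_cong[OF I(1), of \<one> "k \<otimes> p"] k(1) IR[OF p(1)] by simp
  with I(3) show False ..
qed

end

section \<open>Length and duality\<close>

text \<open>Composition series consist of strict covers, but their orthogonals are at first known
  only to form covers, where a factor may vanish. The length comparison has to relate the two kinds
  of chain.\<close>

abbreviation strict_cover ::
    "[('k, 'y) ring_scheme, ('k, 'a, 'u) module_scheme, 'a set, 'a set] \<Rightarrow> bool" where
  "strict_cover K M X Z \<equiv> cover K M X Z \<and> X \<noteq> Z"

context module
begin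

lemma cover_chain_subset: "(cover R M ^^ n) X Z \<Longrightarrow> Z \<subseteq> X"
proof (induction n arbitrary: X)
  case (Suc n)
  then obtain Y where "cover R M X Y" "(cover R M ^^ n) Y Z"
    by (blast dest: relpowp_Suc_D2)
  then show ?case
    using Suc.IH[of Y] coverD(3)[of X Y] by blast
qed auto

text \<open>
  The rank of \<open>U\<close> counts the steps from \<open>W\<close> to \<open>W'\<close> of the chain with \<open>U \<inter> W\<close> not contained in \<open>W'\<close>;
  it replaces the Jordan-Hoelder theorem in comparing lengths of chains.
\<close>

lemma cover_chain_rank:
  assumes "(cover R M ^^ n) X Z"
  shows "\<exists>d :: 'c set \<Rightarrow> nat. \<forall>U V. submodule U R M \<and> submodule V R M \<and> Z \<subseteq> U \<and> U \<subseteq> V \<and> V \<subseteq> X \<longrightarrow>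
    d U \<le> d V \<and> d V \<le> n \<and> (d U = d V \<longrightarrow> U = V)"
  using assms
proof (induction n arbitrary: X)
  case 0
  then show ?case
    by (intro exI[of _ "\<lambda>_. 0"]) auto
next
  case (Suc n)
  from relpowp_Suc_D2[OF Suc.prems] obtain Y where Y: "cover R M X Y" "(cover R M ^^ n) Y Z"
    by blast
  from Suc.IH[OF Y(2)] obtain d :: "'c set \<Rightarrow> nat"
    where "\<forall>U V. submodule U R M \<and> submodule V R M \<and> Z \<subseteq> U \<and> U \<subseteq> V \<and> V \<subseteq> Y \<longrightarrow>
      d U \<le> d V \<and> d V \<le> n \<and> (d U = d V \<longrightarrow> U = V)" ..
  then have d: "\<And>U V. submodule U R M \<Longrightarrow> submodule V R M \<Longrightarrow> Z \<subseteq> U \<Longrightarrow>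
      U \<subseteq> V \<Longrightarrow> V \<subseteq> Y \<Longrightarrow> d U \<le> d V \<and> d V \<le> n \<and> (d U = d V \<longrightarrow> U = V)"
    by simp
  note ZY = cover_chain_subset[OF Y(2)]
  note YX = coverD[OF Y(1)]
  define d' where "d' U = d (U \<inter> Y) + (if U \<subseteq> Y then 0 else 1)" for U
  have "d' U \<le> d' V \<and> d' V \<le> Suc n \<and> (d' U = d' V \<longrightarrow> U = V)"
    if UV: "submodule U R M" "submodule V R M" "Z \<subseteq> U" "U \<subseteq> V" "V \<subseteq> X" for U V
  proof -
    have *: "d (U \<inter> Y) \<le> d (V \<inter> Y) \<and> d (V \<inter> Y) \<le> n \<and> (d (U \<inter> Y) = d (V \<inter> Y) \<longrightarrow> U \<inter> Y = V \<inter> Y)"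
      using UV ZY YX submodule_Int by (intro d) auto
    \<comment> \<open>Modular law: for \<open>u\<close> in \<open>U\<close> outside
      \<open>Y\<close>, every \<open>v\<close> in \<open>V\<close> is congruent to a multiple of
      \<open>u\<close> modulo \<open>Y\<close>, and the difference lies in
      \<open>V \<inter> Y = U \<inter> Y\<close>.\<close>
    have "U = V" if "U \<inter> Y = V \<inter> Y" "U \<subseteq> Y \<longleftrightarrow> V \<subseteq> Y"
    proof (cases "U \<subseteq> Y")
      case True
      with that show ?thesis
        by blast
    next
      case False
      then obtain u where u: "u \<in> U" "u \<notin> Y"
        by blast
      have "v \<in> U" if v: "v \<in> V" for v
      proof -
        have M: "u \<in> carrier M" "v \<in> carrier M"
          using u v UV by (auto simp: submodule_iff)
        obtain k where k: "k \<in> carrier R" "v \<ominus>\<^bsub>M\<^esub> k \<odot>\<^bsub>M\<^esub> u \<in> Y"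
          using YX(5)[of u v] u v UV by blast
        have "k \<odot>\<^bsub>M\<^esub> u \<in> U"
          using u UV k by (simp add: submodule_iff)
        moreover have "v \<ominus>\<^bsub>M\<^esub> k \<odot>\<^bsub>M\<^esub> u \<in> V"
          using submodule_minus[OF UV(2) v] \<open>k \<odot>\<^bsub>M\<^esub> u \<in> U\<close> UV(4) by blast
        ultimately have "(v \<ominus>\<^bsub>M\<^esub> k \<odot>\<^bsub>M\<^esub> u) \<oplus>\<^bsub>M\<^esub> k \<odot>\<^bsub>M\<^esub> u \<in> U"
          using k(2) \<open>U \<inter> Y = V \<inter> Y\<close> UV(1) unfolding submodule_iff by blast
        then show "v \<in> U"
          using M k by (simp add: a_minus_def M.a_assoc M.l_neg)
      qed
      with UV(4) show ?thesis
        by blast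
    qed
    then show ?thesis
      using * UV(4) unfolding d'_def by (auto split: if_splits)
  qed
  then show ?case
    by (intro exI[of _ d']) blast
qed

text \<open>The rank attached to the chain of covers is at most \<open>n\<close> and grows strictly
  along each strict cover.\<close>

lemma strict_cover_chain_length_le:
  assumes "(cover R M ^^ n) X Z" "(strict_cover R M ^^ k) X Z" "submodule X R M"
  shows "k \<le> n"
proof -
  from cover_chain_rank[OF assms(1)] obtain d :: "'c set \<Rightarrow> nat"
    where "\<forall>U V. submodule U R M \<and> submodule V R M \<and> Z \<subseteq> U \<and> U \<subseteq> V \<and> V \<subseteq> X \<longrightarrow>
      d U \<le> d V \<and> d V \<le> n \<and> (d U = d V \<longrightarrow> U = V)" ..
  then have d: "\<And>U V. submodule U R M \<Longrightarrow> submodule V R M \<Longrightarrow> Z \<subseteq> U \<Longrightarrow>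
      U \<subseteq> V \<Longrightarrow> V \<subseteq> X \<Longrightarrow> d U \<le> d V \<and> d V \<le> n \<and> (d U = d V \<longrightarrow> U = V)"
    by simp
  have "d Z + k \<le> d Y \<and> Z \<subseteq> Y" if "(strict_cover R M ^^ k) Y Z" "submodule Y R M" "Y \<subseteq> X" for Y
    using that
  proof (induction k arbitrary: Y)
    case (Suc k)
    from relpowp_Suc_D2[OF Suc.prems(1)] obtain W
      where W: "cover R M Y W" "Y \<noteq> W" "(strict_cover R M ^^ k) W Z"
      by blast
    note YW = coverD[OF W(1)]
    have "d Z + k \<le> d W \<and> Z \<subseteq> W"
      using Suc.IH[OF W(3)] YW Suc.prems by blast
    moreover from this have "d W \<le> d Y \<and> (d W = d Y \<longrightarrow> W = Y)"
      using d[of W Y] YW Suc.prems by blast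
    ultimately show ?case
      using W(2) YW(3) by auto
  qed auto
  from this[OF assms(2,3)] have "d Z + k \<le> d X" "Z \<subseteq> X"
    by simp_all
  moreover have "d X \<le> n"
    using d[of X X] assms(3) \<open>Z \<subseteq> X\<close> by blast
  ultimately show ?thesis
    by simp
qed

text \<open>Take \<open>Z\<close> minimal among the submodules above \<open>Y\<close> that are
  reached from \<open>X\<close> in finitely many strict steps. If \<open>Z\<close> were different
  from \<open>Y\<close>, \<open>exists_cover_above\<close> would allow one more step.\<close>

lemma exists_strict_cover_chain:
  assumes art: "artinian_module R (regular_module R)" "artinian_module R M"
    and X: "submodule X R M" and Y: "submodule Y R M" "Y \<subseteq> X"
  shows "\<exists>n. (strict_cover R M ^^ n) X Y"
proof -
  let ?\<N> = "{Z. submodule Z R M \<and> Y \<subseteq> Z \<and> Z \<subseteq> X \<and> (\<exists>n. (strict_cover R M ^^ n) X Z)}"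
  have "X \<in> ?\<N>"
    using X Y by (auto intro: exI[of _ 0])
  then have ne: "?\<N> \<noteq> {}"
    by blast
  show ?thesis
  proof (rule artinian_module_minimal[OF art(2) ne])
    fix Z assume Z: "Z \<in> ?\<N>" and min: "\<And>L. L \<in> ?\<N> \<Longrightarrow> L \<subseteq> Z \<Longrightarrow> L = Z"
    from Z obtain n where n: "(strict_cover R M ^^ n) X Z"
      by blast
    show ?thesis
    proof (cases "Y = Z")
      case True
      with n show ?thesis
        by blast
    next
      case False
      then obtain W where W: "cover R M Z W" "Y \<subseteq> W" "W \<noteq> Z"
        using exists_cover_above[OF art(1), of Z Y] Z Y by blast
      note ZW = coverD[OF W(1)]
      have "(strict_cover R M ^^ Suc n) X W"
        using n W by (auto intro: relpowp_Suc_I)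
      then have "W \<in> ?\<N>"
        using Z W ZW by blast
      with min[of W] W ZW show ?thesis
        by blast
    qed
  qed blast
qed

end

text \<open>The annihilator of a maximal ideal \<open>I\<close> is a vector space over
  \<open>K/I\<close>, and the condition bounds its dimension by one: each simple module occurs at
  most once in the socle of \<open>K\<close>. Together with the descending chain condition this is
  all that the duality takes from the Frobenius property of \<open>K\<close>.\<close>

definition annihilators_cyclic :: "('k, 'y) ring_scheme \<Rightarrow> bool" where
  "annihilators_cyclic K \<longleftrightarrow>
    (\<forall>I c d. maximal_submodule I K (regular_module K) \<and> c \<in> carrier K \<and> d \<in> carrier K \<and>
      (\<forall>p\<in>I. p \<otimes>\<^bsub>K\<^esub> c = \<zero>\<^bsub>K\<^esub> \<and> p \<otimes>\<^bsub>K\<^esub> d = \<zero>\<^bsub>K\<^esub>) \<and> c \<noteq> \<zero>\<^bsub>K\<^esub> \<longrightarrow>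
      (\<exists>k\<in>carrier K. d = k \<otimes>\<^bsub>K\<^esub> c))"

text \<open>The right orthogonal. The left one is the same notion for the flipped form
  \<open>\<lambda>x y. F y x\<close>, so results on \<open>perp\<close> serve both sides through
  \<open>flip\<close>.\<close>

definition perp ::
    "[('k, 'y) ring_scheme, ('k, 'a, 'u) module_scheme, 'a \<Rightarrow> 'a \<Rightarrow> 'k, 'a set] \<Rightarrow> 'a set" where
  "perp K M F N = {x \<in> carrier M. \<forall>n\<in>N. F n x = \<zero>\<^bsub>K\<^esub>}"

locale nondegenerate_pairing = module K M for K (structure) and M (structure) +
  fixes F
  assumes bilinear: "bilinear_form K M F" and nondegenerate: "nondegenerate_form M F"
begin

lemma F_closed [simp]: "x \<in> carrier M \<Longrightarrow> y \<in> carrier M \<Longrightarrow> F x y \<in> carrier K"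
  and F_add_left: "x \<in> carrier M \<Longrightarrow> y \<in> carrier M \<Longrightarrow> z \<in> carrier M \<Longrightarrow>
    F (x \<oplus>\<^bsub>M\<^esub> y) z = F x z \<oplus> F y z"
  and F_add_right: "x \<in> carrier M \<Longrightarrow> y \<in> carrier M \<Longrightarrow> z \<in> carrier M \<Longrightarrow>
    F x (y \<oplus>\<^bsub>M\<^esub> z) = F x y \<oplus> F x z"
  and F_smult_left: "k \<in> carrier K \<Longrightarrow> x \<in> carrier M \<Longrightarrow> y \<in> carrier M \<Longrightarrow>
    F (k \<odot>\<^bsub>M\<^esub> x) y = k \<otimes> F x y"
  and F_smult_right: "k \<in> carrier K \<Longrightarrow> x \<in> carrier M \<Longrightarrow> y \<in> carrier M \<Longrightarrow>
    F x (k \<odot>\<^bsub>M\<^esub> y) = k \<otimes> F x y"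
  using bilinear by (simp_all add: bilinear_form_def)

lemma F_zero_left [simp]: "x \<in> carrier M \<Longrightarrow> F \<zero>\<^bsub>M\<^esub> x = \<zero>"
  using F_smult_left[of \<zero> "\<zero>\<^bsub>M\<^esub>" x] by simp

lemma F_zero_right [simp]: "x \<in> carrier M \<Longrightarrow> F x \<zero>\<^bsub>M\<^esub> = \<zero>"
  using F_smult_right[of \<zero> x "\<zero>\<^bsub>M\<^esub>"] by simp

lemma F_uminus_right: "x \<in> carrier M \<Longrightarrow> y \<in> carrier M \<Longrightarrow> F x (\<ominus>\<^bsub>M\<^esub> y) = \<ominus> F x y"
  using F_smult_right[of "\<ominus> \<one>" x y] by (simp add: smult_l_minus R.l_minus)

lemma F_minus_right:
  "x \<in> carrier M \<Longrightarrow> y \<in> carrier M \<Longrightarrow> z \<in> carrier M \<Longrightarrow> F x (y \<ominus>\<^bsub>M\<^esub> z) = F x y \<ominus> F x z"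
  by (simp add: a_minus_def F_add_right F_uminus_right)

lemma nondegenerate_left:
  assumes "x \<in> carrier M" "\<And>y. y \<in> carrier M \<Longrightarrow> F x y = \<zero>"
  shows "x = \<zero>\<^bsub>M\<^esub>"
proof -
  have "(\<lambda>y\<in>carrier M. F x y) = (\<lambda>y\<in>carrier M. F \<zero>\<^bsub>M\<^esub> y)"
    using assms by auto
  then show ?thesis
    using nondegenerate assms(1) by (auto simp: nondegenerate_form_def dest: inj_onD)
qed

lemma flip: "nondegenerate_pairing K M (\<lambda>x y. F y x)"
  using bilinear nondegenerate module_axioms
  by (simp add: nondegenerate_pairing_def nondegenerate_pairing_axioms_def bilinear_form_def
      nondegenerate_form_def)

lemma submodule_perp:
  assumes "N \<subseteq> carrier M"
  shows "submodule (perp K M F N) K M"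
  using assms unfolding submodule_iff
  by (auto simp: perp_def F_add_right F_smult_right subset_iff)

lemma perp_carrier: "perp K M F (carrier M) = {\<zero>\<^bsub>M\<^esub>}"
  using nondegenerate_pairing.nondegenerate_left[OF flip] by (auto simp: perp_def)

lemma perp_zero: "perp K M F {\<zero>\<^bsub>M\<^esub>} = carrier M"
  by (auto simp: perp_def)

text \<open>Choose \<open>y\<close> in \<open>X\<close> with \<open>F y u\<close> nonzero, so that
  \<open>X = Z + K y\<close>. The maximal ideal of scalars carrying \<open>y\<close> into
  \<open>Z\<close> kills both \<open>F y u\<close> and \<open>F y v\<close>, so
  \<open>annihilators_cyclic\<close> gives \<open>F y v = k F y u\<close>. Then
  \<open>v - k u\<close> is orthogonal to \<open>y\<close> as well as to \<open>Z\<close>.\<close>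

lemma cover_perp:
  assumes K: "annihilators_cyclic K" and XZ: "cover K M X Z"
  shows "cover K M (perp K M F Z) (perp K M F X)"
proof -
  note X = coverD[OF XZ]
  have XM: "x \<in> carrier M" if "x \<in> X" for x
    using X that by blast
  have "\<exists>k\<in>carrier K. v \<ominus>\<^bsub>M\<^esub> k \<odot>\<^bsub>M\<^esub> u \<in> perp K M F X"
    if u: "u \<in> perp K M F Z - perp K M F X" and v: "v \<in> perp K M F Z" for u v
  proof -
    have uvM: "u \<in> carrier M" "v \<in> carrier M"
      using u v by (auto simp: perp_def)
    obtain y where y: "y \<in> X" "F y u \<noteq> \<zero>"
      using u by (auto simp: perp_def)
    then have yZ: "y \<notin> Z"
      using u by (auto simp: perp_def)
    note yM = XM[OF y(1)]
    let ?I = "{k \<in> carrier K. k \<odot>\<^bsub>M\<^esub> y \<in> Z}"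
    have sub: "submodule ?I K (regular_module K)"
      using X(2) yM
      by (auto simp: R.left_ideal_iff submodule_iff smult_l_distr smult_assoc1)
    have max: "maximal_submodule ?I K (regular_module K)"
      unfolding R.maximal_left_ideal_iff
    proof (intro conjI ballI)
      show "\<one> \<notin> ?I"
        using yZ yM by simp
      fix k assume "k \<in> carrier K - ?I"
      then have k: "k \<in> carrier K" "k \<odot>\<^bsub>M\<^esub> y \<notin> Z" "k \<odot>\<^bsub>M\<^esub> y \<in> X"
        using X(1) y by (auto simp: submodule_iff)
      then obtain l where l: "l \<in> carrier K" "y \<ominus>\<^bsub>M\<^esub> l \<odot>\<^bsub>M\<^esub> (k \<odot>\<^bsub>M\<^esub> y) \<in> Z"
        using X(5)[OF _ _ y(1)] by blast
      have "(\<one> \<ominus> l \<otimes> k) \<odot>\<^bsub>M\<^esub> y = y \<ominus>\<^bsub>M\<^esub> l \<odot>\<^bsub>M\<^esub> (k \<odot>\<^bsub>M\<^esub> y)"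
        using k l yM by (simp add: a_minus_def smult_l_distr smult_l_minus smult_assoc1)
      then show "\<exists>l\<in>carrier K. \<one> \<ominus> l \<otimes> k \<in> ?I"
        using l k by (intro bexI[of _ l]) auto
    qed (rule sub)
    have "p \<otimes> F y u = \<zero> \<and> p \<otimes> F y v = \<zero>" if "p \<in> ?I" for p
      using that u v uvM yM by (auto simp: F_smult_left[symmetric] perp_def)
    then have "\<exists>k\<in>carrier K. F y v = k \<otimes> F y u"
      using K[unfolded annihilators_cyclic_def, rule_format, of ?I "F y u" "F y v"] max y(2) uvM yM
      by simp
    then obtain k where k: "k \<in> carrier K" "F y v = k \<otimes> F y u" ..
    have "F x (v \<ominus>\<^bsub>M\<^esub> k \<odot>\<^bsub>M\<^esub> u) = \<zero>" if x: "x \<in> X" for x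
    proof -
      let ?w = "v \<ominus>\<^bsub>M\<^esub> k \<odot>\<^bsub>M\<^esub> u"
      have w: "?w \<in> carrier M"
        using k uvM by simp
      obtain l where l: "l \<in> carrier K" "x \<ominus>\<^bsub>M\<^esub> l \<odot>\<^bsub>M\<^esub> y \<in> Z"
        using X(5)[OF y(1) yZ x] by blast
      have "x = (x \<ominus>\<^bsub>M\<^esub> l \<odot>\<^bsub>M\<^esub> y) \<oplus>\<^bsub>M\<^esub> l \<odot>\<^bsub>M\<^esub> y"
        using XM[OF x] yM l by (simp add: a_minus_def M.a_assoc M.l_neg)
      then have "F x ?w = F (x \<ominus>\<^bsub>M\<^esub> l \<odot>\<^bsub>M\<^esub> y) ?w \<oplus> l \<otimes> F y ?w"
        using XM[OF x] yM l w F_add_left[of "x \<ominus>\<^bsub>M\<^esub> l \<odot>\<^bsub>M\<^esub> y" "l \<odot>\<^bsub>M\<^esub> y" ?w]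
        by (simp add: F_smult_left)
      also have "F (x \<ominus>\<^bsub>M\<^esub> l \<odot>\<^bsub>M\<^esub> y) ?w = \<zero>"
      proof -
        let ?z = "x \<ominus>\<^bsub>M\<^esub> l \<odot>\<^bsub>M\<^esub> y"
        have "?z \<in> carrier M" "F ?z u = \<zero>" "F ?z v = \<zero>"
          using XM[OF x] yM l u v by (auto simp: perp_def)
        then have "F ?z ?w = \<zero> \<ominus> k \<otimes> \<zero>"
          using uvM k(1) by (simp only: F_minus_right F_smult_right smult_closed)
        then show ?thesis
          using k(1) by (simp add: a_minus_def)
      qed
      also have "F y ?w = \<zero>"
        using yM uvM k by (simp add: F_minus_right F_smult_right) (simp add: a_minus_def R.r_neg)
      finally show ?thesis
        using l by simp
    qed
    then show ?thesis
      using k uvM by (auto simp: perp_def)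
  qed
  moreover have "perp K M F X \<subseteq> perp K M F Z"
    using X by (auto simp: perp_def)
  ultimately show ?thesis
    using X submodule_perp unfolding cover_def by blast
qed

lemma cover_chain_perp:
  assumes K: "annihilators_cyclic K"
  shows "(strict_cover K M ^^ n) X Z \<Longrightarrow> (cover K M ^^ n) (perp K M F Z) (perp K M F X)"
proof (induction n arbitrary: X)
  case (Suc n)
  from relpowp_Suc_D2[OF Suc.prems] obtain Y
    where Y: "cover K M X Y" "(strict_cover K M ^^ n) Y Z"
    by blast
  show ?case
    using relpowp_Suc_I[OF Suc.IH[OF Y(2)] cover_perp[OF K Y(1)]] .
qed auto

text \<open>
  If \<open>N\<close> were strictly smaller than its double orthogonal, then the orthogonals of a composition
  series through both would form a chain from \<open>M\<close> to \<open>0\<close> that is too short.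
\<close>

lemma perp_perp:
  assumes K: "annihilators_cyclic K" "artinian_module K (regular_module K)"
    and M: "artinian_module K M" and N: "submodule N K M"
  shows "perp K M (\<lambda>x y. F y x) (perp K M F N) = N" (is "?N = N")
proof (rule ccontr)
  assume ne: "?N \<noteq> N"
  have NM: "N \<subseteq> carrier M"
    using N by (simp add: submodule_iff)
  have sub: "N \<subseteq> ?N"
    using NM by (auto simp: perp_def)
  have N': "submodule ?N K M"
    by (rule nondegenerate_pairing.submodule_perp[OF flip]) (auto simp: perp_def)
  then have N'M: "?N \<subseteq> carrier M"
    by (simp add: submodule_iff)
  have carr: "submodule (carrier M) K M" and zero: "submodule {\<zero>\<^bsub>M\<^esub>} K M" "{\<zero>\<^bsub>M\<^esub>} \<subseteq> N"
    using carrier_is_submodule submodule_zero N by (auto simp: submodule_iff)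
  obtain a where a: "(strict_cover K M ^^ a) (carrier M) ?N"
    using exists_strict_cover_chain[OF K(2) M carr N' N'M] ..
  obtain b where b: "(strict_cover K M ^^ b) ?N N"
    using exists_strict_cover_chain[OF K(2) M N' N sub] ..
  obtain c where c: "(strict_cover K M ^^ c) N {\<zero>\<^bsub>M\<^esub>}"
    using exists_strict_cover_chain[OF K(2) M N zero] ..
  \<comment> \<open>A triple orthogonal is a single one, so the \<open>b\<close> steps from
    \<open>?N\<close> to \<open>N\<close> contribute nothing to the chain of orthogonals.\<close>
  have "perp K M F ?N = perp K M F N"
    using sub by (auto simp: perp_def)
  then have "(cover K M ^^ (c + a)) (carrier M) {\<zero>\<^bsub>M\<^esub>}"
    using relpowp_trans[OF cover_chain_perp[OF K(1) c]] cover_chain_perp[OF K(1) a]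
    by (simp add: perp_zero perp_carrier)
  moreover have "(strict_cover K M ^^ (a + b + c)) (carrier M) {\<zero>\<^bsub>M\<^esub>}"
    using relpowp_trans[OF relpowp_trans[OF a b] c] .
  ultimately have "a + b + c \<le> c + a"
    using strict_cover_chain_length_le carr by blast
  then have "b = 0"
    by simp
  with b ne show False
    by simp
qed

end

section \<open>The Jacobson radical\<close>

lemma submodule_abelian_subgroup:
  assumes "submodule N R M" "abelian_group M"
  shows "abelian_subgroup N M"
  using assms by (intro abelian_subgroupI3 additive_subgroup.intro submodule.axioms(1))

lemma (in abelian_subgroup) a_r_coset_eq_iff:
  assumes "x \<in> carrier G" "y \<in> carrier G"
  shows "H +> x = H +> y \<longleftrightarrow> x \<ominus> y \<in> H"
  using a_rcos_module[OF assms(2,1)] a_repr_independence'[OF _ assms(2)] a_rcos_self[OF assms(1)]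
  by (auto simp: minus_eq)

lemma (in abelian_group) minus_eq_zero_iff:
  assumes "x \<in> carrier G" "y \<in> carrier G"
  shows "x \<ominus> y = \<zero> \<longleftrightarrow> x = y"
proof
  assume "x \<ominus> y = \<zero>"
  then have "(x \<ominus> y) \<oplus> y = y"
    using assms by simp
  then show "x = y"
    using assms by (simp add: minus_eq a_assoc l_neg)
qed (use assms in \<open>simp add: minus_eq r_neg\<close>)

lemma quotient_module_simps:
  "carrier (quotient_module M N) = a_rcosets\<^bsub>M\<^esub> N"
  "mult (quotient_module M N) = rcoset_mult M N"
  "one (quotient_module M N) = N +>\<^bsub>M\<^esub> \<one>\<^bsub>M\<^esub>"
  "zero (quotient_module M N) = N"
  "add (quotient_module M N) = set_add M"
  "smult (quotient_module M N) = (\<lambda>k X. \<Union>x\<in>X. N +>\<^bsub>M\<^esub> (k \<odot>\<^bsub>M\<^esub> x))"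
  by (simp_all add: quotient_module_def FactRing_def ring.defs)

lemma a_rcosets_eq_image: "a_rcosets\<^bsub>M\<^esub> N = (\<lambda>x. N +>\<^bsub>M\<^esub> x) ` carrier M"
  by (auto simp: A_RCOSETS_def' a_r_coset_def')

text \<open>Collapses the union in \<open>quotient_module\<close> to one coset. The operation stays
  general because it is instantiated both by multiplication in a ring, for quotients by left ideals,
  and by the scalars of an algebra.\<close>

lemma (in abelian_subgroup) quotient_smult:
  fixes smult (infixl "\<star>" 70)
  assumes "\<And>x y. x \<in> carrier G \<Longrightarrow> y \<in> carrier G \<Longrightarrow> k \<star> (x \<oplus> y) = k \<star> x \<oplus> k \<star> y"
    and "\<And>x. x \<in> carrier G \<Longrightarrow> k \<star> x \<in> carrier G" and "\<And>h. h \<in> H \<Longrightarrow> k \<star> h \<in> H"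
    and a: "a \<in> carrier G"
  shows "(\<Union>x\<in>H +> a. H +> (k \<star> x)) = H +> (k \<star> a)"
proof -
  have "H +> (k \<star> x) = H +> (k \<star> a)" if x: "x \<in> H +> a" for x
  proof -
    obtain h where h: "h \<in> H" "x = h \<oplus> a"
      using x by (auto simp: a_r_coset_def')
    then have "k \<star> x = k \<star> h \<oplus> k \<star> a"
      using assms a_Hcarr by simp
    then have "k \<star> x \<in> H +> (k \<star> a)"
      using h assms(3) by (auto simp: a_r_coset_def')
    then show ?thesis
      using a_repr_independence'[of "k \<star> x" "k \<star> a"] assms(2) a by simp
  qed
  moreover have "a \<in> H +> a"
    using a_rcos_self[OF a] .
  ultimately show ?thesis
    by blast
qed

context ring
begin

lemma left_ideal_quotient:
  assumes J: "left_ideal J" and ab: "a \<in> carrier R" "b \<in> carrier R"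
  defines "c \<equiv> \<lambda>x. J +>\<^bsub>regular_module R\<^esub> x" and "Q \<equiv> quotient_module (regular_module R) J"
  shows "carrier Q = c ` carrier R" "c a \<oplus>\<^bsub>Q\<^esub> c b = c (a \<oplus> b)" "a \<odot>\<^bsub>Q\<^esub> c b = c (a \<otimes> b)"
    "c a = c b \<longleftrightarrow> a \<ominus> b \<in> J" "c a = {x \<in> carrier R. x \<ominus> a \<in> J}"
proof -
  interpret J: abelian_subgroup J "regular_module R"
    by (rule submodule_abelian_subgroup[OF J regular_module_abelian_group])
  have minus: "x \<ominus>\<^bsub>regular_module R\<^esub> y = x \<ominus> y" for x y
    by (simp add: a_minus_def a_inv_def regular_module_def m_inv_def)
  show "carrier Q = c ` carrier R"
    by (simp add: Q_def c_def quotient_module_simps a_rcosets_eq_image)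
  show "c a \<oplus>\<^bsub>Q\<^esub> c b = c (a \<oplus> b)"
    using J.a_rcos_sum ab by (simp add: Q_def c_def quotient_module_simps)
  show "a \<odot>\<^bsub>Q\<^esub> c b = c (a \<otimes> b)"
    using J.quotient_smult[where k = a and smult = "(\<otimes>)" and a = b] ab J by (simp add: Q_def c_def quotient_module_simps r_distr left_ideal_iff)
  show "c a = c b \<longleftrightarrow> a \<ominus> b \<in> J"
    using J.a_r_coset_eq_iff[of a b] ab by (simp add: c_def minus)
  have "c a \<subseteq> carrier R"
    using J.a_elemrcos_carrier[of a] ab by (auto simp: c_def)
  moreover have "x \<in> c a \<longleftrightarrow> x \<ominus> a \<in> J" if "x \<in> carrier R" for x
    using J.a_rcos_module[of a x] that ab
    unfolding c_def minus[symmetric] by (simp add: a_minus_def)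
  ultimately show "c a = {x \<in> carrier R. x \<ominus> a \<in> J}"
    by auto
qed

lemma jacobson_radical_iff:
  "x \<in> jacobson_radical R \<longleftrightarrow>
     x \<in> carrier R \<and> (\<forall>L. maximal_left_ideal L \<longrightarrow> x \<in> L)"
  by (auto simp: jacobson_radical_def)

lemma maximal_left_idealD:
  assumes "maximal_left_ideal L"
  shows "left_ideal L" "L \<subseteq> carrier R" "\<zero> \<in> L" "\<one> \<notin> L"
    "\<And>x y. x \<in> L \<Longrightarrow> y \<in> L \<Longrightarrow> x \<oplus> y \<in> L" "\<And>a x. a \<in> carrier R \<Longrightarrow> x \<in> L \<Longrightarrow> a \<otimes> x \<in> L"
    "\<And>a. a \<in> carrier R \<Longrightarrow> a \<notin> L \<Longrightarrow> \<exists>r\<in>carrier R. \<one> \<ominus> r \<otimes> a \<in> L"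
  using assms by (auto simp: maximal_left_ideal_iff left_ideal_iff)

lemma jacobson_radical_left_ideal: "left_ideal (jacobson_radical R)"
  unfolding left_ideal_iff
  by (auto simp: jacobson_radical_iff intro: maximal_left_idealD)

text \<open>Right multiplication by \<open>a\<close> induces an isomorphism from the quotient by
  this conductor onto \<open>R/L\<close>, which is simple.\<close>

lemma maximal_left_ideal_conductor:
  assumes L: "maximal_left_ideal L" and a: "a \<in> carrier R" "a \<notin> L"
  shows "maximal_left_ideal {r \<in> carrier R. r \<otimes> a \<in> L}"
  unfolding maximal_left_ideal_iff
proof (intro conjI ballI)
  note L' = maximal_left_idealD[OF L]
  show "left_ideal {r \<in> carrier R. r \<otimes> a \<in> L}"
    using L' a by (auto simp: left_ideal_iff l_distr m_assoc)
  show "\<one> \<notin> {r \<in> carrier R. r \<otimes> a \<in> L}"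
    using a by simp
  fix z assume "z \<in> carrier R - {r \<in> carrier R. r \<otimes> a \<in> L}"
  then have z: "z \<in> carrier R" "z \<otimes> a \<notin> L"
    by auto
  then obtain r where r: "r \<in> carrier R" "\<one> \<ominus> r \<otimes> (z \<otimes> a) \<in> L"
    using L'(7)[of "z \<otimes> a"] a by auto
  \<comment> \<open>Multiplying by \<open>a\<close> on the left lets \<open>a\<close> be factored
    out on the right, which turns \<open>r\<close> into the witness
    \<open>a \<otimes> r\<close>.\<close>
  have "a \<otimes> (\<one> \<ominus> r \<otimes> (z \<otimes> a)) \<in> L"
    using L'(6) r a by blast
  also have "a \<otimes> (\<one> \<ominus> r \<otimes> (z \<otimes> a)) = (\<one> \<ominus> (a \<otimes> r) \<otimes> z) \<otimes> a"
    using r z a by (simp add: a_minus_def r_distr r_minus l_distr l_minus m_assoc)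
  finally show "\<exists>r\<in>carrier R. \<one> \<ominus> r \<otimes> z \<in> {r \<in> carrier R. r \<otimes> a \<in> L}"
    using r z a by (intro bexI[of _ "a \<otimes> r"]) auto
qed

text \<open>For \<open>x\<close> in the radical, \<open>x a\<close> lies in a maximal left ideal
  \<open>L\<close> either because \<open>a\<close> does, or because \<open>x\<close> lies in the
  conductor of \<open>L\<close> by \<open>a\<close>, which is again maximal.\<close>

lemma jacobson_radical_ideal: "ideal (jacobson_radical R) R"
proof -
  note J = jacobson_radical_left_ideal[unfolded left_ideal_iff]
  have right: "x \<otimes> a \<in> jacobson_radical R" if x: "x \<in> jacobson_radical R" and a: "a \<in> carrier R" for x a
    unfolding jacobson_radical_iff
  proof (intro conjI allI impI)
    have xR: "x \<in> carrier R"
      using x by (simp add: jacobson_radical_iff)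
    then show "x \<otimes> a \<in> carrier R"
      using a by simp
    fix L assume L: "maximal_left_ideal L"
    show "x \<otimes> a \<in> L"
    proof (cases "a \<in> L")
      case True
      then show ?thesis
        using maximal_left_idealD(6)[OF L] xR by blast
    next
      case False
      then show ?thesis
        using maximal_left_ideal_conductor[OF L a] x unfolding jacobson_radical_iff by blast
    qed
  qed
  interpret abelian_subgroup "jacobson_radical R" "regular_module R"
    by (rule submodule_abelian_subgroup[OF jacobson_radical_left_ideal regular_module_abelian_group])
  have "subgroup (jacobson_radical R) (add_monoid R)"
    using a_subgroup by (simp add: regular_module_def subgroup_def m_inv_def)
  then show ?thesis
    using J right by (intro idealI) (auto simp: ring_axioms)
qed

text \<open>If \<open>a\<close> is outside a maximal left ideal \<open>L\<close>, then
  \<open>1 - r a\<close> is in \<open>L\<close> for some \<open>r\<close>, and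
  \<open>a = a r a + a (1 - r a)\<close> would lie in \<open>L\<close>.\<close>

lemma jacobson_radical_semiprime:
  assumes a: "a \<in> carrier R" and aRa: "\<And>r. r \<in> carrier R \<Longrightarrow> a \<otimes> r \<otimes> a \<in> jacobson_radical R"
  shows "a \<in> jacobson_radical R"
proof (rule ccontr)
  assume "a \<notin> jacobson_radical R"
  with a obtain L where L: "maximal_left_ideal L" "a \<notin> L"
    by (auto simp: jacobson_radical_iff)
  note L' = maximal_left_idealD[OF L(1)]
  obtain r where r: "r \<in> carrier R" "\<one> \<ominus> r \<otimes> a \<in> L"
    using L'(7)[OF a L(2)] by blast
  have "a \<otimes> r \<otimes> a \<in> L"
    using aRa[OF r(1)] L by (simp add: jacobson_radical_iff)
  moreover have "a \<otimes> (\<one> \<ominus> r \<otimes> a) \<in> L"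
    using L'(6) a r by blast
  ultimately have "a \<otimes> r \<otimes> a \<oplus> a \<otimes> (\<one> \<ominus> r \<otimes> a) \<in> L"
    using L'(5) by blast
  also have "a \<otimes> r \<otimes> a \<oplus> a \<otimes> (\<one> \<ominus> r \<otimes> a) = a"
    using a r by (simp add: a_minus_def r_distr r_minus m_assoc a_lcomm r_neg)
  finally show False
    using L(2) by contradiction
qed

end

text \<open>Elements killed by \<open>I\<close> lie in the socle, so the isomorphism carries
  \<open>c\<close> and \<open>d\<close> to classes of \<open>a\<close> and \<open>b\<close> in
  \<open>R/J\<close> that are killed by \<open>I\<close>. As \<open>a\<close> is invertible modulo
  \<open>I\<close>, \<open>b\<close> is a multiple of \<open>a\<close> modulo \<open>J\<close>, and
  pulling back expresses \<open>d\<close> through \<open>c\<close>.\<close>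

lemma (in cring) Frobenius_annihilators_cyclic:
  assumes Frob: "Frobenius_ring R"
  shows "annihilators_cyclic R"
  unfolding annihilators_cyclic_def
proof (intro allI impI, elim conjE)
  fix I c d
  assume max: "maximal_left_ideal I"
    and c: "c \<in> carrier R" "c \<noteq> \<zero>" and d: "d \<in> carrier R"
    and ann: "\<forall>p\<in>I. p \<otimes> c = \<zero> \<and> p \<otimes> d = \<zero>"
  let ?J = "jacobson_radical R" and ?Soc = "socle R (regular_module R)"
  let ?Q = "quotient_module (regular_module R) ?J"
  define coset where "coset x = ?J +>\<^bsub>regular_module R\<^esub> x" for x
  note I = maximal_left_idealD[OF max]
  note J = jacobson_radical_left_ideal
  note Q = left_ideal_quotient[OF J, folded coset_def]
  have IR: "p \<in> carrier R" if "p \<in> I" for p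
    using I that by blast
  \<comment> \<open>A nonzero \<open>x\<close> killed by \<open>I\<close> generates a copy of
    \<open>R/I\<close>, a simple submodule.\<close>
  have simple: "x \<in> ?Soc" if x: "x \<in> carrier R" "\<forall>p\<in>I. p \<otimes> x = \<zero>" for x
  proof (cases "x = \<zero>")
    case True
    then show ?thesis
      by (auto simp: socle_def left_ideal_iff)
  next
    case False
    let ?N = "{k \<otimes> x | k. k \<in> carrier R}"
    have N: "left_ideal ?N" "x \<in> ?N"
      using principal_left_ideal x by auto
    have "simple_submodule ?N R (regular_module R)"
      unfolding simple_submodule_def
    proof (intro conjI allI impI)
      show "?N \<noteq> {\<zero>\<^bsub>regular_module R\<^esub>}"
        using N(2) False by (metis regular_module_simps(4) singletonD)
      fix L assume L: "left_ideal L \<and> L \<subseteq> ?N"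
      show "L = {\<zero>\<^bsub>regular_module R\<^esub>} \<or> L = ?N"
      proof (cases "L \<subseteq> {\<zero>}")
        case True
        then show ?thesis
          using L by (auto simp: left_ideal_iff)
      next
        case False
        then obtain y where y: "y \<in> L" "y \<noteq> \<zero>"
          by blast
        with L obtain k where k: "k \<in> carrier R" "y = k \<otimes> x"
          by blast
        have "k \<notin> I"
          using k x y by auto
        then obtain l where l: "l \<in> carrier R" "\<one> \<ominus> l \<otimes> k \<in> I"
          using I(7) k by blast
        have "(\<one> \<ominus> l \<otimes> k) \<otimes> x = \<zero>"
          using l x by blast
        then have "x \<ominus> l \<otimes> y = \<zero>"
          using k l x by (simp add: a_minus_def l_distr l_minus m_assoc)
        then have "x = l \<otimes> y"
          using k l x y by (simp add: minus_eq_zero_iff)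
        then have "x \<in> L"
          using L l y by (simp add: left_ideal_iff)
        then have "?N \<subseteq> L"
          using L by (auto simp: left_ideal_iff)
        then show ?thesis
          using L by blast
      qed
    qed (rule N(1))
    then show ?thesis
      using N(2) by (auto simp: socle_def)
  qed
  have cS: "c \<in> ?Soc" and dS: "d \<in> ?Soc" and zS: "\<zero> \<in> ?Soc"
    using simple[of c] simple[of d] simple[of \<zero>] c d ann IR by auto
  have SR: "x \<in> carrier R" if "x \<in> ?Soc" for x
  proof -
    have "left_ideal (carrier R)"
      by (auto simp: left_ideal_iff)
    then show ?thesis
      using that by (auto simp: socle_def simple_submodule_def left_ideal_iff)
  qed
  obtain \<phi> where bij: "bij_betw \<phi> ?Soc (carrier ?Q)"
    and hom: "\<And>a x. a \<in> carrier R \<Longrightarrow> x \<in> ?Soc \<Longrightarrow> \<phi> (a \<otimes> x) = a \<odot>\<^bsub>?Q\<^esub> \<phi> x"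
    using Frob unfolding Frobenius_ring_def socle_isomorphic_quotient_def module_isomorphic_def
    by auto
  have "\<phi> c \<in> carrier ?Q" "\<phi> d \<in> carrier ?Q"
    using bij cS dS by (auto dest: bij_betwE)
  then obtain a b where a: "a \<in> carrier R" "\<phi> c = coset a" and b: "b \<in> carrier R" "\<phi> d = coset b"
    using Q(1)[OF zero_closed zero_closed] by auto
  have z: "\<phi> \<zero> = coset \<zero>"
    using hom[OF zero_closed cS] Q(3)[OF zero_closed a(1)] c a by simp
  have Ja: "p \<otimes> x \<in> ?J" if p: "p \<in> I" and x: "x \<in> carrier R" "\<phi> y = coset x" "y \<in> ?Soc" "p \<otimes> y = \<zero>"
    for p x y
  proof -
    have "coset (p \<otimes> x) = coset \<zero>"
      using hom[OF IR[OF p] x(3)] Q(3)[OF IR[OF p] x(1)] x z by simp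
    then show ?thesis
      using Q(4)[of "p \<otimes> x" \<zero>] IR[OF p] x by (simp add: a_minus_def)
  qed
  have aJ: "a \<notin> ?J"
  proof
    assume "a \<in> ?J"
    then have "\<phi> c = \<phi> \<zero>"
      using Q(4)[of a \<zero>] a z by (simp add: a_minus_def)
    then show False
      using bij cS zS c by (auto simp: bij_betw_def dest: inj_onD)
  qed
  \<comment> \<open>Otherwise \<open>a \<otimes> a\<close> would lie in \<open>J\<close>; by
    commutativity so would every \<open>a \<otimes> r \<otimes> a\<close>, and semiprimeness would
    put \<open>a\<close> in \<open>J\<close>.\<close>
  have "a \<notin> I"
  proof
    assume "a \<in> I"
    then have "a \<otimes> a \<in> ?J"
      using Ja[of a a c] a cS ann by blast
    then have "a \<otimes> r \<otimes> a \<in> ?J" if "r \<in> carrier R" for r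
      using J that a by (metis left_ideal_iff m_assoc m_comm)
    then show False
      using jacobson_radical_semiprime[OF a(1)] aJ by blast
  qed
  then obtain l where l: "l \<in> carrier R" "\<one> \<ominus> l \<otimes> a \<in> I"
    using I(7) a by blast
  have "(\<one> \<ominus> l \<otimes> a) \<otimes> b \<in> ?J"
    using Ja[OF l(2) b dS] ann l by blast
  also have "(\<one> \<ominus> l \<otimes> a) \<otimes> b = b \<ominus> (b \<otimes> l) \<otimes> a"
    using l a b by algebra
  finally have "coset b = coset ((b \<otimes> l) \<otimes> a)"
    using Q(4)[of b "(b \<otimes> l) \<otimes> a"] a b l by simp
  also have "\<dots> = \<phi> ((b \<otimes> l) \<otimes> c)"
    using hom[of "b \<otimes> l" c] cS Q(3)[of "b \<otimes> l" a] a b l by simp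
  finally have "\<phi> d = \<phi> ((b \<otimes> l) \<otimes> c)"
    using b by simp
  moreover have "(b \<otimes> l) \<otimes> c \<in> ?Soc"
    using simple[of "(b \<otimes> l) \<otimes> c"] b l c ann IR by (metis m_closed m_comm m_assoc r_null)
  ultimately have "d = (b \<otimes> l) \<otimes> c"
    using bij dS by (auto simp: bij_betw_def dest: inj_onD)
  then show "\<exists>k\<in>carrier R. d = k \<otimes> c"
    using b l by blast
qed

section \<open>Opposite rings and idempotents modulo the radical\<close>

lemma opposite_simps [simp]:
  "carrier (opposite R) = carrier R" "one (opposite R) = one R" "zero (opposite R) = zero R"
  "add (opposite R) = add R" "x \<otimes>\<^bsub>opposite R\<^esub> y = y \<otimes>\<^bsub>R\<^esub> x"
  by (simp_all add: opposite_def)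

lemma opposite_opposite [simp]: "opposite (opposite R) = R"
  by (simp add: opposite_def)

lemma (in ring) opposite_ring: "ring (opposite R)"
proof (rule ringI)
  show "abelian_group (opposite R)"
    by (rule abelian_groupI) (auto simp: a_ac intro: l_neg)
  show "Group.monoid (opposite R)"
    by (rule monoidI) (auto simp: m_assoc)
qed (auto simp: l_distr r_distr)

lemma (in ring) right_ideal_iff:
  "submodule N (opposite R) (regular_module (opposite R)) \<longleftrightarrow>
     N \<subseteq> carrier R \<and> \<zero> \<in> N \<and> (\<forall>x\<in>N. \<forall>y\<in>N. x \<oplus> y \<in> N) \<and> (\<forall>a\<in>carrier R. \<forall>x\<in>N. x \<otimes> a \<in> N)"
  using ring.left_ideal_iff[OF opposite_ring] by simp

lemma (in abelian_monoid) finsum_split: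
  assumes "finite I" "i \<in> I" "g \<in> I \<rightarrow> carrier G"
  shows "(\<Oplus>j\<in>I. g j) = g i \<oplus> (\<Oplus>j\<in>I - {i}. g j)"
proof -
  have "(\<Oplus>j\<in>insert i (I - {i}). g j) = g i \<oplus> (\<Oplus>j\<in>I - {i}. g j)"
    using assms by (intro finsum_insert) auto
  then show ?thesis
    using assms(2) by (simp add: insert_absorb)
qed

text \<open>
  The assumptions make \<open>eRe\<close> a division ring, in which left inverses are also right inverses.
\<close>

lemma (in ring) primitive_idempotent_right:
  assumes e: "e \<in> carrier R" "e \<otimes> e = e"
    and left: "\<And>x. x \<in> carrier R \<Longrightarrow> x \<otimes> e \<noteq> \<zero> \<Longrightarrow> \<exists>r\<in>carrier R. r \<otimes> (x \<otimes> e) = e"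
    and semiprime: "\<And>a. a \<in> carrier R \<Longrightarrow> (\<And>t. t \<in> carrier R \<Longrightarrow> a \<otimes> t \<otimes> a = \<zero>) \<Longrightarrow> a = \<zero>"
    and x: "x \<in> carrier R" "e \<otimes> x \<noteq> \<zero>"
  shows "\<exists>r\<in>carrier R. e \<otimes> x \<otimes> r = e"
proof -
  define a where "a = e \<otimes> x"
  have a: "a \<in> carrier R" "e \<otimes> a = a" "a \<noteq> \<zero>"
    using e x by (simp_all add: a_def flip: m_assoc)
  obtain t where t: "t \<in> carrier R" "a \<otimes> t \<otimes> a \<noteq> \<zero>"
    using semiprime[OF a(1)] a(3) by blast
  \<comment> \<open>The element \<open>a\<close> lies only in \<open>e R\<close>. The factor
    \<open>t\<close> supplied by semiprimeness moves it to the nonzero element \<open>a t e\<close>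
    of \<open>e R e\<close>.\<close>
  define b where "b = a \<otimes> t \<otimes> e"
  have b: "b \<in> carrier R" "e \<otimes> b = b"
    using e a t by (simp_all add: b_def flip: m_assoc)
  have "a \<otimes> t \<otimes> a = b \<otimes> x"
    unfolding b_def using e x t a(1) by (subst (2) a_def) (simp add: m_assoc)
  then have "b \<noteq> \<zero>"
    using t x by auto
  then obtain u where u: "u \<in> carrier R" "u \<otimes> b = e"
    using left[of "a \<otimes> t"] a t unfolding b_def by auto
  define c where "c = e \<otimes> u \<otimes> e"
  have c: "c \<in> carrier R" "e \<otimes> c = c"
    using e u by (simp_all add: c_def flip: m_assoc)
  have cb: "c \<otimes> b = e"
    unfolding c_def using e u b by (simp add: m_assoc)
  then have "c \<noteq> \<zero>"
    using a b by auto
  then obtain w where w: "w \<in> carrier R" "w \<otimes> c = e"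
    using left[of "e \<otimes> u"] e u unfolding c_def by auto
  \<comment> \<open>As \<open>c\<close> is a left inverse of \<open>b\<close> and \<open>w\<close>
    one of \<open>c\<close>, \<open>b\<close> equals \<open>w e\<close>, and therefore
    \<open>b c = w e c = w c = e\<close>.\<close>
  have "b = w \<otimes> (c \<otimes> b)"
    using w b c by (simp flip: m_assoc)
  then have "b \<otimes> c = w \<otimes> e \<otimes> c"
    by (simp add: cb)
  also have "\<dots> = e"
    using e c w by (simp add: m_assoc)
  finally have "e \<otimes> x \<otimes> (t \<otimes> e \<otimes> c) = e"
    unfolding b_def a_def using e x t c by (simp add: m_assoc)
  then show ?thesis
    using e t c by blast
qed

text \<open>
  The \<open>e L\<close> represent orthogonal primitive idempotents of \<open>R/J\<close> with sum \<open>1\<close>: modulo \<open>J\<close>, the left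
  multiples of \<open>e L\<close> form a complement of the maximal left ideal \<open>L/J\<close>.
\<close>

locale primitive_decomposition = ring R for R (structure) +
  fixes \<L> :: "'a set set" and e :: "'a set \<Rightarrow> 'a"
  assumes finite_\<L>: "finite \<L>"
    and maximal: "L \<in> \<L> \<Longrightarrow> maximal_left_ideal L"
    and radical: "x \<in> carrier R \<Longrightarrow> (\<And>L. L \<in> \<L> \<Longrightarrow> x \<in> L) \<Longrightarrow> x \<in> jacobson_radical R"
    and e_closed: "L \<in> \<L> \<Longrightarrow> e L \<in> carrier R"
    and e_mem: "L \<in> \<L> \<Longrightarrow> L' \<in> \<L> \<Longrightarrow> L' \<noteq> L \<Longrightarrow> e L \<in> L'"
    and one_minus_e: "L \<in> \<L> \<Longrightarrow> \<one> \<ominus> e L \<in> L"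

text \<open>By the descending chain condition some finite intersection of maximal left ideals is
  minimal, hence contained in all of them. A family of least cardinality with intersection in the
  radical is irredundant, because without any one member the intersection leaves the
  radical.\<close>

lemma (in ring) artinian_irredundant_maximal_left_ideals:
  assumes art: "artinian_module R (regular_module R)"
  shows "\<exists>\<L>. finite \<L> \<and> (\<forall>L\<in>\<L>. maximal_left_ideal L) \<and>
    carrier R \<inter> \<Inter>\<L> \<subseteq> jacobson_radical R \<and>
    (\<forall>L\<in>\<L>. \<exists>a\<in>carrier R. a \<notin> L \<and> (\<forall>L'\<in>\<L>. L' \<noteq> L \<longrightarrow> a \<in> L'))"
proof -
  define P where "P \<L> \<longleftrightarrow> finite \<L> \<and> (\<forall>L\<in>\<L>. maximal_left_ideal L)" for \<L>
  let ?\<N> = "{carrier R \<inter> \<Inter>\<L> | \<L>. P \<L>}"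
  \<comment> \<open>The empty family is allowed: it is the only one in the zero ring, and its
    intersection is read as the carrier.\<close>
  have "carrier R \<inter> \<Inter>{} \<in> ?\<N>"
    unfolding P_def by blast
  then have ne: "?\<N> \<noteq> {}"
    by blast
  have "\<exists>\<L>. P \<L> \<and> carrier R \<inter> \<Inter>\<L> \<subseteq> jacobson_radical R"
  proof (rule artinian_module_minimal[OF art ne])
    fix N assume "N \<in> ?\<N>"
    then obtain \<L> where "P \<L>" "N = carrier R \<inter> \<Inter>\<L>"
      by blast
    then show "left_ideal N"
      by (auto simp: left_ideal_iff P_def intro: maximal_left_idealD)
  next
    fix N assume N: "N \<in> ?\<N>" and min: "\<And>L. L \<in> ?\<N> \<Longrightarrow> L \<subseteq> N \<Longrightarrow> L = N"
    obtain \<L> where \<L>: "P \<L>" "N = carrier R \<inter> \<Inter>\<L>"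
      using N by blast
    have "N \<subseteq> L" if L: "maximal_left_ideal L" for L
    proof -
      have "P (insert L \<L>)"
        using \<L> L by (simp add: P_def)
      then have mem: "carrier R \<inter> \<Inter>(insert L \<L>) \<in> ?\<N>"
        by (intro CollectI exI conjI) (rule refl)
      have "carrier R \<inter> \<Inter>(insert L \<L>) \<subseteq> N"
        unfolding \<L>(2) by (simp add: le_infI2)
      then have "carrier R \<inter> \<Inter>(insert L \<L>) = N"
        by (rule min[OF mem])
      then show ?thesis
        by auto
    qed
    then have "N \<subseteq> jacobson_radical R"
      using \<L>(2) by (auto simp: jacobson_radical_iff subset_iff)
    with \<L> show ?thesis
      by blast
  qed
  then obtain \<L>0 where \<L>0: "P \<L>0 \<and> carrier R \<inter> \<Inter>\<L>0 \<subseteq> jacobson_radical R" ..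
  from ex_has_least_nat[of "\<lambda>\<L>. P \<L> \<and> carrier R \<inter> \<Inter>\<L> \<subseteq> jacobson_radical R" \<L>0 card, OF \<L>0]
  obtain \<L> where *: "(P \<L> \<and> carrier R \<inter> \<Inter>\<L> \<subseteq> jacobson_radical R) \<and>
    (\<forall>\<L>'. P \<L>' \<and> carrier R \<inter> \<Inter>\<L>' \<subseteq> jacobson_radical R \<longrightarrow> card \<L> \<le> card \<L>')" ..
  then have \<L>: "P \<L>" "carrier R \<inter> \<Inter>\<L> \<subseteq> jacobson_radical R"
    and least: "\<And>\<L>'. P \<L>' \<Longrightarrow> carrier R \<inter> \<Inter>\<L>' \<subseteq> jacobson_radical R \<Longrightarrow> card \<L> \<le> card \<L>'"
    by simp_all
  have "\<exists>a\<in>carrier R. a \<notin> L \<and> (\<forall>L'\<in>\<L>. L' \<noteq> L \<longrightarrow> a \<in> L')" if L: "L \<in> \<L>" for L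
  proof (rule ccontr)
    assume "\<not> ?thesis"
    then have "carrier R \<inter> \<Inter>(\<L> - {L}) \<subseteq> carrier R \<inter> \<Inter>\<L>"
      by blast
    then have "card \<L> \<le> card (\<L> - {L})"
      using \<L> by (intro least) (auto simp: P_def)
    then show False
      using \<L>(1) L card_Diff1_less[of \<L> L] by (simp add: P_def)
  qed
  then show ?thesis
    using \<L> unfolding P_def by blast
qed

text \<open>If \<open>a\<close> lies in every member except \<open>L\<close>, so does each left
  multiple \<open>r a\<close>, and \<open>r\<close> can be chosen to make \<open>r a\<close>
  congruent to 1 modulo \<open>L\<close>. This is \<open>e L\<close>.\<close>

lemma (in ring) artinian_primitive_decomposition:
  assumes art: "artinian_module R (regular_module R)"
  shows "\<exists>\<L> e. primitive_decomposition R \<L> e"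
proof -
  from artinian_irredundant_maximal_left_ideals[OF art] obtain \<L>
    where \<L>: "finite \<L>" "\<And>L. L \<in> \<L> \<Longrightarrow> maximal_left_ideal L"
      "carrier R \<inter> \<Inter>\<L> \<subseteq> jacobson_radical R"
    and irred: "\<And>L. L \<in> \<L> \<Longrightarrow> \<exists>a\<in>carrier R. a \<notin> L \<and> (\<forall>L'\<in>\<L>. L' \<noteq> L \<longrightarrow> a \<in> L')"
    by blast
  have "\<exists>e. e \<in> carrier R \<and> (\<forall>L'\<in>\<L>. L' \<noteq> L \<longrightarrow> e \<in> L') \<and> \<one> \<ominus> e \<in> L" if L: "L \<in> \<L>" for L
  proof -
    obtain a where a: "a \<in> carrier R" "a \<notin> L" "\<forall>L'\<in>\<L>. L' \<noteq> L \<longrightarrow> a \<in> L'"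
      using irred[OF L] by blast
    obtain r where "r \<in> carrier R" "\<one> \<ominus> r \<otimes> a \<in> L"
      using maximal_left_idealD(7)[OF \<L>(2)[OF L] a(1,2)] by blast
    then show ?thesis
      using a \<L>(2) by (intro exI[of _ "r \<otimes> a"]) (auto intro: maximal_left_idealD)
  qed
  then obtain e where "\<And>L. L \<in> \<L> \<Longrightarrow> e L \<in> carrier R \<and> (\<forall>L'\<in>\<L>. L' \<noteq> L \<longrightarrow> e L \<in> L') \<and> \<one> \<ominus> e L \<in> L"
    by metis
  then have "primitive_decomposition R \<L> e"
    using \<L> by unfold_locales auto
  then show ?thesis
    by blast
qed

context primitive_decomposition
begin

abbreviation J where "J \<equiv> jacobson_radical R"

sublocale J: ideal J R
  by (rule jacobson_radical_ideal)

lemma J_mem_cong: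
  assumes "x \<ominus> y \<in> J" "x \<in> carrier R" "y \<in> carrier R"
  shows "x \<in> J \<longleftrightarrow> y \<in> J"
  using left_ideal_mem_cong[OF jacobson_radical_left_ideal assms] .

text \<open>Since \<open>x e L\<close> lies in every other member of the family, its membership in
  \<open>J\<close> is decided at \<open>L\<close> alone, and there it agrees with \<open>x\<close>
  modulo \<open>L\<close>.\<close>

lemma mult_e_mem_J_iff:
  assumes L: "L \<in> \<L>" and x: "x \<in> carrier R"
  shows "x \<otimes> e L \<in> J \<longleftrightarrow> x \<in> L"
proof -
  note L' = maximal_left_idealD[OF maximal[OF L]]
  have "x \<otimes> (\<one> \<ominus> e L) \<in> L"
    using L'(6) x one_minus_e[OF L] by blast
  also have "x \<otimes> (\<one> \<ominus> e L) = x \<ominus> x \<otimes> e L"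
    using x e_closed[OF L] by (simp add: a_minus_def r_distr r_minus)
  finally have iff: "x \<in> L \<longleftrightarrow> x \<otimes> e L \<in> L"
    using left_ideal_mem_cong[OF L'(1)] x e_closed[OF L] by blast
  have "x \<otimes> e L \<in> L'" if "L' \<in> \<L>" "L' \<noteq> L" for L'
    using maximal_left_idealD(6)[OF maximal[OF that(1)] x e_mem[OF L that]] .
  then have "x \<otimes> e L \<in> L \<Longrightarrow> x \<otimes> e L \<in> J"
    using x e_closed[OF L] by (intro radical) blast+
  moreover have "x \<otimes> e L \<in> J \<Longrightarrow> x \<otimes> e L \<in> L"
    using maximal[OF L] by (simp add: jacobson_radical_iff)
  ultimately show ?thesis
    using iff by blast
qed

lemma e_orthogonal:
  assumes "L \<in> \<L>" "L' \<in> \<L>" "L' \<noteq> L"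
  shows "e L \<otimes> e L' \<in> J"
  using mult_e_mem_J_iff[of L' "e L"] e_mem[of L L'] e_closed assms by blast

lemma e_idempotent: "L \<in> \<L> \<Longrightarrow> e L \<otimes> e L \<ominus> e L \<in> J"
proof -
  assume L: "L \<in> \<L>"
  have "(\<one> \<ominus> e L) \<otimes> e L \<in> J"
    using mult_e_mem_J_iff[OF L] one_minus_e[OF L] e_closed[OF L] by blast
  then have "\<ominus> ((\<one> \<ominus> e L) \<otimes> e L) \<in> J"
    by (rule J.a_inv_closed)
  also have "\<ominus> ((\<one> \<ominus> e L) \<otimes> e L) = e L \<otimes> e L \<ominus> e L"
    using e_closed[OF L] by (simp add: a_minus_def l_distr l_minus minus_add a_comm)
  finally show ?thesis .
qed

lemma e_notin_J: "L \<in> \<L> \<Longrightarrow> e L \<notin> J"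
  using mult_e_mem_J_iff[of L \<one>] e_closed[of L] maximal_left_idealD(4)[OF maximal[of L]] by simp

text \<open>The image of \<open>R e L\<close> in \<open>R/J\<close> is isomorphic to
  \<open>R/L\<close>, hence simple, so each of its nonzero elements generates it.\<close>

lemma mult_e_left_inverse:
  assumes L: "L \<in> \<L>" and x: "x \<in> carrier R" "x \<otimes> e L \<notin> J"
  shows "\<exists>r\<in>carrier R. e L \<ominus> r \<otimes> (x \<otimes> e L) \<in> J"
proof -
  have "x \<notin> L"
    using mult_e_mem_J_iff[OF L] x by blast
  then obtain r where r: "r \<in> carrier R" "\<one> \<ominus> r \<otimes> x \<in> L"
    using maximal_left_idealD(7)[OF maximal[OF L] x(1)] by blast
  then have "(\<one> \<ominus> r \<otimes> x) \<otimes> e L \<in> J"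
    using mult_e_mem_J_iff[OF L] x by simp
  also have "(\<one> \<ominus> r \<otimes> x) \<otimes> e L = e L \<ominus> r \<otimes> (x \<otimes> e L)"
    using x r e_closed[OF L] by (simp add: a_minus_def l_distr l_minus m_assoc)
  finally show ?thesis
    using r by blast
qed

lemma mem_J_if_mult_e: "x \<in> carrier R \<Longrightarrow> (\<And>L. L \<in> \<L> \<Longrightarrow> x \<otimes> e L \<in> J) \<Longrightarrow> x \<in> J"
  using mult_e_mem_J_iff radical by blast

text \<open>Checked modulo each \<open>L\<close>: every summand other than \<open>e L\<close> lies
  in \<open>L\<close>, and \<open>e L\<close> is congruent to 1.\<close>

lemma one_minus_sum_e: "\<one> \<ominus> (\<Oplus>L\<in>\<L>. e L) \<in> J"
proof (rule radical)
  have cl: "e \<in> \<L> \<rightarrow> carrier R"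
    using e_closed by blast
  then have sum: "(\<Oplus>L\<in>\<L>. e L) \<in> carrier R"
    by (rule finsum_closed)
  then show "\<one> \<ominus> (\<Oplus>L\<in>\<L>. e L) \<in> carrier R"
    by simp
  fix L assume L: "L \<in> \<L>"
  note L' = maximal_left_idealD[OF maximal[OF L]]
  have rest: "(\<Oplus>L'\<in>\<L> - {L}. e L') \<in> L"
  proof (rule finsum_mem)
    fix L'' assume "L'' \<in> \<L> - {L}"
    then show "e L'' \<in> L"
      using e_mem[of L'' L] L by auto
  qed (use finite_\<L> L' in auto)
  have "(\<one> \<ominus> e L) \<ominus> (\<Oplus>L'\<in>\<L> - {L}. e L') \<in> L"
    by (rule left_ideal_minus[OF L'(1) one_minus_e[OF L] rest])
  also have "(\<one> \<ominus> e L) \<ominus> (\<Oplus>L'\<in>\<L> - {L}. e L') = \<one> \<ominus> (\<Oplus>L\<in>\<L>. e L)"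
    using finsum_split[OF finite_\<L> L cl] e_closed[OF L] subsetD[OF L'(2) rest]
    by (simp add: a_minus_def minus_add a_assoc)
  finally show "\<one> \<ominus> (\<Oplus>L\<in>\<L>. e L) \<in> L" .
qed

lemma mem_J_if_e_mult:
  assumes x: "x \<in> carrier R" and ex: "\<And>L. L \<in> \<L> \<Longrightarrow> e L \<otimes> x \<in> J"
  shows "x \<in> J"
proof -
  let ?H = "{h \<in> carrier R. h \<otimes> x \<in> J}"
  have H: "(\<Oplus>L\<in>\<L>. e L) \<in> ?H"
    by (rule finsum_mem) (use finite_\<L> x ex e_closed in \<open>auto simp: l_distr\<close>)
  have "(\<one> \<ominus> (\<Oplus>L\<in>\<L>. e L)) \<otimes> x \<in> J"
    using one_minus_sum_e x by (rule J.I_r_closed)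
  also have "(\<one> \<ominus> (\<Oplus>L\<in>\<L>. e L)) \<otimes> x = x \<ominus> (\<Oplus>L\<in>\<L>. e L) \<otimes> x"
    using H x by (simp add: a_minus_def l_distr l_minus)
  finally show ?thesis
    using J_mem_cong[of x "(\<Oplus>L\<in>\<L>. e L) \<otimes> x"] H x by blast
qed

text \<open>The family of left ideals supplies left inverses only;
  \<open>primitive_idempotent_right\<close>, applied in \<open>R/J\<close>, converts them into right
  inverses. This is what makes each \<open>right_max L\<close> a maximal right ideal.\<close>

lemma e_mult_right_inverse:
  assumes L: "L \<in> \<L>" and x: "x \<in> carrier R" "e L \<otimes> x \<notin> J"
  shows "\<exists>r\<in>carrier R. e L \<ominus> e L \<otimes> x \<otimes> r \<in> J"
proof -
  interpret T: ring "R Quot J"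
    by (rule J.quotient_is_ring)
  have carr: "carrier (R Quot J) = (+>) J ` carrier R"
    by (auto simp: FactRing_simps)
  have zero: "\<zero>\<^bsub>R Quot J\<^esub> = J"
    by (simp add: FactRing_def)
  have mult: "(J +> a) \<otimes>\<^bsub>R Quot J\<^esub> (J +> b) = J +> (a \<otimes> b)" if "a \<in> carrier R" "b \<in> carrier R" for a b
    using that by (simp add: FactRing_def J.rcoset_mult_add)
  have eq: "J +> a = J +> b \<longleftrightarrow> a \<ominus> b \<in> J" if "a \<in> carrier R" "b \<in> carrier R" for a b
    using quotient_eq_iff_same_a_r_cos[OF J.is_ideal that] by simp
  have eq_J: "J +> a = J \<longleftrightarrow> a \<in> J" if "a \<in> carrier R" for a
    using eq[OF that zero_closed] that a_coset_add_zero[OF J.a_subset] by (simp add: a_minus_def)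
  note e = e_closed[OF L]
  have "\<exists>r\<in>carrier (R Quot J).
      (J +> e L) \<otimes>\<^bsub>R Quot J\<^esub> (J +> x) \<otimes>\<^bsub>R Quot J\<^esub> r = J +> e L"
  proof (rule T.primitive_idempotent_right)
    show "(J +> e L) \<otimes>\<^bsub>R Quot J\<^esub> (J +> e L) = J +> e L"
      using e e_idempotent[OF L] by (simp add: mult eq)
    show "(J +> e L) \<otimes>\<^bsub>R Quot J\<^esub> (J +> x) \<noteq> \<zero>\<^bsub>R Quot J\<^esub>"
      using e x by (simp add: mult zero eq_J)
  next
    fix X assume X: "X \<in> carrier (R Quot J)" "X \<otimes>\<^bsub>R Quot J\<^esub> (J +> e L) \<noteq> \<zero>\<^bsub>R Quot J\<^esub>"
    then obtain y where y: "y \<in> carrier R" "X = J +> y"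
      by (auto simp: carr)
    then have "y \<otimes> e L \<notin> J"
      using X e by (simp add: mult zero eq_J)
    then obtain r where r: "r \<in> carrier R" "e L \<ominus> r \<otimes> (y \<otimes> e L) \<in> J"
      using mult_e_left_inverse[OF L y(1)] by blast
    have "(J +> r) \<otimes>\<^bsub>R Quot J\<^esub> (X \<otimes>\<^bsub>R Quot J\<^esub> (J +> e L)) = J +> (r \<otimes> (y \<otimes> e L))"
      using y e r by (simp add: mult)
    also have "\<dots> = J +> e L"
      using y e r eq[of "e L" "r \<otimes> (y \<otimes> e L)"] by simp
    finally show "\<exists>r\<in>carrier (R Quot J). r \<otimes>\<^bsub>R Quot J\<^esub> (X \<otimes>\<^bsub>R Quot J\<^esub> (J +> e L)) = J +> e L"
      using r(1) by (auto simp: carr)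
  next
    fix X assume X: "X \<in> carrier (R Quot J)"
      and nil: "\<And>t. t \<in> carrier (R Quot J) \<Longrightarrow> X \<otimes>\<^bsub>R Quot J\<^esub> t \<otimes>\<^bsub>R Quot J\<^esub> X = \<zero>\<^bsub>R Quot J\<^esub>"
    then obtain y where y: "y \<in> carrier R" "X = J +> y"
      by (auto simp: carr)
    have "y \<otimes> r \<otimes> y \<in> J" if "r \<in> carrier R" for r
      using nil[of "J +> r"] y that by (simp add: carr mult zero eq_J)
    then have "y \<in> J"
      using jacobson_radical_semiprime[OF y(1)] by blast
    then show "X = \<zero>\<^bsub>R Quot J\<^esub>"
      using y by (simp add: zero eq_J)
  qed (use e x in \<open>auto simp: carr\<close>)
  then obtain r where "r \<in> carrier R"
    "(J +> e L) \<otimes>\<^bsub>R Quot J\<^esub> (J +> x) \<otimes>\<^bsub>R Quot J\<^esub> (J +> r) = J +> e L"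
    by (auto simp: carr)
  then show ?thesis
    using e x by (auto simp: mult eq[symmetric])
qed

definition right_max :: "'a set \<Rightarrow> 'a set" where
  "right_max L = {x \<in> carrier R. e L \<otimes> x \<in> J}"

lemma right_max_right_ideal:
  assumes "L \<in> \<L>"
  shows "submodule (right_max L) (opposite R) (regular_module (opposite R))"
  using e_closed[OF assms] unfolding right_ideal_iff right_max_def
  by (auto simp: r_distr m_assoc[symmetric] J.I_r_closed)

lemma J_subset_right_max: "L \<in> \<L> \<Longrightarrow> J \<subseteq> right_max L"
  by (auto simp: right_max_def J.I_l_closed e_closed)

lemma e_notin_right_max: "L \<in> \<L> \<Longrightarrow> e L \<notin> right_max L"
  using J_mem_cong[OF e_idempotent] e_notin_J e_closed by (simp add: right_max_def)

lemma right_max_maximal: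
  assumes L: "L \<in> \<L>" and x: "x \<in> carrier R" "x \<notin> right_max L"
  shows "\<exists>r\<in>carrier R. \<one> \<ominus> x \<otimes> r \<in> right_max L"
proof -
  obtain r where r: "r \<in> carrier R" "e L \<ominus> e L \<otimes> x \<otimes> r \<in> J"
    using e_mult_right_inverse[OF L x(1)] x by (auto simp: right_max_def)
  moreover have "e L \<otimes> (\<one> \<ominus> x \<otimes> r) = e L \<ominus> e L \<otimes> x \<otimes> r"
    using e_closed[OF L] x r by (simp add: a_minus_def r_distr r_minus m_assoc)
  ultimately show ?thesis
    using x by (intro bexI[of _ r]) (auto simp: right_max_def)
qed

text \<open>The \<open>right_max L\<close> are maximal right ideals, and by
  \<open>mem_J_if_e_mult\<close> their intersection lies in \<open>J\<close>. Applied to the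
  opposite ring as well, this yields equality of the two radicals.\<close>

lemma jacobson_radical_opposite_subset: "jacobson_radical (opposite R) \<subseteq> J"
proof
  interpret op: ring "opposite R"
    by (rule opposite_ring)
  have minus: "a \<ominus>\<^bsub>opposite R\<^esub> b = a \<ominus> b" for a b
    by (simp add: a_minus_def a_inv_def m_inv_def)
  fix x assume x: "x \<in> jacobson_radical (opposite R)"
  then have xR: "x \<in> carrier R"
    by (simp add: op.jacobson_radical_iff)
  show "x \<in> J"
  proof (rule mem_J_if_e_mult[OF xR])
    fix L assume L: "L \<in> \<L>"
    have "maximal_submodule (right_max L) (opposite R) (regular_module (opposite R))"
      unfolding op.maximal_left_ideal_iff
    proof (intro conjI ballI)
      show "\<one>\<^bsub>opposite R\<^esub> \<notin> right_max L"
        using e_notin_J[OF L] e_closed[OF L] by (simp add: right_max_def)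
    qed (use right_max_right_ideal[OF L] right_max_maximal[OF L] in \<open>simp_all add: minus\<close>)
    then have "x \<in> right_max L"
      using x by (simp add: op.jacobson_radical_iff)
    then show "e L \<otimes> x \<in> J"
      by (simp add: right_max_def)
  qed
qed

end

section \<open>The socle\<close>

text \<open>
  Only the orthogonality relation of a Frobenius form matters for the socle, not its values.
\<close>

locale dual_ring = primitive_decomposition R \<L> e for R (structure) and \<L> e +
  fixes orth :: "'a \<Rightarrow> 'a \<Rightarrow> bool"
  assumes orth_assoc: "x \<in> carrier R \<Longrightarrow> y \<in> carrier R \<Longrightarrow> z \<in> carrier R \<Longrightarrow>
      orth (x \<otimes> y) z \<longleftrightarrow> orth x (y \<otimes> z)"
    and orth_zero: "x \<in> carrier R \<Longrightarrow> orth x \<zero>"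
    and orth_add_left: "x \<in> carrier R \<Longrightarrow> y \<in> carrier R \<Longrightarrow> z \<in> carrier R \<Longrightarrow>
      orth x z \<Longrightarrow> orth y z \<Longrightarrow> orth (x \<oplus> y) z"
    and orth_add_right: "x \<in> carrier R \<Longrightarrow> y \<in> carrier R \<Longrightarrow> z \<in> carrier R \<Longrightarrow>
      orth x y \<Longrightarrow> orth x z \<Longrightarrow> orth x (y \<oplus> z)"
    and double_orth_left: "left_ideal N \<Longrightarrow> x \<in> carrier R \<Longrightarrow>
      (\<And>y. y \<in> carrier R \<Longrightarrow> (\<And>n. n \<in> N \<Longrightarrow> orth y n) \<Longrightarrow> orth y x) \<Longrightarrow> x \<in> N"
    and double_orth_right: "submodule N (opposite R) (regular_module (opposite R)) \<Longrightarrow> x \<in> carrier R \<Longrightarrow>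
      (\<And>y. y \<in> carrier R \<Longrightarrow> (\<And>n. n \<in> N \<Longrightarrow> orth n y) \<Longrightarrow> orth x y) \<Longrightarrow> x \<in> N"
begin

text \<open>Nondegeneracy, read off from the double orthogonal property of the zero left
  ideal.\<close>

lemma orth_all_imp_zero:
  assumes "x \<in> carrier R" "\<And>r. r \<in> carrier R \<Longrightarrow> orth r x"
  shows "x = \<zero>"
proof -
  have "left_ideal {\<zero>}"
    by (simp add: left_ideal_iff)
  from double_orth_left[OF this assms(1)] assms(2) show ?thesis
    by blast
qed

text \<open>The right annihilator of \<open>J\<close>, which turns out to be the left socle
  (\<open>socle_eq_ann_J\<close>). On it congruences modulo \<open>J\<close> become equations
  (\<open>ann_J_eq_mult\<close>).\<close>

definition ann_J :: "'a set" where
  "ann_J = {x \<in> carrier R. \<forall>j\<in>J. j \<otimes> x = \<zero>}"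

definition left_min :: "'a set \<Rightarrow> 'a set" where
  "left_min L = {x \<in> carrier R. \<forall>p\<in>right_max L. orth p x}"

text \<open>Associativity moves a factor across: \<open>orth p (a x)\<close> is
  \<open>orth (p a) x\<close>, and \<open>p a\<close> stays in the right ideal
  \<open>right_max L\<close>.\<close>

lemma left_min_left_ideal:
  assumes L: "L \<in> \<L>"
  shows "left_ideal (left_min L)"
proof -
  note P = right_max_right_ideal[OF L, unfolded right_ideal_iff]
  have PR: "p \<in> carrier R" if "p \<in> right_max L" for p
    using that by (simp add: right_max_def)
  have "orth p (a \<otimes> x)" if "p \<in> right_max L" "a \<in> carrier R" "x \<in> left_min L" for p a x
  proof -
    have "orth (p \<otimes> a) x"
      using P that by (auto simp: left_min_def)
    then show ?thesis
      using orth_assoc[of p a x] that PR by (simp add: left_min_def)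
  qed
  then show ?thesis
    using PR orth_zero orth_add_right unfolding left_ideal_iff by (auto simp: left_min_def)
qed

lemma left_min_carrier: "x \<in> left_min L \<Longrightarrow> x \<in> carrier R"
  by (simp add: left_min_def)

text \<open>For \<open>j\<close> in \<open>J\<close> all \<open>r j\<close> lie in
  \<open>right_max L\<close>, so every \<open>r\<close> is orthogonal to \<open>j x\<close>, which
  forces \<open>j x = 0\<close>.\<close>

lemma left_min_subset_ann_J:
  assumes L: "L \<in> \<L>"
  shows "left_min L \<subseteq> ann_J"
proof
  fix x assume x: "x \<in> left_min L"
  note xR = left_min_carrier[OF x]
  have "j \<otimes> x = \<zero>" if j: "j \<in> J" for j
  proof (rule orth_all_imp_zero)
    have jR: "j \<in> carrier R"
      using j by (rule J.a_Hcarr)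
    then show "j \<otimes> x \<in> carrier R"
      using xR by simp
    fix r assume r: "r \<in> carrier R"
    have "r \<otimes> j \<in> right_max L"
      using J_subset_right_max[OF L] J.I_l_closed[OF j r] by blast
    then have "orth (r \<otimes> j) x"
      using x by (simp add: left_min_def)
    then show "orth r (j \<otimes> x)"
      using orth_assoc[of r j x] r jR xR by simp
  qed
  then show "x \<in> ann_J"
    using xR by (simp add: ann_J_def)
qed

text \<open>By double orthogonality it suffices that every \<open>z\<close> orthogonal to
  \<open>R x\<close> lies in \<open>right_max L\<close>. If not, 1 is the sum of an element of
  \<open>right_max L\<close> and some \<open>z r\<close>, both orthogonal to \<open>R x\<close>;
  then every element is orthogonal to \<open>x\<close>, and \<open>x\<close> vanishes.\<close>

lemma left_min_generated:
  assumes L: "L \<in> \<L>" and x: "x \<in> left_min L" "x \<noteq> \<zero>" and y: "y \<in> left_min L"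
  shows "\<exists>r\<in>carrier R. y = r \<otimes> x"
proof -
  note xR = left_min_carrier[OF x(1)]
  let ?N = "{r \<otimes> x | r. r \<in> carrier R}"
  have "y \<in> ?N"
  proof (rule double_orth_left[OF principal_left_ideal(1)[OF xR] left_min_carrier[OF y]])
    fix z assume z: "z \<in> carrier R" and orth: "\<And>n. n \<in> ?N \<Longrightarrow> orth z n"
    have "z \<in> right_max L"
    proof (rule ccontr)
      assume "z \<notin> right_max L"
      then obtain r where r: "r \<in> carrier R" "\<one> \<ominus> z \<otimes> r \<in> right_max L"
        using right_max_maximal[OF L z] by blast
      have "orth t x" if t: "t \<in> carrier R" for t
      proof -
        have tx: "t \<otimes> x \<in> left_min L"
          using left_min_left_ideal[OF L] t x(1) by (simp add: left_ideal_iff)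
        note txR = left_min_carrier[OF tx]
        have 1: "orth (\<one> \<ominus> z \<otimes> r) (t \<otimes> x)"
          using tx r(2) by (simp add: left_min_def)
        have "orth z ((r \<otimes> t) \<otimes> x)"
          using orth r t by blast
        then have 2: "orth (z \<otimes> r) (t \<otimes> x)"
          using orth_assoc[of z r "t \<otimes> x"] z r t xR by (simp add: m_assoc)
        have "(\<one> \<ominus> z \<otimes> r) \<oplus> z \<otimes> r = \<one>"
          using z r by (simp add: minus_eq a_assoc l_neg)
        then have "orth \<one> (t \<otimes> x)"
          using orth_add_left[OF _ _ txR 1 2] z r(1) by simp
        then show "orth t x"
          using orth_assoc[of \<one> t x] t xR by simp
      qed
      then show False
        using orth_all_imp_zero[OF xR] x(2) by blast
    qed
    then show "orth z y"
      using y by (simp add: left_min_def)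
  qed
  then show ?thesis
    by blast
qed

text \<open>Otherwise \<open>e L\<close> kills \<open>left_min L\<close>, hence is orthogonal to it,
  and double orthogonality would place \<open>e L\<close> in \<open>right_max L\<close>.\<close>

lemma exists_e_mult_left_min:
  assumes L: "L \<in> \<L>"
  shows "\<exists>m\<in>left_min L. e L \<otimes> m \<noteq> \<zero>"
proof (rule ccontr)
  assume "\<not> ?thesis"
  then have em: "\<And>m. m \<in> left_min L \<Longrightarrow> e L \<otimes> m = \<zero>"
    by blast
  have "e L \<in> right_max L"
  proof (rule double_orth_right[OF right_max_right_ideal[OF L] e_closed[OF L]])
    fix y assume y: "y \<in> carrier R" "\<And>n. n \<in> right_max L \<Longrightarrow> orth n y"
    then have "e L \<otimes> y = \<zero>"
      by (intro em) (simp add: left_min_def)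
    then show "orth (e L) y"
      using orth_assoc[of \<one> "e L" y] orth_zero[of \<one>] e_closed[OF L] y by simp
  qed
  then show False
    using e_notin_right_max[OF L] by contradiction
qed

lemma ann_J_eq_mult:
  assumes "a \<ominus> b \<in> J" "a \<in> carrier R" "b \<in> carrier R" "x \<in> ann_J"
  shows "a \<otimes> x = b \<otimes> x"
proof -
  have x: "x \<in> carrier R" "(a \<ominus> b) \<otimes> x = \<zero>"
    using assms by (simp_all add: ann_J_def)
  then have "a \<otimes> x \<ominus> b \<otimes> x = \<zero>"
    using assms by (simp add: a_minus_def l_distr l_minus)
  then show ?thesis
    using assms x by (simp add: minus_eq_zero_iff)
qed

text \<open>Take \<open>n L = e L m\<close> with \<open>m\<close> in \<open>left_min L\<close>. On
  \<open>ann_J\<close> the relations that the \<open>e L\<close> satisfy modulo \<open>J\<close>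
  hold exactly.\<close>

lemma exists_generators:
  "\<exists>n. \<forall>L\<in>\<L>. n L \<in> left_min L \<and> n L \<noteq> \<zero> \<and> e L \<otimes> n L = n L \<and>
    (\<forall>L'\<in>\<L>. L' \<noteq> L \<longrightarrow> e L' \<otimes> n L = \<zero>)"
proof (rule bchoice, intro ballI)
  fix L assume L: "L \<in> \<L>"
  obtain m where m: "m \<in> left_min L" "e L \<otimes> m \<noteq> \<zero>"
    using exists_e_mult_left_min[OF L] by blast
  note mR = left_min_carrier[OF m(1)]
  have mJ: "m \<in> ann_J"
    using left_min_subset_ann_J[OF L] m(1) by blast
  have "e L \<otimes> m \<in> left_min L"
    using left_min_left_ideal[OF L] m(1) e_closed[OF L] by (simp add: left_ideal_iff)
  moreover have "e L \<otimes> (e L \<otimes> m) = e L \<otimes> m"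
    using ann_J_eq_mult[OF e_idempotent[OF L] _ _ mJ] e_closed[OF L] mR by (simp add: m_assoc)
  moreover have "e L' \<otimes> (e L \<otimes> m) = \<zero>" if L': "L' \<in> \<L>" "L' \<noteq> L" for L'
  proof -
    have "(e L' \<otimes> e L) \<otimes> m = \<zero>"
      using e_orthogonal[OF L'(1) L] L'(2) mJ by (auto simp: ann_J_def)
    then show ?thesis
      using e_closed[OF L] e_closed[OF L'(1)] mR by (simp add: m_assoc)
  qed
  ultimately show "\<exists>n. n \<in> left_min L \<and> n \<noteq> \<zero> \<and> e L \<otimes> n = n \<and> (\<forall>L'\<in>\<L>. L' \<noteq> L \<longrightarrow> e L' \<otimes> n = \<zero>)"
    using m(2) by blast
qed

lemma ann_J_left_ideal: "left_ideal ann_J"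
proof -
  have "j \<otimes> (a \<otimes> x) = \<zero>" if "j \<in> J" "a \<in> carrier R" "x \<in> ann_J" for j a x
  proof -
    have "(j \<otimes> a) \<otimes> x = \<zero>"
      using J.I_r_closed that by (simp add: ann_J_def)
    then show ?thesis
      using that J.a_Hcarr by (simp add: ann_J_def m_assoc)
  qed
  then show ?thesis
    unfolding left_ideal_iff by (auto simp: ann_J_def r_distr J.a_Hcarr)
qed

text \<open>The generator is the sum of the \<open>n L\<close>. The last clause is what later places
  \<open>s\<close>, and with it \<open>ann_J\<close>, inside the socle.\<close>

lemma ann_J_cyclic:
  "\<exists>s\<in>ann_J. ann_J \<subseteq> {r \<otimes> s | r. r \<in> carrier R} \<and> (\<forall>r\<in>carrier R. r \<otimes> s = \<zero> \<longleftrightarrow> r \<in> J) \<and>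
    (\<forall>N. left_ideal N \<and> (\<forall>L\<in>\<L>. left_min L \<subseteq> N) \<longrightarrow> s \<in> N)"
proof -
  obtain n where n: "\<And>L. L \<in> \<L> \<Longrightarrow> n L \<in> left_min L" "\<And>L. L \<in> \<L> \<Longrightarrow> n L \<noteq> \<zero>"
    "\<And>L. L \<in> \<L> \<Longrightarrow> e L \<otimes> n L = n L"
    "\<And>L L'. L \<in> \<L> \<Longrightarrow> L' \<in> \<L> \<Longrightarrow> L' \<noteq> L \<Longrightarrow> e L' \<otimes> n L = \<zero>"
    using exists_generators by metis
  have nR: "n L \<in> carrier R" if "L \<in> \<L>" for L
    using left_min_carrier[OF n(1)[OF that]] .
  define s where "s = (\<Oplus>L\<in>\<L>. n L)"
  have sN: "s \<in> N" if N: "left_ideal N" "\<And>L. L \<in> \<L> \<Longrightarrow> left_min L \<subseteq> N" for N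
    unfolding s_def
    by (rule finsum_mem) (use finite_\<L> N n(1) in \<open>auto simp: left_ideal_iff\<close>)
  have sP: "s \<in> ann_J"
    by (rule sN[OF ann_J_left_ideal left_min_subset_ann_J])
  then have sR: "s \<in> carrier R"
    by (simp add: ann_J_def)
  \<comment> \<open>Asking only for closure under addition lets \<open>N\<close> be the set of
    elements killed by \<open>e L\<close> in one use and the right orthogonal of
    \<open>e L R\<close> in the other.\<close>
  have split: "\<exists>s'\<in>N. s' \<in> carrier R \<and> s = n L \<oplus> s'"
    if L: "L \<in> \<L>" and N: "N \<subseteq> carrier R" "\<zero> \<in> N" "\<And>x y. x \<in> N \<Longrightarrow> y \<in> N \<Longrightarrow> x \<oplus> y \<in> N"
      "\<And>L'. L' \<in> \<L> \<Longrightarrow> L' \<noteq> L \<Longrightarrow> n L' \<in> N" for L N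
  proof -
    have "(\<Oplus>L'\<in>\<L> - {L}. n L') \<in> N"
      by (rule finsum_mem) (use finite_\<L> N in auto)
    moreover have "s = n L \<oplus> (\<Oplus>L'\<in>\<L> - {L}. n L')"
      unfolding s_def by (rule finsum_split) (use finite_\<L> L nR in auto)
    ultimately show ?thesis
      using N(1) by blast
  qed
  have es: "e L \<otimes> s = n L" if L: "L \<in> \<L>" for L
  proof -
    have "\<exists>s'\<in>{x \<in> carrier R. e L \<otimes> x = \<zero>}. s' \<in> carrier R \<and> s = n L \<oplus> s'"
      by (rule split[OF L]) (use e_closed[OF L] nR n(4) L in \<open>auto simp: r_distr\<close>)
    then obtain s' where "s' \<in> carrier R" "e L \<otimes> s' = \<zero>" "s = n L \<oplus> s'"
      by blast
    then show ?thesis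
      using n(3)[OF L] nR[OF L] e_closed[OF L] by (simp add: r_distr)
  qed
  have "x \<in> {r \<otimes> s | r. r \<in> carrier R}" if x: "x \<in> ann_J" for x
  proof (rule double_orth_left[OF principal_left_ideal(1)[OF sR]])
    show xR: "x \<in> carrier R"
      using x by (simp add: ann_J_def)
    fix z assume z: "z \<in> carrier R" and orth: "\<And>n. n \<in> {r \<otimes> s | r. r \<in> carrier R} \<Longrightarrow> orth z n"
    \<comment> \<open>Orthogonality to \<open>R s\<close> includes \<open>r n L = (r e L) s\<close>,
      hence all of \<open>left_min L\<close>. Double orthogonality then puts \<open>z\<close> into
      \<open>right_max L\<close> for each \<open>L\<close>.\<close>
    have "z \<in> J"
    proof (rule mem_J_if_e_mult[OF z])
      fix L assume L: "L \<in> \<L>"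
      have "z \<in> right_max L"
      proof (rule double_orth_right[OF right_max_right_ideal[OF L] z])
        fix y assume y: "y \<in> carrier R" "\<And>n. n \<in> right_max L \<Longrightarrow> orth n y"
        then have "y \<in> left_min L"
          by (simp add: left_min_def)
        then obtain r where r: "r \<in> carrier R" "y = r \<otimes> n L"
          using left_min_generated[OF L n(1)[OF L] n(2)[OF L]] by blast
        then have "y = (r \<otimes> e L) \<otimes> s"
          using es[OF L] e_closed[OF L] sR by (simp add: m_assoc)
        then show "orth z y"
          using orth r e_closed[OF L] by blast
      qed
      then show "e L \<otimes> z \<in> J"
        by (simp add: right_max_def)
    qed
    then have "z \<otimes> x = \<zero>"
      using x by (simp add: ann_J_def)
    have "orth (\<one> \<otimes> z) x \<longleftrightarrow> orth \<one> (z \<otimes> x)"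
      using z xR by (intro orth_assoc) auto
    then show "orth z x"
      using \<open>z \<otimes> x = \<zero>\<close> orth_zero[of \<one>] z by simp
  qed
  then have gen: "ann_J \<subseteq> {r \<otimes> s | r. r \<in> carrier R}"
    by (rule subsetI)
  have ann: "r \<in> J" if r: "r \<in> carrier R" "r \<otimes> s = \<zero>" for r
  proof (rule mem_J_if_mult_e[OF r(1)], rule ccontr)
    fix L assume L: "L \<in> \<L>" and "r \<otimes> e L \<notin> J"
    then obtain t where t: "t \<in> carrier R" "e L \<ominus> t \<otimes> (r \<otimes> e L) \<in> J"
      using mult_e_left_inverse[OF L r(1)] by blast
    note eR = e_closed[OF L] and nLR = nR[OF L]
    \<comment> \<open>The other summands of \<open>s\<close> belong to this orthogonal of
      \<open>e L R\<close>, since \<open>e L R\<close> lies in \<open>right_max L'\<close> for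
      \<open>L'\<close> different from \<open>L\<close>.\<close>
    let ?Q = "{x \<in> carrier R. \<forall>t\<in>carrier R. orth (e L \<otimes> t) x}"
    have "\<exists>s'\<in>?Q. s' \<in> carrier R \<and> s = n L \<oplus> s'"
    proof (rule split[OF L])
      fix L' assume L': "L' \<in> \<L>" "L' \<noteq> L"
      have "e L \<otimes> t \<in> right_max L'" if "t \<in> carrier R" for t
      proof -
        have "(e L' \<otimes> e L) \<otimes> t \<in> J"
          using J.I_r_closed[OF e_orthogonal[OF L'(1) L] that] L'(2) by blast
        then show ?thesis
          using eR e_closed[OF L'(1)] that by (simp add: right_max_def m_assoc)
      qed
      then show "n L' \<in> ?Q"
        using n(1)[OF L'(1)] by (simp add: left_min_def)
    qed (use eR orth_zero orth_add_right in auto)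
    then obtain s' where s': "s' \<in> carrier R" "\<And>t. t \<in> carrier R \<Longrightarrow> orth (e L \<otimes> t) s'" "s = n L \<oplus> s'"
      by blast
    have "\<zero> = r \<otimes> n L \<oplus> r \<otimes> s'"
      using r s' nLR by (simp add: r_distr)
    then have rn: "r \<otimes> n L = \<ominus> (r \<otimes> s')"
      using r(1) s'(1) nLR by (metis m_closed minus_equality a_comm)
    \<comment> \<open>Split \<open>y\<close> as \<open>e L y + (y - e L y)\<close>. The first part
      is orthogonal to \<open>r n L = - r s'\<close>. The second lies in \<open>right_max L\<close>,
      hence is orthogonal to \<open>r n L\<close> in \<open>left_min L\<close>.\<close>
    have "r \<otimes> n L = \<zero>"
    proof (rule orth_all_imp_zero)
      show rnR: "r \<otimes> n L \<in> carrier R"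
        using r nLR by simp
      fix y assume y: "y \<in> carrier R"
      have "orth (e L \<otimes> (y \<otimes> (\<ominus> r))) s'"
        using s'(2) y r by simp
      moreover have "e L \<otimes> (y \<otimes> (\<ominus> r)) = (e L \<otimes> y) \<otimes> (\<ominus> r)"
        using eR y r by (simp add: m_assoc)
      ultimately have "orth (e L \<otimes> y) ((\<ominus> r) \<otimes> s')"
        using orth_assoc[of "e L \<otimes> y" "\<ominus> r" s'] eR y r s'(1) by simp
      then have 1: "orth (e L \<otimes> y) (r \<otimes> n L)"
        using rn r s'(1) by (simp add: l_minus)
      have "(e L \<otimes> e L \<ominus> e L) \<otimes> y \<in> J"
        by (rule J.I_r_closed[OF e_idempotent[OF L] y])
      then have "\<ominus> ((e L \<otimes> e L \<ominus> e L) \<otimes> y) \<in> J"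
        by (rule J.a_inv_closed)
      moreover have "\<ominus> ((e L \<otimes> e L \<ominus> e L) \<otimes> y) = e L \<otimes> (y \<ominus> e L \<otimes> y)"
        using eR y by (simp add: a_minus_def r_distr l_distr l_minus r_minus minus_add m_assoc a_comm)
      ultimately have "y \<ominus> e L \<otimes> y \<in> right_max L"
        using eR y by (simp add: right_max_def)
      moreover have "r \<otimes> n L \<in> left_min L"
        using left_min_left_ideal[OF L] n(1)[OF L] r(1) by (simp add: left_ideal_iff)
      ultimately have 2: "orth (y \<ominus> e L \<otimes> y) (r \<otimes> n L)"
        by (simp add: left_min_def)
      have "(y \<ominus> e L \<otimes> y) \<oplus> e L \<otimes> y = y"
        using eR y by (simp add: minus_eq a_assoc l_neg)
      then show "orth y (r \<otimes> n L)"
        using orth_add_left[OF _ _ rnR 2 1] eR y by simp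
    qed
    then have "(t \<otimes> (r \<otimes> e L)) \<otimes> n L = \<zero>"
      using t r eR nLR n(3)[OF L] by (simp add: m_assoc)
    moreover have "e L \<otimes> n L = (t \<otimes> (r \<otimes> e L)) \<otimes> n L"
      using left_min_subset_ann_J[OF L] n(1)[OF L] t r eR by (intro ann_J_eq_mult) auto
    ultimately show False
      using n(2,3)[OF L] by simp
  qed
  have "r \<otimes> s = \<zero>" if "r \<in> J" for r
    using sP that by (simp add: ann_J_def)
  with ann have "\<forall>r\<in>carrier R. r \<otimes> s = \<zero> \<longleftrightarrow> r \<in> J"
    by blast
  moreover have "\<forall>N. left_ideal N \<and> (\<forall>L\<in>\<L>. left_min L \<subseteq> N) \<longrightarrow> s \<in> N"
    using sN by simp
  ultimately show ?thesis
    using gen sP by (intro bexI[of _ s] conjI)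
qed

text \<open>The left annihilator of a nonzero element of a simple left ideal is a maximal left
  ideal, so it contains \<open>J\<close>.\<close>

lemma simple_subset_ann_J:
  assumes N: "simple_submodule N R (regular_module R)"
  shows "N \<subseteq> ann_J"
proof
  fix x assume x: "x \<in> N"
  have N': "left_ideal N"
    using N by (simp add: simple_submodule_def)
  have xR: "x \<in> carrier R"
    using N' x by (auto simp: left_ideal_iff)
  show "x \<in> ann_J"
  proof (cases "x = \<zero>")
    case True
    then show ?thesis
      using ann_J_left_ideal by (simp add: left_ideal_iff)
  next
    case False
    let ?A = "{r \<in> carrier R. r \<otimes> x = \<zero>}"
    have "maximal_left_ideal ?A"
      unfolding maximal_left_ideal_iff
    proof (intro conjI ballI)
      show "left_ideal ?A"
        using xR by (auto simp: left_ideal_iff l_distr m_assoc)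
      show "\<one> \<notin> ?A"
        using False xR by simp
      fix a assume a: "a \<in> carrier R - ?A"
      let ?N = "{r \<otimes> (a \<otimes> x) | r. r \<in> carrier R}"
      have sub: "left_ideal ?N"
        using a xR by (intro principal_left_ideal(1)) auto
      have "?N \<subseteq> N"
        using N' x a by (auto simp: left_ideal_iff)
      have "a \<otimes> x = \<one> \<otimes> (a \<otimes> x)"
        using a xR by simp
      then have "a \<otimes> x \<in> ?N"
        by blast
      then have "?N \<noteq> {\<zero>}"
        using a by auto
      moreover have "L = {\<zero>} \<or> L = N" if "left_ideal L" "L \<subseteq> N" for L
        using N that by (simp add: simple_submodule_def)
      ultimately have "?N = N"
        using sub \<open>?N \<subseteq> N\<close> by blast
      then obtain r where r: "r \<in> carrier R" "x = r \<otimes> (a \<otimes> x)"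
        using x by auto
      then have "x \<ominus> r \<otimes> (a \<otimes> x) = \<zero>"
        using xR a by (simp add: minus_eq_zero_iff)
      then have "(\<one> \<ominus> r \<otimes> a) \<otimes> x = \<zero>"
        using r(1) a xR by (simp add: a_minus_def l_distr l_minus m_assoc)
      then show "\<exists>r\<in>carrier R. \<one> \<ominus> r \<otimes> a \<in> ?A"
        using r(1) a by (intro bexI[of _ r]) auto
    qed
    then have "J \<subseteq> ?A"
      by (auto simp: jacobson_radical_iff)
    then show ?thesis
      using xR by (auto simp: ann_J_def)
  qed
qed

lemma left_min_simple:
  assumes L: "L \<in> \<L>"
  shows "simple_submodule (left_min L) R (regular_module R)"
  unfolding simple_submodule_def
proof (intro conjI allI impI)
  show "left_ideal (left_min L)"
    by (rule left_min_left_ideal[OF L])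
  show "left_min L \<noteq> {\<zero>\<^bsub>regular_module R\<^esub>}"
  proof
    assume zero: "left_min L = {\<zero>\<^bsub>regular_module R\<^esub>}"
    obtain m where "m \<in> left_min L" "e L \<otimes> m \<noteq> \<zero>"
      using exists_e_mult_left_min[OF L] ..
    with zero e_closed[OF L] show False
      by simp
  qed
  fix N assume N: "left_ideal N \<and> N \<subseteq> left_min L"
  show "N = {\<zero>\<^bsub>regular_module R\<^esub>} \<or> N = left_min L"
  proof (cases "N \<subseteq> {\<zero>}")
    case True
    then show ?thesis
      using N by (auto simp: left_ideal_iff)
  next
    case False
    then obtain x where x: "x \<in> N" "x \<noteq> \<zero>"
      by blast
    have "y \<in> N" if "y \<in> left_min L" for y
    proof -
      have "x \<in> left_min L"
        using N x(1) by blast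
      from left_min_generated[OF L this x(2) that] obtain r where "r \<in> carrier R" "y = r \<otimes> x" ..
      then show ?thesis
        using N x(1) by (simp add: left_ideal_iff)
    qed
    then show ?thesis
      using N by blast
  qed
qed

text \<open>Simple left ideals lie in the left ideal \<open>ann_J\<close>. Conversely, a left ideal
  containing all simple ones contains every \<open>left_min L\<close>, thus the generator
  \<open>s\<close> and all of \<open>ann_J\<close>.\<close>

lemma socle_eq_ann_J: "socle R (regular_module R) = ann_J"
proof
  show "socle R (regular_module R) \<subseteq> ann_J"
    using ann_J_left_ideal simple_subset_ann_J unfolding socle_def by blast
  obtain s where s: "ann_J \<subseteq> {r \<otimes> s | r. r \<in> carrier R}"
    "\<forall>N. left_ideal N \<and> (\<forall>L\<in>\<L>. left_min L \<subseteq> N) \<longrightarrow> s \<in> N"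
    using ann_J_cyclic by (elim bexE conjE)
  have "ann_J \<subseteq> N" if N: "left_ideal N"
    "\<And>L. simple_submodule L R (regular_module R) \<Longrightarrow> L \<subseteq> N" for N
  proof -
    have "s \<in> N"
      using s(2) N left_min_simple by simp
    then show ?thesis
      using s(1) N(1) by (auto simp: left_ideal_iff)
  qed
  then show "ann_J \<subseteq> socle R (regular_module R)"
    unfolding socle_def by blast
qed

lemma socle_isomorphic: "socle_isomorphic_quotient R J"
proof -
  obtain s where s: "s \<in> ann_J" "ann_J \<subseteq> {r \<otimes> s | r. r \<in> carrier R}"
    "\<forall>r\<in>carrier R. r \<otimes> s = \<zero> \<longleftrightarrow> r \<in> J"
    using ann_J_cyclic by (elim bexE conjE)
  have sR: "s \<in> carrier R"
    using s(1) by (simp add: ann_J_def)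
  let ?Q = "quotient_module (regular_module R) J"
  define coset where "coset x = J +>\<^bsub>regular_module R\<^esub> x" for x
  note Q = left_ideal_quotient[OF jacobson_radical_left_ideal, folded coset_def]
  \<comment> \<open>Inverse to the map that right multiplication by \<open>s\<close> induces on
    \<open>R/J\<close>: the fibre over \<open>x = a s\<close> is itself the coset of
    \<open>a\<close> modulo \<open>J\<close>, so no representative has to be chosen.\<close>
  define \<phi> where "\<phi> x = {r \<in> carrier R. r \<otimes> s = x}" for x
  have \<phi>: "\<phi> (a \<otimes> s) = coset a" if a: "a \<in> carrier R" for a
  proof -
    have "r \<otimes> s = a \<otimes> s \<longleftrightarrow> r \<ominus> a \<in> J" if r: "r \<in> carrier R" for r
    proof -
      have "r \<otimes> s = a \<otimes> s \<longleftrightarrow> (r \<ominus> a) \<otimes> s = \<zero>"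
        using minus_eq_zero_iff[of "r \<otimes> s" "a \<otimes> s"] a r sR
        by (simp add: a_minus_def l_distr l_minus)
      then show ?thesis
        using bspec[OF s(3), of "r \<ominus> a"] a r by simp
    qed
    then show ?thesis
      using Q(5)[OF a a] by (auto simp: \<phi>_def)
  qed
  have rep: "\<exists>a\<in>carrier R. x = a \<otimes> s" if "x \<in> ann_J" for x
    using s(2) that by blast
  have mem: "a \<otimes> s \<in> ann_J" if "a \<in> carrier R" for a
    using ann_J_left_ideal s(1) that by (simp add: left_ideal_iff)
  show ?thesis
    unfolding socle_isomorphic_quotient_def module_isomorphic_def socle_eq_ann_J
  proof (intro exI[of _ \<phi>] conjI ballI)
    show "bij_betw \<phi> (carrier ((regular_module R)\<lparr>carrier := ann_J\<rparr>)) (carrier ?Q)"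
      unfolding bij_betw_def
    proof
      show "inj_on \<phi> (carrier ((regular_module R)\<lparr>carrier := ann_J\<rparr>))"
      proof (rule inj_onI)
        fix x y assume "x \<in> carrier ((regular_module R)\<lparr>carrier := ann_J\<rparr>)"
          "y \<in> carrier ((regular_module R)\<lparr>carrier := ann_J\<rparr>)" and eq: "\<phi> x = \<phi> y"
        then obtain a where "a \<in> carrier R" "x = a \<otimes> s"
          using rep by auto
        then have "a \<in> \<phi> x"
          by (simp add: \<phi>_def)
        with eq have "a \<in> \<phi> y"
          by simp
        with \<open>x = a \<otimes> s\<close> show "x = y"
          by (simp add: \<phi>_def)
      qed
      have "\<phi> ` ann_J = coset ` carrier R"
      proof
        show "\<phi> ` ann_J \<subseteq> coset ` carrier R"
        proof
          fix X assume "X \<in> \<phi> ` ann_J"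
          then obtain x where x: "x \<in> ann_J" "X = \<phi> x" ..
          from rep[OF x(1)] obtain a where "a \<in> carrier R" "x = a \<otimes> s" ..
          with \<phi> x(2) show "X \<in> coset ` carrier R"
            by simp
        qed
        show "coset ` carrier R \<subseteq> \<phi> ` ann_J"
        proof
          fix X assume "X \<in> coset ` carrier R"
          then obtain a where a: "a \<in> carrier R" "X = coset a" ..
          with \<phi> mem[OF a(1)] show "X \<in> \<phi> ` ann_J"
            by (intro image_eqI[of _ _ "a \<otimes> s"]) simp_all
        qed
      qed
      then show "\<phi> ` carrier ((regular_module R)\<lparr>carrier := ann_J\<rparr>) = carrier ?Q"
        using Q(1)[OF zero_closed zero_closed] by simp
    qed
  next
    fix x y assume "x \<in> carrier ((regular_module R)\<lparr>carrier := ann_J\<rparr>)"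
      "y \<in> carrier ((regular_module R)\<lparr>carrier := ann_J\<rparr>)"
    then obtain a b where ab: "a \<in> carrier R" "x = a \<otimes> s" "b \<in> carrier R" "y = b \<otimes> s"
      using rep[of x] rep[of y] by auto
    then have "\<phi> (x \<oplus> y) = coset (a \<oplus> b)"
      using \<phi>[of "a \<oplus> b"] sR by (simp add: l_distr)
    then show "\<phi> (x \<oplus>\<^bsub>(regular_module R)\<lparr>carrier := ann_J\<rparr>\<^esub> y) = \<phi> x \<oplus>\<^bsub>?Q\<^esub> \<phi> y"
      using ab \<phi> Q(2)[of a b] by simp
  next
    fix a x assume a: "a \<in> carrier R" and "x \<in> carrier ((regular_module R)\<lparr>carrier := ann_J\<rparr>)"
    then obtain b where b: "b \<in> carrier R" "x = b \<otimes> s"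
      using rep by auto
    then have "\<phi> (a \<otimes> x) = coset (a \<otimes> b)"
      using \<phi>[of "a \<otimes> b"] sR a by (simp add: m_assoc)
    then show "\<phi> (a \<odot>\<^bsub>(regular_module R)\<lparr>carrier := ann_J\<rparr>\<^esub> x) = a \<odot>\<^bsub>?Q\<^esub> \<phi> x"
      using a b \<phi> Q(3)[of a b] by simp
  qed
qed

end

section \<open>Non projective Frobenius algebras\<close>

lemma smult_opposite [simp]: "smult (opposite R) = smult R"
  by (simp add: opposite_def)

lemma finsum_opposite [simp]: "finsum (opposite R) = finsum R"
  by (simp add: finsum_def fun_eq_iff)

context assoc_algebra
begin

text \<open>Since \<open>k x = (k 1) x\<close>, left ideals are submodules over the scalars, so the
  chain condition and double orthogonality over the base ring apply to them.\<close>

lemma left_ideal_submodule: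
  assumes "submodule N M (regular_module M)"
  shows "submodule N R M"
proof -
  note N = assms[unfolded left_ideal_iff]
  have "k \<odot>\<^bsub>M\<^esub> x \<in> N" if k: "k \<in> carrier R" and x: "x \<in> N" for k x
  proof -
    have "x \<in> carrier M"
      using x N by blast
    then have "(k \<odot>\<^bsub>M\<^esub> \<one>\<^bsub>M\<^esub>) \<otimes>\<^bsub>M\<^esub> x = k \<odot>\<^bsub>M\<^esub> x"
      using k smult_assoc2[of k "\<one>\<^bsub>M\<^esub>" x] by simp
    moreover have "(k \<odot>\<^bsub>M\<^esub> \<one>\<^bsub>M\<^esub>) \<otimes>\<^bsub>M\<^esub> x \<in> N"
      using N k x by simp
    ultimately show ?thesis
      by simp
  qed
  then show ?thesis
    using N by (simp add: submodule_iff)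
qed

lemma opposite_assoc_algebra: "assoc_algebra R (opposite M)"
proof -
  have "module R (opposite M)"
  proof (rule moduleI)
    show "abelian_group (opposite M)"
      using opposite_ring by (rule ring.is_abelian_group)
  qed (use module_axioms in \<open>simp_all add: R.is_cring smult_l_distr smult_r_distr smult_assoc1\<close>)
  then show ?thesis
    using opposite_ring
    by (intro assoc_algebra.intro assoc_algebra_axioms.intro) (simp_all add: smult_assoc2 smult_assoc3)
qed

lemma right_ideal_submodule:
  assumes "submodule N (opposite M) (regular_module (opposite M))"
  shows "submodule N R M"
proof -
  have "submodule N R (opposite M)"
    by (rule assoc_algebra.left_ideal_submodule[OF opposite_assoc_algebra assms])
  moreover have "module R (opposite M)"
    using opposite_assoc_algebra by (simp add: assoc_algebra_def)
  ultimately show ?thesis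
    by (simp add: submodule_iff module.submodule_iff)
qed

end

text \<open>The flipped form \<open>\<lambda>x y. F y x\<close> is a Frobenius form for the opposite
  algebra.\<close>

lemma opposite_nonprojective_Frobenius_algebra:
  assumes "nonprojective_Frobenius_algebra K A"
  shows "nonprojective_Frobenius_algebra K (opposite A)"
proof -
  obtain F where alg: "assoc_algebra K A" and fg: "fin_gen_module K A" and F: "Frobenius_form K A F"
    using assms by (auto simp: nonprojective_Frobenius_algebra_def)
  interpret assoc_algebra K A
    by (rule alg)
  have "F (z \<otimes>\<^bsub>A\<^esub> y) x = F z (y \<otimes>\<^bsub>A\<^esub> x)" if "x \<in> carrier A" "y \<in> carrier A" "z \<in> carrier A" for x y z
    using F that by (simp add: Frobenius_form_def associative_form_def)
  then have "Frobenius_form K (opposite A) (\<lambda>x y. F y x)"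
    using F by (simp add: Frobenius_form_def bilinear_form_def associative_form_def
        nondegenerate_form_def)
  moreover have "fin_gen_module K (opposite A)"
    using fg by (simp add: fin_gen_module_def)
  ultimately show ?thesis
    using opposite_assoc_algebra unfolding nonprojective_Frobenius_algebra_def by blast
qed

text \<open>The left half of the Frobenius property, together with one inclusion between the
  radicals. The relation \<open>F x y = 0\<close> makes \<open>R\<close> a \<open>dual_ring\<close>:
  one-sided ideals are \<open>K\<close>-submodules and inherit \<open>perp_perp\<close>, left ideals
  for the flipped pairing and right ideals for \<open>F\<close> itself.\<close>

lemma nonprojective_Frobenius_algebra_left:
  assumes K: "cring K" "Frobenius_ring K" and R: "nonprojective_Frobenius_algebra K R"
  shows "artinian_module R (regular_module R)"
    and "socle_isomorphic_quotient R (jacobson_radical R)"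
    and "jacobson_radical (opposite R) \<subseteq> jacobson_radical R"
proof -
  obtain F where alg: "assoc_algebra K R" and fg: "fin_gen_module K R" and F: "Frobenius_form K R F"
    using R by (auto simp: nonprojective_Frobenius_algebra_def)
  interpret alg: assoc_algebra K R
    by (rule alg)
  interpret pairing: nondegenerate_pairing K R F
    using F by unfold_locales (auto simp: Frobenius_form_def)
  have assoc: "F (x \<otimes>\<^bsub>R\<^esub> y) z = F x (y \<otimes>\<^bsub>R\<^esub> z)"
    if "x \<in> carrier R" "y \<in> carrier R" "z \<in> carrier R" for x y z
    using F that by (simp add: Frobenius_form_def associative_form_def)
  have artK: "artinian_module K (regular_module K)"
    using K(2) by (simp add: Frobenius_ring_def)
  have cyc: "annihilators_cyclic K"
    by (rule cring.Frobenius_annihilators_cyclic[OF K])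
  have artR: "artinian_module K R"
    by (rule alg.fin_gen_artinian[OF artK fg])
  then show art: "artinian_module R (regular_module R)"
    using alg.left_ideal_submodule unfolding artinian_module_def by blast
  obtain \<L> e where "primitive_decomposition R \<L> e"
    using alg.artinian_primitive_decomposition[OF art] by blast
  then interpret dec: primitive_decomposition R \<L> e .
  interpret dual_ring R \<L> e "\<lambda>x y. F x y = \<zero>\<^bsub>K\<^esub>"
  proof unfold_locales
    fix N x
    assume N: "submodule N R (regular_module R)" and x: "x \<in> carrier R"
      and orth: "\<And>y. y \<in> carrier R \<Longrightarrow> (\<And>n. n \<in> N \<Longrightarrow> F y n = \<zero>\<^bsub>K\<^esub>) \<Longrightarrow> F y x = \<zero>\<^bsub>K\<^esub>"
    have "x \<in> perp K R F (perp K R (\<lambda>x y. F y x) N)"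
      using x orth by (simp add: perp_def)
    then show "x \<in> N"
      using nondegenerate_pairing.perp_perp[OF pairing.flip cyc artK artR
          alg.left_ideal_submodule[OF N]] by simp
  next
    fix N x
    assume N: "submodule N (opposite R) (regular_module (opposite R))" and x: "x \<in> carrier R"
      and orth: "\<And>y. y \<in> carrier R \<Longrightarrow> (\<And>n. n \<in> N \<Longrightarrow> F n y = \<zero>\<^bsub>K\<^esub>) \<Longrightarrow> F x y = \<zero>\<^bsub>K\<^esub>"
    have "x \<in> perp K R (\<lambda>x y. F y x) (perp K R F N)"
      using x orth by (simp add: perp_def)
    then show "x \<in> N"
      using pairing.perp_perp[OF cyc artK artR alg.right_ideal_submodule[OF N]] by simp
  qed (simp_all add: assoc pairing.F_add_left pairing.F_add_right)
  show "socle_isomorphic_quotient R (jacobson_radical R)"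
    by (rule socle_isomorphic)
  show "jacobson_radical (opposite R) \<subseteq> jacobson_radical R"
    by (rule dec.jacobson_radical_opposite_subset)
qed

text \<open>The left half is applied to \<open>R\<close> and to \<open>opposite R\<close>; the two
  inclusions of radicals combine to the single radical in the definition.\<close>

theorem nonprojective_Frobenius_algebra_Frobenius_ring:
  assumes K: "cring K" "Frobenius_ring K" and R: "nonprojective_Frobenius_algebra K R"
  shows "Frobenius_ring R"
proof -
  have op: "nonprojective_Frobenius_algebra K (opposite R)"
    by (rule opposite_nonprojective_Frobenius_algebra[OF R])
  have J: "jacobson_radical (opposite R) = jacobson_radical R"
    using nonprojective_Frobenius_algebra_left(3)[OF K R]
      nonprojective_Frobenius_algebra_left(3)[OF K op] by simp
  have "ring R"
    using R by (simp add: nonprojective_Frobenius_algebra_def assoc_algebra_def)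
  then show ?thesis
    unfolding Frobenius_ring_def
    using nonprojective_Frobenius_algebra_left(1,2)[OF K R]
      nonprojective_Frobenius_algebra_left(1,2)[OF K op] by (simp add: J)
qed

section \<open>Skew polynomial rings\<close>

lemma skew_poly_simps [simp]:
  "mult (skew_poly A \<sigma>) p q = (\<lambda>n. \<Oplus>\<^bsub>A\<^esub>i\<in>{..n}. p i \<otimes>\<^bsub>A\<^esub> (\<sigma> ^^ i) (q (n - i)))"
  "one (skew_poly A \<sigma>) = (\<lambda>i. if i = 0 then \<one>\<^bsub>A\<^esub> else \<zero>\<^bsub>A\<^esub>)"
  "zero (skew_poly A \<sigma>) = (\<lambda>i. \<zero>\<^bsub>A\<^esub>)"
  "add (skew_poly A \<sigma>) p q = (\<lambda>i. p i \<oplus>\<^bsub>A\<^esub> q i)"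
  "smult (skew_poly A \<sigma>) k p = (\<lambda>i. k \<odot>\<^bsub>A\<^esub> p i)"
  by (simp_all add: skew_poly_def)

text \<open>The bound is weak (\<open>i \<ge> n\<close>), so that \<open>n = 0\<close> describes the
  zero polynomial and inductions on \<open>n\<close> can start there.\<close>

lemma skew_poly_carrier_iff:
  "p \<in> carrier (skew_poly A \<sigma>) \<longleftrightarrow> (\<forall>i. p i \<in> carrier A) \<and> (\<exists>n. \<forall>i\<ge>n. p i = \<zero>\<^bsub>A\<^esub>)"
proof -
  have "(\<exists>n. \<forall>i>n. p i = \<zero>\<^bsub>A\<^esub>) \<longleftrightarrow> (\<exists>n. \<forall>i\<ge>n. p i = \<zero>\<^bsub>A\<^esub>)"
    by (meson Suc_le_eq less_imp_le)
  then show ?thesis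
    by (auto simp: skew_poly_def up_def bound_def)
qed

definition skew_monom :: "('a, 'z) ring_scheme \<Rightarrow> 'a \<Rightarrow> nat \<Rightarrow> nat \<Rightarrow> 'a" where
  "skew_monom A a d = (\<lambda>i. if i = d then a else \<zero>\<^bsub>A\<^esub>)"

locale skew_algebra = assoc_algebra K A for K and A (structure) +
  fixes \<sigma>
  assumes automorphism: "algebra_automorphism K A \<sigma>"
begin

abbreviation S where "S \<equiv> skew_poly A \<sigma>"

abbreviation skew_times (infixl "\<star>" 70) where "p \<star> q \<equiv> p \<otimes>\<^bsub>S\<^esub> q"

abbreviation monom where "monom \<equiv> skew_monom A"

lemma \<sigma>_closed [simp]: "a \<in> carrier A \<Longrightarrow> \<sigma> a \<in> carrier A"
  and \<sigma>_add: "a \<in> carrier A \<Longrightarrow> b \<in> carrier A \<Longrightarrow> \<sigma> (a \<oplus> b) = \<sigma> a \<oplus> \<sigma> b"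
  and \<sigma>_mult: "a \<in> carrier A \<Longrightarrow> b \<in> carrier A \<Longrightarrow> \<sigma> (a \<otimes> b) = \<sigma> a \<otimes> \<sigma> b"
  and \<sigma>_one: "\<sigma> \<one> = \<one>"
  and \<sigma>_smult: "k \<in> carrier K \<Longrightarrow> a \<in> carrier A \<Longrightarrow> \<sigma> (k \<odot> a) = k \<odot> \<sigma> a"
  and \<sigma>_bij: "bij_betw \<sigma> (carrier A) (carrier A)"
  using automorphism
  by (auto simp: algebra_automorphism_def ring_iso_def ring_hom_def)

lemma \<sigma>_zero: "\<sigma> \<zero> = \<zero>"
  using \<sigma>_add[of \<zero> \<zero>] by (metis M.add.l_cancel_one' M.zero_closed \<sigma>_closed l_zero)

lemma \<sigma>_pow_closed [simp]: "a \<in> carrier A \<Longrightarrow> (\<sigma> ^^ i) a \<in> carrier A"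
  by (induction i) auto

lemma \<sigma>_pow_add: "a \<in> carrier A \<Longrightarrow> b \<in> carrier A \<Longrightarrow> (\<sigma> ^^ i) (a \<oplus> b) = (\<sigma> ^^ i) a \<oplus> (\<sigma> ^^ i) b"
  by (induction i) (auto simp: \<sigma>_add)

lemma \<sigma>_pow_mult: "a \<in> carrier A \<Longrightarrow> b \<in> carrier A \<Longrightarrow> (\<sigma> ^^ i) (a \<otimes> b) = (\<sigma> ^^ i) a \<otimes> (\<sigma> ^^ i) b"
  by (induction i) (auto simp: \<sigma>_mult)

lemma \<sigma>_pow_one [simp]: "(\<sigma> ^^ i) \<one> = \<one>"
  by (induction i) (auto simp: \<sigma>_one)

lemma \<sigma>_pow_zero [simp]: "(\<sigma> ^^ i) \<zero> = \<zero>"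
  by (induction i) (auto simp: \<sigma>_zero)

lemma \<sigma>_pow_smult: "k \<in> carrier K \<Longrightarrow> a \<in> carrier A \<Longrightarrow> (\<sigma> ^^ i) (k \<odot> a) = k \<odot> (\<sigma> ^^ i) a"
  by (induction i) (auto simp: \<sigma>_smult)

lemma \<sigma>_inverse: "a \<in> carrier A \<Longrightarrow> \<exists>b\<in>carrier A. \<sigma> b = a"
  using \<sigma>_bij unfolding bij_betw_def by (metis imageE)

lemma coeff_closed [simp]: "p \<in> carrier S \<Longrightarrow> p i \<in> carrier A"
  by (simp add: skew_poly_carrier_iff)

lemma skew_closed:
  "(\<lambda>i. \<zero>) \<in> carrier S" "\<one>\<^bsub>S\<^esub> \<in> carrier S"
  "p \<in> carrier S \<Longrightarrow> q \<in> carrier S \<Longrightarrow> (\<lambda>i. p i \<oplus> q i) \<in> carrier S"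
  "k \<in> carrier K \<Longrightarrow> p \<in> carrier S \<Longrightarrow> (\<lambda>i. k \<odot> p i) \<in> carrier S"
  "p \<in> carrier S \<Longrightarrow> (\<lambda>i. \<ominus> p i) \<in> carrier S"
  "a \<in> carrier A \<Longrightarrow> monom a d \<in> carrier S"
proof -
  have monom: "monom a d \<in> carrier S" if "a \<in> carrier A" for a d
    using that unfolding skew_poly_carrier_iff skew_monom_def
    by (intro conjI allI exI[of _ "Suc d"]) auto
  then show "a \<in> carrier A \<Longrightarrow> monom a d \<in> carrier S" .
  show "\<one>\<^bsub>S\<^esub> \<in> carrier S"
    using monom[of \<one> 0] by (simp add: skew_monom_def)
next
  assume "p \<in> carrier S" "q \<in> carrier S"
  then obtain n m where "\<forall>i\<ge>n. p i = \<zero>" "\<forall>i\<ge>m. q i = \<zero>"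
    by (auto simp: skew_poly_carrier_iff)
  then have "\<exists>n. \<forall>i\<ge>n. p i \<oplus> q i = \<zero>"
    by (intro exI[of _ "max n m"]) simp
  then show "(\<lambda>i. p i \<oplus> q i) \<in> carrier S"
    using \<open>p \<in> carrier S\<close> \<open>q \<in> carrier S\<close> by (simp add: skew_poly_carrier_iff)
next
  assume "p \<in> carrier S"
  then obtain n where "\<forall>i\<ge>n. p i = \<zero>"
    by (auto simp: skew_poly_carrier_iff)
  then have "\<forall>i\<ge>n. \<ominus> p i = \<zero>"
    by simp
  then show "(\<lambda>i. \<ominus> p i) \<in> carrier S"
    using \<open>p \<in> carrier S\<close> by (auto simp: skew_poly_carrier_iff)
next
  assume k: "k \<in> carrier K" and "p \<in> carrier S"
  then obtain n where "\<forall>i\<ge>n. p i = \<zero>"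
    by (auto simp: skew_poly_carrier_iff)
  then have "\<forall>i\<ge>n. k \<odot> p i = \<zero>"
    using k by simp
  then show "(\<lambda>i. k \<odot> p i) \<in> carrier S"
    using k \<open>p \<in> carrier S\<close> by (auto simp: skew_poly_carrier_iff)
qed (auto simp: skew_poly_carrier_iff)

lemma skew_mult_closed:
  assumes p: "p \<in> carrier S" and q: "q \<in> carrier S"
  shows "p \<star> q \<in> carrier S"
proof -
  obtain n m where n: "\<forall>i\<ge>n. p i = \<zero>" and m: "\<forall>i\<ge>m. q i = \<zero>"
    using p q by (auto simp: skew_poly_carrier_iff)
  have "(\<Oplus>j\<in>{..i}. p j \<otimes> (\<sigma> ^^ j) (q (i - j))) = \<zero>" if i: "i \<ge> n + m" for i
  proof (rule M.add.finprod_one_eqI)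
    fix j assume "j \<in> {..i}"
    show "p j \<otimes> (\<sigma> ^^ j) (q (i - j)) = \<zero>"
    proof (cases "j \<ge> n")
      case False
      then have "q (i - j) = \<zero>"
        using i m by simp
      then show ?thesis
        using p by simp
    qed (use n q in simp)
  qed
  then show ?thesis
    using p q unfolding skew_poly_carrier_iff by (auto intro!: finsum_closed)
qed

lemma skew_l_distr:
  assumes "p \<in> carrier S" "q \<in> carrier S" "r \<in> carrier S"
  shows "(p \<oplus>\<^bsub>S\<^esub> q) \<star> r = p \<star> r \<oplus>\<^bsub>S\<^esub> q \<star> r"
proof
  fix n
  have "(\<Oplus>i\<in>{..n}. (p i \<oplus> q i) \<otimes> (\<sigma> ^^ i) (r (n - i))) =
      (\<Oplus>i\<in>{..n}. p i \<otimes> (\<sigma> ^^ i) (r (n - i)) \<oplus> q i \<otimes> (\<sigma> ^^ i) (r (n - i)))"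
    by (rule finsum_cong') (use assms in \<open>auto simp: l_distr\<close>)
  also have "\<dots> = (\<Oplus>i\<in>{..n}. p i \<otimes> (\<sigma> ^^ i) (r (n - i))) \<oplus> (\<Oplus>i\<in>{..n}. q i \<otimes> (\<sigma> ^^ i) (r (n - i)))"
    by (rule finsum_addf) (use assms in auto)
  finally show "((p \<oplus>\<^bsub>S\<^esub> q) \<star> r) n = (p \<star> r \<oplus>\<^bsub>S\<^esub> q \<star> r) n"
    by simp
qed

lemma skew_r_distr:
  assumes "p \<in> carrier S" "q \<in> carrier S" "r \<in> carrier S"
  shows "r \<star> (p \<oplus>\<^bsub>S\<^esub> q) = r \<star> p \<oplus>\<^bsub>S\<^esub> r \<star> q"
proof
  fix n
  have "(\<Oplus>i\<in>{..n}. r i \<otimes> (\<sigma> ^^ i) (p (n - i) \<oplus> q (n - i))) =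
      (\<Oplus>i\<in>{..n}. r i \<otimes> (\<sigma> ^^ i) (p (n - i)) \<oplus> r i \<otimes> (\<sigma> ^^ i) (q (n - i)))"
    by (rule finsum_cong') (use assms in \<open>auto simp: r_distr \<sigma>_pow_add\<close>)
  also have "\<dots> = (\<Oplus>i\<in>{..n}. r i \<otimes> (\<sigma> ^^ i) (p (n - i))) \<oplus> (\<Oplus>i\<in>{..n}. r i \<otimes> (\<sigma> ^^ i) (q (n - i)))"
    by (rule finsum_addf) (use assms in auto)
  finally show "(r \<star> (p \<oplus>\<^bsub>S\<^esub> q)) n = (r \<star> p \<oplus>\<^bsub>S\<^esub> r \<star> q) n"
    by simp
qed

text \<open>Together with \<open>mult_monom\<close> this gives explicit coefficients for products
  with a monomial; most later computations rest on these two instead of the convolution sum.\<close>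

lemma monom_mult:
  assumes "a \<in> carrier A" "q \<in> carrier S"
  shows "(monom a d \<star> q) n = (if d \<le> n then a \<otimes> (\<sigma> ^^ d) (q (n - d)) else \<zero>)"
proof -
  have "(monom a d \<star> q) n = (\<Oplus>i\<in>{..n}. if d = i then a \<otimes> (\<sigma> ^^ i) (q (n - i)) else \<zero>)"
    unfolding skew_poly_simps skew_monom_def
    by (rule finsum_cong') (use assms in auto)
  also have "\<dots> = (if d \<le> n then a \<otimes> (\<sigma> ^^ d) (q (n - d)) else \<zero>)"
  proof (cases "d \<le> n")
    case True
    then show ?thesis
      using finsum_singleton[of d "{..n}" "\<lambda>i. a \<otimes> (\<sigma> ^^ i) (q (n - i))"] assms by auto
  next
    case False
    then show ?thesis
      by (auto intro!: M.add.finprod_one_eqI)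
  qed
  finally show ?thesis .
qed

lemma mult_monom:
  assumes "p \<in> carrier S" "a \<in> carrier A"
  shows "(p \<star> monom a d) n = (if d \<le> n then p (n - d) \<otimes> (\<sigma> ^^ (n - d)) a else \<zero>)"
proof -
  have "(p \<star> monom a d) n = (\<Oplus>i\<in>{..n}. if d \<le> n \<and> n - d = i then p i \<otimes> (\<sigma> ^^ i) a else \<zero>)"
    unfolding skew_poly_simps skew_monom_def
    by (rule finsum_cong') (use assms in auto)
  also have "\<dots> = (if d \<le> n then p (n - d) \<otimes> (\<sigma> ^^ (n - d)) a else \<zero>)"
  proof (cases "d \<le> n")
    case True
    then show ?thesis
      using finsum_singleton[of "n - d" "{..n}" "\<lambda>i. p i \<otimes> (\<sigma> ^^ i) a"] assms by auto
  next
    case False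
    then show ?thesis
      by (auto intro!: M.add.finprod_one_eqI)
  qed
  finally show ?thesis .
qed

lemma skew_induct [consumes 1, case_names zero monom add]:
  assumes p: "p \<in> carrier S"
    and zero: "P (\<lambda>i. \<zero>)"
    and monom: "\<And>a d. a \<in> carrier A \<Longrightarrow> P (monom a d)"
    and add: "\<And>p q. p \<in> carrier S \<Longrightarrow> q \<in> carrier S \<Longrightarrow> P p \<Longrightarrow> P q \<Longrightarrow> P (\<lambda>i. p i \<oplus> q i)"
  shows "P p"
proof -
  obtain n where "\<forall>i\<ge>n. p i = \<zero>"
    using p by (auto simp: skew_poly_carrier_iff)
  then show ?thesis
    using p
  proof (induction n arbitrary: p)
    case 0
    then have "p = (\<lambda>i. \<zero>)"
      by auto
    then show ?case
      using zero by simp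
  next
    case (Suc n)
    define q where "q i = (if i = n then \<zero> else p i)" for i
    have q: "q \<in> carrier S" "\<forall>i\<ge>n. q i = \<zero>"
      using Suc.prems by (auto simp: q_def skew_poly_carrier_iff)
    have "p = (\<lambda>i. q i \<oplus> monom (p n) n i)"
      using Suc.prems(2) by (auto simp: q_def skew_monom_def)
    moreover have "P (\<lambda>i. q i \<oplus> monom (p n) n i)"
      using q Suc.IH Suc.prems(2) by (intro add monom skew_closed) auto
    ultimately show ?case
      by simp
  qed
qed

lemma skew_mult_zero: "p \<in> carrier S \<Longrightarrow> p \<star> (\<lambda>i. \<zero>) = (\<lambda>i. \<zero>)"
  and skew_zero_mult: "p \<in> carrier S \<Longrightarrow> (\<lambda>i. \<zero>) \<star> p = (\<lambda>i. \<zero>)"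
  by (auto simp: fun_eq_iff intro!: M.add.finprod_one_eqI)

lemma monom_mult_monom:
  assumes "a \<in> carrier A" "b \<in> carrier A"
  shows "monom a d \<star> monom b e = monom (a \<otimes> (\<sigma> ^^ d) b) (d + e)"
proof
  fix n
  show "(monom a d \<star> monom b e) n = monom (a \<otimes> (\<sigma> ^^ d) b) (d + e) n"
    using assms monom_mult[OF assms(1) skew_closed(6)[OF assms(2), of e], of d n]
    by (auto simp: skew_monom_def simp del: skew_poly_simps(1))
qed

text \<open>Additivity reduces \<open>p\<close> and \<open>q\<close> to monomials while
  \<open>r\<close> stays arbitrary. Then both sides agree coefficientwise, because the powers of
  \<open>\<sigma>\<close> are multiplicative and compose.\<close>

lemma skew_m_assoc:
  assumes "p \<in> carrier S" "q \<in> carrier S" "r \<in> carrier S"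
  shows "p \<star> q \<star> r = p \<star> (q \<star> r)"
  using assms(1,2)
proof (induction p rule: skew_induct)
  case zero
  then show ?case
    using assms(3) by (simp add: skew_zero_mult skew_mult_closed del: skew_poly_simps(1))
next
  case (add p p')
  then show ?case
    using assms(3) skew_l_distr[unfolded skew_poly_simps(4)]
    by (simp add: skew_mult_closed del: skew_poly_simps(1))
next
  case (monom a d)
  show ?case
    using assms(2)
  proof (induction q rule: skew_induct)
    case zero
    then show ?case
      using assms(3) monom by (simp add: skew_zero_mult skew_mult_zero skew_closed del: skew_poly_simps(1))
  next
    case (add q q')
    then show ?case
      using assms(3) monom skew_l_distr[unfolded skew_poly_simps(4)] skew_r_distr[unfolded skew_poly_simps(4)]
      by (simp add: skew_mult_closed skew_closed del: skew_poly_simps(1))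
  next
    case (monom b e)
    have br: "monom b e \<star> r \<in> carrier S"
      using monom assms(3) by (intro skew_mult_closed skew_closed)
    show ?case
    proof
      fix n
      have "(monom a d \<star> (monom b e \<star> r)) n =
        (if d \<le> n then a \<otimes> (\<sigma> ^^ d) (if e \<le> n - d then b \<otimes> (\<sigma> ^^ e) (r (n - d - e)) else \<zero>) else \<zero>)"
        using \<open>a \<in> carrier A\<close> monom assms(3) br by (subst monom_mult) (auto simp: monom_mult simp del: skew_poly_simps(1))
      also have "\<dots> = (if d + e \<le> n then a \<otimes> (\<sigma> ^^ d) b \<otimes> (\<sigma> ^^ (d + e)) (r (n - (d + e))) else \<zero>)"
        using \<open>a \<in> carrier A\<close> monom assms(3) by (auto simp: \<sigma>_pow_mult m_assoc funpow_add)
      also have "\<dots> = (monom a d \<star> monom b e \<star> r) n"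
        using \<open>a \<in> carrier A\<close> monom assms(3)
        by (simp add: monom_mult_monom monom_mult del: skew_poly_simps(1))
      finally show "(monom a d \<star> monom b e \<star> r) n = (monom a d \<star> (monom b e \<star> r)) n"
        by simp
    qed
  qed
qed

lemma skew_one_eq: "\<one>\<^bsub>S\<^esub> = monom \<one> 0"
  by (simp add: skew_monom_def)

lemma skew_one_mult: "p \<in> carrier S \<Longrightarrow> \<one>\<^bsub>S\<^esub> \<star> p = p"
  and skew_mult_one: "p \<in> carrier S \<Longrightarrow> p \<star> \<one>\<^bsub>S\<^esub> = p"
  unfolding skew_one_eq by (auto simp: fun_eq_iff monom_mult mult_monom simp del: skew_poly_simps(1))

lemma skew_abelian_group: "abelian_group S"
proof (rule abelian_groupI)
  fix p assume p: "p \<in> carrier S"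
  then show "\<exists>q\<in>carrier S. q \<oplus>\<^bsub>S\<^esub> p = \<zero>\<^bsub>S\<^esub>"
    by (intro bexI[of _ "\<lambda>i. \<ominus> p i"]) (auto simp: l_neg skew_closed)
qed (auto simp: skew_closed[unfolded skew_poly_simps] a_ac)

lemma skew_ring: "ring S"
proof (rule ringI[OF skew_abelian_group])
  show "Group.monoid S"
    by (rule monoidI)
      (simp_all only: skew_mult_closed skew_closed skew_m_assoc skew_one_mult skew_mult_one)
qed (simp_all only: skew_l_distr skew_r_distr)

lemma skew_assoc_algebra: "assoc_algebra K S"
proof -
  have "module K S"
    by (rule moduleI)
      (auto simp: R.is_cring skew_abelian_group skew_closed smult_l_distr smult_r_distr smult_assoc1)
  moreover have "(k \<odot>\<^bsub>S\<^esub> p) \<star> q = k \<odot>\<^bsub>S\<^esub> (p \<star> q)"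
    if k: "k \<in> carrier K" and pq: "p \<in> carrier S" "q \<in> carrier S" for k p q
  proof
    fix n
    have "(\<Oplus>i\<in>{..n}. (k \<odot> p i) \<otimes> (\<sigma> ^^ i) (q (n - i))) =
        (\<Oplus>i\<in>{..n}. k \<odot> (p i \<otimes> (\<sigma> ^^ i) (q (n - i))))"
      by (rule finsum_cong') (use k pq in \<open>auto simp: smult_assoc2\<close>)
    also have "\<dots> = k \<odot> (\<Oplus>i\<in>{..n}. p i \<otimes> (\<sigma> ^^ i) (q (n - i)))"
      by (rule finsum_smult_ldistr[symmetric]) (use k pq in auto)
    finally show "((k \<odot>\<^bsub>S\<^esub> p) \<star> q) n = (k \<odot>\<^bsub>S\<^esub> (p \<star> q)) n"
      by simp
  qed
  moreover have "p \<star> (k \<odot>\<^bsub>S\<^esub> q) = k \<odot>\<^bsub>S\<^esub> (p \<star> q)"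
    if k: "k \<in> carrier K" and pq: "p \<in> carrier S" "q \<in> carrier S" for k p q
  proof
    fix n
    have "(\<Oplus>i\<in>{..n}. p i \<otimes> (\<sigma> ^^ i) (k \<odot> q (n - i))) =
        (\<Oplus>i\<in>{..n}. k \<odot> (p i \<otimes> (\<sigma> ^^ i) (q (n - i))))"
      by (rule finsum_cong') (use k pq in \<open>auto simp: smult_assoc3 \<sigma>_pow_smult\<close>)
    also have "\<dots> = k \<odot> (\<Oplus>i\<in>{..n}. p i \<otimes> (\<sigma> ^^ i) (q (n - i)))"
      by (rule finsum_smult_ldistr[symmetric]) (use k pq in auto)
    finally show "(p \<star> (k \<odot>\<^bsub>S\<^esub> q)) n = (k \<odot>\<^bsub>S\<^esub> (p \<star> q)) n"
      by simp
  qed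
  ultimately show ?thesis
    using skew_ring by (intro assoc_algebra.intro assoc_algebra_axioms.intro)
qed

end

section \<open>Quotients of skew polynomial rings\<close>

declare skew_poly_simps [simp del]

context module
begin

text \<open>By bilinearity, injectivity of the two maps into the dual reduces to trivial
  kernels.\<close>

lemma nondegenerate_formI:
  assumes F: "bilinear_form R M F"
    and left: "\<And>x. x \<in> carrier M \<Longrightarrow> (\<And>y. y \<in> carrier M \<Longrightarrow> F x y = \<zero>) \<Longrightarrow> x = \<zero>\<^bsub>M\<^esub>"
    and right: "\<And>y. y \<in> carrier M \<Longrightarrow> (\<And>x. x \<in> carrier M \<Longrightarrow> F x y = \<zero>) \<Longrightarrow> y = \<zero>\<^bsub>M\<^esub>"
  shows "nondegenerate_form M F"
proof -
  have minus: "F (x \<ominus>\<^bsub>M\<^esub> y) z = F x z \<ominus> F y z" "F z (x \<ominus>\<^bsub>M\<^esub> y) = F z x \<ominus> F z y"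
    if xyz: "x \<in> carrier M" "y \<in> carrier M" "z \<in> carrier M" for x y z
  proof -
    have "x \<ominus>\<^bsub>M\<^esub> y = x \<oplus>\<^bsub>M\<^esub> (\<ominus> \<one>) \<odot>\<^bsub>M\<^esub> y"
      using xyz by (simp add: a_minus_def smult_l_minus)
    then show "F (x \<ominus>\<^bsub>M\<^esub> y) z = F x z \<ominus> F y z" "F z (x \<ominus>\<^bsub>M\<^esub> y) = F z x \<ominus> F z y"
      using F xyz by (simp_all add: bilinear_form_def a_minus_def R.l_minus)
  qed
  have closed: "F x y \<in> carrier R" if "x \<in> carrier M" "y \<in> carrier M" for x y
    using F that by (simp add: bilinear_form_def)
  show ?thesis
    unfolding nondegenerate_form_def
  proof (intro conjI inj_onI)
    fix x x' assume x: "x \<in> carrier M" "x' \<in> carrier M"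
      and eq: "(\<lambda>y\<in>carrier M. F x y) = (\<lambda>y\<in>carrier M. F x' y)"
    have "F (x \<ominus>\<^bsub>M\<^esub> x') y = \<zero>" if "y \<in> carrier M" for y
      using fun_cong[OF eq, of y] that x closed by (simp add: minus R.minus_eq R.r_neg)
    then have "x \<ominus>\<^bsub>M\<^esub> x' = \<zero>\<^bsub>M\<^esub>"
      using x by (intro left) auto
    then show "x = x'"
      using x by (simp add: M.minus_eq_zero_iff)
  next
    fix y y' assume y: "y \<in> carrier M" "y' \<in> carrier M"
      and eq: "(\<lambda>x\<in>carrier M. F x y) = (\<lambda>x\<in>carrier M. F x y')"
    have "F x (y \<ominus>\<^bsub>M\<^esub> y') = \<zero>" if "x \<in> carrier M" for x
      using fun_cong[OF eq, of x] that y closed by (simp add: minus R.minus_eq R.r_neg)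
    then have "y \<ominus>\<^bsub>M\<^esub> y' = \<zero>\<^bsub>M\<^esub>"
      using y by (intro right) auto
    then show "y = y'"
      using y by (simp add: M.minus_eq_zero_iff)
  qed
qed

end

context assoc_algebra
begin

lemma quotient_module_ops:
  assumes I: "ideal I M"
  defines "c \<equiv> \<lambda>x. I +>\<^bsub>M\<^esub> x" and "Q \<equiv> quotient_module M I"
  shows "carrier Q = c ` carrier M" "\<one>\<^bsub>Q\<^esub> = c \<one>\<^bsub>M\<^esub>" "\<zero>\<^bsub>Q\<^esub> = c \<zero>\<^bsub>M\<^esub>"
    "\<And>a b. a \<in> carrier M \<Longrightarrow> b \<in> carrier M \<Longrightarrow> c a \<oplus>\<^bsub>Q\<^esub> c b = c (a \<oplus>\<^bsub>M\<^esub> b)"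
    "\<And>a b. a \<in> carrier M \<Longrightarrow> b \<in> carrier M \<Longrightarrow> c a \<otimes>\<^bsub>Q\<^esub> c b = c (a \<otimes>\<^bsub>M\<^esub> b)"
    "\<And>k a. k \<in> carrier R \<Longrightarrow> a \<in> carrier M \<Longrightarrow> k \<odot>\<^bsub>Q\<^esub> c a = c (k \<odot>\<^bsub>M\<^esub> a)"
    "\<And>a b. a \<in> carrier M \<Longrightarrow> b \<in> carrier M \<Longrightarrow> c a = c b \<longleftrightarrow> a \<ominus>\<^bsub>M\<^esub> b \<in> I"
    "\<And>a x. a \<in> carrier M \<Longrightarrow> x \<in> c a \<longleftrightarrow> x \<in> carrier M \<and> x \<ominus>\<^bsub>M\<^esub> a \<in> I"
proof -
  interpret I: ideal I M
    by (rule I)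
  show "carrier Q = c ` carrier M"
    by (simp add: Q_def c_def quotient_module_simps a_rcosets_eq_image)
  show "\<one>\<^bsub>Q\<^esub> = c \<one>\<^bsub>M\<^esub>" "\<zero>\<^bsub>Q\<^esub> = c \<zero>\<^bsub>M\<^esub>"
    using M.a_coset_add_zero[OF I.a_subset] by (simp_all add: Q_def c_def quotient_module_simps)
  show "c a \<oplus>\<^bsub>Q\<^esub> c b = c (a \<oplus>\<^bsub>M\<^esub> b)" "c a \<otimes>\<^bsub>Q\<^esub> c b = c (a \<otimes>\<^bsub>M\<^esub> b)"
    "c a = c b \<longleftrightarrow> a \<ominus>\<^bsub>M\<^esub> b \<in> I" if "a \<in> carrier M" "b \<in> carrier M" for a b
    using that I.a_rcos_sum I.rcoset_mult_add I.a_r_coset_eq_iff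
    by (simp_all add: Q_def c_def quotient_module_simps)
  show "k \<odot>\<^bsub>Q\<^esub> c a = c (k \<odot>\<^bsub>M\<^esub> a)" if k: "k \<in> carrier R" and a: "a \<in> carrier M" for k a
  proof -
    have "k \<odot>\<^bsub>M\<^esub> x \<in> I" if x: "x \<in> I" for x
    proof -
      have "(k \<odot>\<^bsub>M\<^esub> \<one>\<^bsub>M\<^esub>) \<otimes>\<^bsub>M\<^esub> x = k \<odot>\<^bsub>M\<^esub> x"
        using k x I.Icarr smult_assoc2[of k "\<one>\<^bsub>M\<^esub>" x] by simp
      then show ?thesis
        using I.I_l_closed[OF x, of "k \<odot>\<^bsub>M\<^esub> \<one>\<^bsub>M\<^esub>"] k by simp
    qed
    then show ?thesis
      using I.quotient_smult[where smult = "smult M" and k = k and a = a] k a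
      by (simp add: Q_def c_def quotient_module_simps smult_r_distr)
  qed
  show "x \<in> c a \<longleftrightarrow> x \<in> carrier M \<and> x \<ominus>\<^bsub>M\<^esub> a \<in> I" if a: "a \<in> carrier M" for a x
    using I.a_elemrcos_carrier[OF a] I.a_rcos_module_minus[OF ring_axioms a] by (auto simp: c_def)
qed

lemma quotient_assoc_algebra:
  assumes I: "ideal I M"
  shows "assoc_algebra R (quotient_module M I)"
proof -
  let ?Q = "quotient_module M I"
  define c where "c x = I +>\<^bsub>M\<^esub> x" for x
  note Q = quotient_module_ops[OF I, folded c_def]
  have QE: "\<exists>x\<in>carrier M. X = c x" if "X \<in> carrier ?Q" for X
    using that Q(1) by auto
  have cQ: "c x \<in> carrier ?Q" if "x \<in> carrier M" for x
    using that Q(1) by auto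
  have ab: "abelian_group ?Q"
  proof (rule abelian_groupI)
    fix X assume "X \<in> carrier ?Q"
    then obtain x where x: "x \<in> carrier M" "X = c x"
      using QE by blast
    then show "\<exists>Y\<in>carrier ?Q. Y \<oplus>\<^bsub>?Q\<^esub> X = \<zero>\<^bsub>?Q\<^esub>"
      by (intro bexI[of _ "c (\<ominus>\<^bsub>M\<^esub> x)"]) (auto simp: Q cQ M.l_neg)
  qed (auto dest!: QE simp: Q cQ M.a_ac)
  have "ring ?Q"
  proof (rule ringI[OF ab])
    show "Group.monoid ?Q"
      by (rule monoidI) (auto dest!: QE simp: Q cQ m_assoc)
  qed (auto dest!: QE simp: Q cQ l_distr r_distr)
  moreover have "module R ?Q"
    by (rule moduleI)
      (auto dest!: QE simp: R.is_cring ab Q cQ smult_l_distr smult_r_distr smult_assoc1)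
  ultimately show ?thesis
    by (intro assoc_algebra.intro assoc_algebra_axioms.intro)
      (auto dest!: QE simp: Q smult_assoc2 smult_assoc3)
qed

end

section \<open>Right division by \<open>f\<close> and reduced representatives\<close>

locale skew_quotient = skew_algebra K A \<sigma> for K and A (structure) and \<sigma> +
  fixes f :: "nat \<Rightarrow> 'c" and m :: nat
  assumes f_closed: "f \<in> carrier (skew_poly A \<sigma>)" and f_monic: "monic_of_degree A m f"
    and f_normal: "carrier (skew_poly A \<sigma>) #>\<^bsub>skew_poly A \<sigma>\<^esub> f = f <#\<^bsub>skew_poly A \<sigma>\<^esub> carrier (skew_poly A \<sigma>)"
    and f0: "f 0 \<in> Units A"
begin

sublocale S: assoc_algebra K S
  by (rule skew_assoc_algebra)

abbreviation I where "I \<equiv> carrier S #>\<^bsub>S\<^esub> f"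

abbreviation Q where "Q \<equiv> quotient_module S I"

abbreviation c where "c p \<equiv> I +>\<^bsub>S\<^esub> p"

lemma f_coeff: "f m = \<one>" "i > m \<Longrightarrow> f i = \<zero>"
  using f_monic by (simp_all add: monic_of_degree_def)

lemma mem_I_left: "p \<in> I \<longleftrightarrow> (\<exists>q\<in>carrier S. p = q \<star> f)"
  by (auto simp: r_coset_def)

lemma mem_I_right: "p \<in> I \<longleftrightarrow> (\<exists>q\<in>carrier S. p = f \<star> q)"
  unfolding f_normal by (auto simp: l_coset_def)

text \<open>Closure under left multiplication is read off from \<open>S f\<close>, closure under
  right multiplication from \<open>f S\<close>.\<close>

lemma I_ideal: "ideal I S"
proof (rule idealI[OF S.ring_axioms])
  show "subgroup I (add_monoid S)"
  proof (rule S.add.subgroupI)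
    show "I \<subseteq> carrier S"
      using f_closed by (auto simp: mem_I_left)
    show "I \<noteq> {}"
      using S.zero_closed by (auto simp: r_coset_def)
  next
    fix p assume "p \<in> I"
    then obtain q where q: "q \<in> carrier S" "p = q \<star> f"
      by (auto simp: mem_I_left)
    then have "\<ominus>\<^bsub>S\<^esub> p = (\<ominus>\<^bsub>S\<^esub> q) \<star> f"
      using f_closed by (simp add: S.l_minus)
    then show "\<ominus>\<^bsub>S\<^esub> p \<in> I"
      using q by (auto simp: mem_I_left)
  next
    fix p p' assume "p \<in> I" "p' \<in> I"
    then obtain q q' where q: "q \<in> carrier S" "p = q \<star> f" "q' \<in> carrier S" "p' = q' \<star> f"
      by (auto simp: mem_I_left)
    then have "p \<oplus>\<^bsub>S\<^esub> p' = (q \<oplus>\<^bsub>S\<^esub> q') \<star> f"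
      using f_closed by (simp add: S.l_distr)
    then show "p \<oplus>\<^bsub>S\<^esub> p' \<in> I"
      using q by (auto simp: mem_I_left)
  qed
next
  fix p x assume "p \<in> I" and x: "x \<in> carrier S"
  then obtain q where q: "q \<in> carrier S" "p = q \<star> f"
    by (auto simp: mem_I_left)
  then have "x \<star> p = (x \<star> q) \<star> f"
    using x f_closed by (simp add: S.m_assoc)
  then show "x \<star> p \<in> I"
    using q x by (auto simp: mem_I_left)
next
  fix p x assume "p \<in> I" and x: "x \<in> carrier S"
  then obtain q where q: "q \<in> carrier S" "p = f \<star> q"
    by (auto simp: mem_I_right)
  then have "p \<star> x = f \<star> (q \<star> x)"
    using x f_closed by (simp add: S.m_assoc)
  then show "p \<star> x \<in> I"
    using q x by (auto simp: mem_I_right)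
qed

sublocale I: ideal I S
  by (rule I_ideal)

sublocale Q: assoc_algebra K Q
  by (rule S.quotient_assoc_algebra[OF I_ideal])

lemmas Q_ops = S.quotient_module_ops[OF I_ideal]

lemma c_closed [simp]: "p \<in> carrier S \<Longrightarrow> c p \<in> carrier Q"
  by (simp add: Q_ops(1))

lemma coeff_add: "(p \<oplus>\<^bsub>S\<^esub> q) i = p i \<oplus> q i"
  and coeff_smult: "(k \<odot>\<^bsub>S\<^esub> p) i = k \<odot> p i"
  and coeff_zero: "\<zero>\<^bsub>S\<^esub> i = \<zero>"
  and coeff_one: "\<one>\<^bsub>S\<^esub> i = (if i = 0 then \<one> else \<zero>)"
  by (simp_all add: skew_poly_simps)

lemma coeff_minus:
  assumes "p \<in> carrier S" "q \<in> carrier S"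
  shows "(p \<ominus>\<^bsub>S\<^esub> q) i = p i \<ominus> q i"
proof -
  have "\<ominus>\<^bsub>S\<^esub> q = (\<lambda>i. \<ominus> q i)"
    by (rule S.minus_equality) (use assms in \<open>auto simp: skew_poly_simps l_neg skew_closed\<close>)
  then show ?thesis
    by (simp add: a_minus_def coeff_add)
qed

text \<open>Since \<open>f\<close> is monic and \<open>\<sigma>\<close> fixes 1, the left multiple
  of \<open>f\<close> by the monomial with coefficient \<open>p (m + n)\<close> in degree
  \<open>n\<close> has leading coefficient \<open>p (m + n)\<close>; subtracting it lowers the
  degree bound.\<close>

lemma exists_reduced:
  assumes "p \<in> carrier S"
  shows "\<exists>r\<in>carrier S. (\<forall>i\<ge>m. r i = \<zero>) \<and> p \<ominus>\<^bsub>S\<^esub> r \<in> I"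
proof -
  obtain n where n: "\<forall>i\<ge>n. p i = \<zero>"
    using assms by (auto simp: skew_poly_carrier_iff)
  then have "\<forall>i\<ge>m + n. p i = \<zero>"
    by simp
  then show ?thesis
    using assms
  proof (induction n arbitrary: p)
    case 0
    then show ?case
      by (intro bexI[of _ p]) (auto simp: S.minus_eq S.r_neg)
  next
    case (Suc n)
    let ?t = "monom (p (m + n)) n \<star> f"
    have mon: "monom (p (m + n)) n \<in> carrier S"
      using Suc.prems by (simp add: skew_closed)
    have t: "?t \<in> carrier S" "?t \<in> I"
      using mon f_closed by (auto simp: mem_I_left)
    have "(p \<ominus>\<^bsub>S\<^esub> ?t) i = \<zero>" if i: "i \<ge> m + n" for i
    proof (cases "i = m + n")
      case True
      then show ?thesis
        using Suc.prems t f_closed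
        by (simp add: coeff_minus monom_mult f_coeff minus_eq r_neg)
    next
      case False
      then have "p i = \<zero>" "f (i - n) = \<zero>"
        using Suc.prems i f_coeff by auto
      then show ?thesis
        using Suc.prems t f_closed by (simp add: coeff_minus monom_mult minus_eq)
    qed
    then obtain r where r: "r \<in> carrier S" "\<forall>i\<ge>m. r i = \<zero>" "(p \<ominus>\<^bsub>S\<^esub> ?t) \<ominus>\<^bsub>S\<^esub> r \<in> I"
      using Suc.IH[of "p \<ominus>\<^bsub>S\<^esub> ?t"] Suc.prems t by auto
    have "((p \<ominus>\<^bsub>S\<^esub> ?t) \<ominus>\<^bsub>S\<^esub> r) \<oplus>\<^bsub>S\<^esub> ?t \<in> I"
      using r(3) t(2) by (rule I.a_closed)
    also have "((p \<ominus>\<^bsub>S\<^esub> ?t) \<ominus>\<^bsub>S\<^esub> r) \<oplus>\<^bsub>S\<^esub> ?t = p \<ominus>\<^bsub>S\<^esub> r"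
      using Suc.prems t(1) r(1) by (simp add: S.minus_eq S.a_ac S.r_neg S.r_neg1 S.r_neg2)
    finally show ?case
      using r by blast
  qed
qed

text \<open>If \<open>q\<close> has degree \<open>d\<close>, then \<open>q f\<close> has coefficient
  \<open>q d\<close> in degree \<open>m + d\<close>, so nonzero multiples of \<open>f\<close> have
  degree at least \<open>m\<close>.\<close>

lemma reduced_mem_I:
  assumes r: "r \<in> I" "\<forall>i\<ge>m. r i = \<zero>"
  shows "r = \<zero>\<^bsub>S\<^esub>"
proof -
  obtain q where q: "q \<in> carrier S" "r = q \<star> f"
    using r by (auto simp: mem_I_left)
  have "q i = \<zero>" for i
  proof (rule ccontr)
    assume "q i \<noteq> \<zero>"
    obtain n where "\<forall>i\<ge>n. q i = \<zero>"
      using q by (auto simp: skew_poly_carrier_iff)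
    then have "{i. q i \<noteq> \<zero>} \<subseteq> {..n}"
      by auto (meson linear)
    then have fin: "finite {i. q i \<noteq> \<zero>}"
      by (rule finite_subset) simp
    define d where "d = Max {i. q i \<noteq> \<zero>}"
    have d: "q d \<noteq> \<zero>" "\<And>i. i > d \<Longrightarrow> q i = \<zero>"
      using Max_in[OF fin] Max_ge[OF fin] \<open>q i \<noteq> \<zero>\<close> unfolding d_def by (auto simp: not_le[symmetric])
    have "r (m + d) = (\<Oplus>i\<in>{..m + d}. if d = i then q i \<otimes> (\<sigma> ^^ i) (f (m + d - i)) else \<zero>)"
      unfolding q(2) skew_poly_simps
    proof (rule finsum_cong')
      fix i assume "i \<in> {..m + d}"
      show "q i \<otimes> (\<sigma> ^^ i) (f (m + d - i)) = (if d = i then q i \<otimes> (\<sigma> ^^ i) (f (m + d - i)) else \<zero>)"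
        using d(2)[of i] f_coeff(2)[of "m + d - i"] q(1) f_closed by (cases i d rule: linorder_cases) auto
    qed (use q(1) f_closed in auto)
    also have "\<dots> = q d"
      using finsum_singleton[of d "{..m + d}" "\<lambda>i. q i \<otimes> (\<sigma> ^^ i) (f (m + d - i))"] q(1) f_closed
      by (auto simp: f_coeff)
    finally show False
      using r(2) d(1) by simp
  qed
  then have "q = \<zero>\<^bsub>S\<^esub>"
    by (auto simp: skew_poly_simps)
  then show ?thesis
    using q f_closed by simp
qed

lemma reduced_rep_eq:
  assumes r: "r \<in> carrier S" "\<forall>i\<ge>m. r i = \<zero>"
  shows "reduced_rep A m (c r) = r"
  unfolding reduced_rep_def
proof (rule the_equality)
  show "r \<in> c r \<and> (\<forall>i\<ge>m. r i = \<zero>)"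
    using I.a_rcos_self r by blast
  fix s assume s: "s \<in> c r \<and> (\<forall>i\<ge>m. s i = \<zero>)"
  then have sS: "s \<in> carrier S" "s \<ominus>\<^bsub>S\<^esub> r \<in> I"
    using Q_ops(8)[OF r(1)] by auto
  have "(s \<ominus>\<^bsub>S\<^esub> r) i = \<zero>" if "i \<ge> m" for i
    using sS r s that by (simp add: coeff_minus minus_eq)
  then have "s \<ominus>\<^bsub>S\<^esub> r = \<zero>\<^bsub>S\<^esub>"
    using sS reduced_mem_I by blast
  then show "s = r"
    using sS r by (simp add: S.M.minus_eq_zero_iff)
qed

lemma Q_reduced:
  assumes "X \<in> carrier Q"
  obtains r where "r \<in> carrier S" "\<forall>i\<ge>m. r i = \<zero>" "X = c r" "reduced_rep A m X = r"
proof -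
  obtain p where p: "p \<in> carrier S" "X = c p"
    using assms Q_ops(1) by auto
  obtain r where r: "r \<in> carrier S" "\<forall>i\<ge>m. r i = \<zero>" "p \<ominus>\<^bsub>S\<^esub> r \<in> I"
    using exists_reduced[OF p(1)] by blast
  then have "X = c r"
    using p Q_ops(7) by simp
  then show thesis
    using that r reduced_rep_eq by blast
qed

end

section \<open>Invertibility of \<open>x\<close> in the quotient and finite generation\<close>

context skew_quotient
begin

text \<open>Left division by \<open>x\<close>: as \<open>x q\<close> has coefficients
  \<open>\<sigma> (q j)\<close>, the quotient needs preimages under \<open>\<sigma>\<close>.
  Choosing 0 over 0 keeps the support finite and carries degree bounds over to
  \<open>q\<close>.\<close>

lemma exists_shift:
  assumes p: "p \<in> carrier S"
  shows "\<exists>q\<in>carrier S. \<forall>i. \<sigma> (q i) = p (Suc i) \<and> (p (Suc i) = \<zero> \<longrightarrow> q i = \<zero>)"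
proof -
  have "\<exists>b. b \<in> carrier A \<and> \<sigma> b = p (Suc i) \<and> (p (Suc i) = \<zero> \<longrightarrow> b = \<zero>)" for i
    using \<sigma>_inverse[of "p (Suc i)"] p \<sigma>_zero by (cases "p (Suc i) = \<zero>") auto
  then obtain q where q: "\<And>i. q i \<in> carrier A \<and> \<sigma> (q i) = p (Suc i) \<and> (p (Suc i) = \<zero> \<longrightarrow> q i = \<zero>)"
    by metis
  obtain n where "\<forall>i\<ge>n. p i = \<zero>"
    using p by (auto simp: skew_poly_carrier_iff)
  then have "\<forall>i\<ge>n. q i = \<zero>"
    using q by simp
  then have "q \<in> carrier S"
    using q by (auto simp: skew_poly_carrier_iff)
  with q show ?thesis
    by blast
qed

abbreviation X where "X \<equiv> monom \<one> (Suc 0)"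

lemma X_closed: "X \<in> carrier S"
  by (simp add: skew_closed)

lemma X_mult: "q \<in> carrier S \<Longrightarrow> (X \<star> q) i = (case i of 0 \<Rightarrow> \<zero> | Suc j \<Rightarrow> \<sigma> (q j))"
  by (simp add: monom_mult split: nat.split)

lemma mult_X: "q \<in> carrier S \<Longrightarrow> (q \<star> X) i = (case i of 0 \<Rightarrow> \<zero> | Suc j \<Rightarrow> q j)"
  by (simp add: mult_monom split: nat.split)

text \<open>
  Writing \<open>f = f\<^sub>0 + u x = f\<^sub>0 + x u'\<close>, the elements \<open>- f\<^sub>0\<inverse> u\<close> and \<open>- u' f\<^sub>0\<inverse>\<close> are inverse to
  \<open>x\<close> modulo \<open>f\<close>.
\<close>

lemma X_left_inverse: "\<exists>U\<in>carrier Q. U \<otimes>\<^bsub>Q\<^esub> c X = \<one>\<^bsub>Q\<^esub>"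
proof -
  define g where "g = \<ominus> (inv f 0)"
  have f0': "f 0 \<in> carrier A" "inv f 0 \<in> carrier A" "inv f 0 \<otimes> f 0 = \<one>"
    using f0 by auto
  then have g: "g \<in> carrier A" "g \<otimes> f 0 = \<ominus> \<one>"
    by (simp_all add: g_def l_minus)
  define u where "u i = f (Suc i)" for i
  have "\<exists>n. \<forall>i\<ge>n. u i = \<zero>"
    using f_coeff(2) by (intro exI[of _ m]) (simp add: u_def)
  then have u: "u \<in> carrier S"
    using f_closed by (simp add: skew_poly_carrier_iff u_def)
  let ?g = "monom g 0"
  have gS: "?g \<in> carrier S"
    using g by (simp add: skew_closed)
  have "(?g \<star> u) \<star> X \<ominus>\<^bsub>S\<^esub> \<one>\<^bsub>S\<^esub> = ?g \<star> f"
  proof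
    fix i
    have "((?g \<star> u) \<star> X \<ominus>\<^bsub>S\<^esub> \<one>\<^bsub>S\<^esub>) i =
        (case i of 0 \<Rightarrow> \<zero> | Suc j \<Rightarrow> g \<otimes> u j) \<ominus> (if i = 0 then \<one> else \<zero>)"
      using g gS u X_closed
      by (simp add: coeff_minus mult_X monom_mult coeff_one split: nat.split)
    also have "\<dots> = g \<otimes> f i"
      using g u f_closed by (cases i) (auto simp: minus_eq u_def)
    finally show "((?g \<star> u) \<star> X \<ominus>\<^bsub>S\<^esub> \<one>\<^bsub>S\<^esub>) i = (?g \<star> f) i"
      using g f_closed by (simp add: monom_mult)
  qed
  then have "(?g \<star> u) \<star> X \<ominus>\<^bsub>S\<^esub> \<one>\<^bsub>S\<^esub> \<in> I"
    using gS by (auto simp: mem_I_left)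
  then have "c (?g \<star> u) \<otimes>\<^bsub>Q\<^esub> c X = \<one>\<^bsub>Q\<^esub>"
    using gS u X_closed by (simp add: Q_ops)
  then show ?thesis
    using gS u by (intro bexI[of _ "c (?g \<star> u)"]) simp_all
qed

lemma X_right_inverse: "\<exists>V\<in>carrier Q. c X \<otimes>\<^bsub>Q\<^esub> V = \<one>\<^bsub>Q\<^esub>"
proof -
  define g where "g = \<ominus> (inv f 0)"
  have f0': "f 0 \<in> carrier A" "inv f 0 \<in> carrier A" "f 0 \<otimes> inv f 0 = \<one>"
    using f0 by auto
  then have g: "g \<in> carrier A" "f 0 \<otimes> g = \<ominus> \<one>"
    by (simp_all add: g_def r_minus)
  obtain u where u: "u \<in> carrier S" "\<And>i. \<sigma> (u i) = f (Suc i)"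
    using exists_shift[OF f_closed] by blast
  let ?g = "monom g 0"
  have gS: "?g \<in> carrier S"
    using g by (simp add: skew_closed)
  have "X \<star> (u \<star> ?g) \<ominus>\<^bsub>S\<^esub> \<one>\<^bsub>S\<^esub> = f \<star> ?g"
  proof
    fix i
    have "(X \<star> (u \<star> ?g) \<ominus>\<^bsub>S\<^esub> \<one>\<^bsub>S\<^esub>) i =
        (case i of 0 \<Rightarrow> \<zero> | Suc j \<Rightarrow> f (Suc j) \<otimes> (\<sigma> ^^ Suc j) g) \<ominus> (if i = 0 then \<one> else \<zero>)"
      using g gS u X_closed
      by (simp add: coeff_minus X_mult mult_monom coeff_one \<sigma>_mult split: nat.split)
    also have "\<dots> = f i \<otimes> (\<sigma> ^^ i) g"
      using g u f_closed by (cases i) (auto simp: minus_eq)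
    finally show "(X \<star> (u \<star> ?g) \<ominus>\<^bsub>S\<^esub> \<one>\<^bsub>S\<^esub>) i = (f \<star> ?g) i"
      using g f_closed by (simp add: mult_monom)
  qed
  \<comment> \<open>Here \<open>f S = S f\<close> enters: the difference is \<open>f\<close>
    multiplied by a constant on the right.\<close>
  then have "X \<star> (u \<star> ?g) \<ominus>\<^bsub>S\<^esub> \<one>\<^bsub>S\<^esub> \<in> I"
    using gS by (auto simp: mem_I_right)
  then have "c X \<otimes>\<^bsub>Q\<^esub> c (u \<star> ?g) = \<one>\<^bsub>Q\<^esub>"
    using gS u X_closed by (simp add: Q_ops)
  then show ?thesis
    using gS u by (intro bexI[of _ "c (u \<star> ?g)"]) simp_all
qed

text \<open>The classes of \<open>b x^i\<close> with \<open>b\<close> in \<open>B\<close> and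
  \<open>i < m\<close> generate: in each degree, the coefficients whose monomials have class in
  \<open>N\<close> form a submodule of \<open>A\<close> containing \<open>B\<close>.\<close>

lemma fin_gen_quotient:
  assumes "fin_gen_module K A"
  shows "fin_gen_module K Q"
proof -
  obtain B where B: "finite B" "B \<subseteq> carrier A"
    "\<And>N. submodule N K A \<Longrightarrow> B \<subseteq> N \<Longrightarrow> carrier A \<subseteq> N"
    using fin_gen_moduleE[OF assms] by blast
  let ?B = "(\<lambda>(b, i). c (monom b i)) ` (B \<times> {..<m})"
  show ?thesis
  proof (rule Q.fin_gen_moduleI)
    show "finite ?B"
      using B(1) by simp
    show "?B \<subseteq> carrier Q"
      using B(2) by (auto simp: skew_closed)
  next
    fix N assume N: "submodule N K Q" "?B \<subseteq> N"
    note N' = N(1)[unfolded Q.submodule_iff]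
    have mon: "c (monom a i) \<in> N" if i: "i < m" and a: "a \<in> carrier A" for a i
    proof -
      let ?N = "{a \<in> carrier A. c (monom a i) \<in> N}"
      have monom_add: "monom (a \<oplus> b) i = monom a i \<oplus>\<^bsub>S\<^esub> monom b i" if "a \<in> carrier A" "b \<in> carrier A" for a b
        by (auto simp: skew_monom_def coeff_add)
      have monom_smult: "monom (k \<odot> a) i = k \<odot>\<^bsub>S\<^esub> monom a i" if "k \<in> carrier K" "a \<in> carrier A" for k a
        using that by (auto simp: skew_monom_def coeff_smult)
      have monom_zero: "monom \<zero> i = \<zero>\<^bsub>S\<^esub>"
        by (auto simp: skew_monom_def coeff_zero)
      have "submodule ?N K A"
        unfolding submodule_iff
      proof (intro conjI ballI)
        show "\<zero> \<in> ?N"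
          using N' by (simp add: monom_zero flip: Q_ops(3))
        fix a b assume "a \<in> ?N" "b \<in> ?N"
        then show "a \<oplus> b \<in> ?N"
          using N' by (auto simp: monom_add skew_closed simp flip: Q_ops(4))
      next
        fix k a assume "k \<in> carrier K" "a \<in> ?N"
        then show "k \<odot> a \<in> ?N"
          using N' by (auto simp: monom_smult skew_closed simp flip: Q_ops(6))
      qed auto
      moreover have "B \<subseteq> ?N"
        using B(2) N(2) i by auto
      ultimately show ?thesis
        using B(3) a by blast
    qed
    have "c p \<in> N" if "n \<le> m" "p \<in> carrier S" "\<forall>i\<ge>n. p i = \<zero>" for n p
      using that
    proof (induction n arbitrary: p)
      case 0
      then have "p = \<zero>\<^bsub>S\<^esub>"
        by (auto simp: coeff_zero)
      then show ?case
        using N' by (simp flip: Q_ops(3))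
    next
      case (Suc n)
      define q where "q i = (if i = n then \<zero> else p i)" for i
      have q0: "\<forall>i\<ge>n. q i = \<zero>"
        using Suc.prems by (auto simp: q_def)
      then have q: "q \<in> carrier S"
        using Suc.prems(2) by (auto simp: skew_poly_carrier_iff q_def)
      have "p = q \<oplus>\<^bsub>S\<^esub> monom (p n) n"
        using Suc.prems(2) by (auto simp: q_def skew_monom_def coeff_add)
      moreover have "c q \<in> N" "c (monom (p n) n) \<in> N"
        using Suc.IH[OF _ q q0] mon[of n "p n"] Suc.prems by simp_all
      moreover have "c (q \<oplus>\<^bsub>S\<^esub> monom (p n) n) = c q \<oplus>\<^bsub>Q\<^esub> c (monom (p n) n)"
        using q Suc.prems(2) by (simp add: Q_ops skew_closed)
      ultimately show ?case
        using N' by simp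
    qed
    then show "carrier Q \<subseteq> N"
      by (auto elim!: Q_reduced)
  qed
qed

end

section \<open>The Frobenius form on the quotient\<close>

locale skew_quotient_form = skew_quotient K A \<sigma> f m
  for K and A (structure) and \<sigma> and f :: "nat \<Rightarrow> 'c" and m +
  fixes F \<epsilon>
  assumes form: "Frobenius_form K A F" and functional: "b \<in> carrier A \<Longrightarrow> \<epsilon> b = F \<one> b"
begin

sublocale pairing: nondegenerate_pairing K A F
  using form by unfold_locales (auto simp: Frobenius_form_def)

lemma \<epsilon>_closed [simp]: "a \<in> carrier A \<Longrightarrow> \<epsilon> a \<in> carrier K"
  and \<epsilon>_add: "a \<in> carrier A \<Longrightarrow> b \<in> carrier A \<Longrightarrow> \<epsilon> (a \<oplus> b) = \<epsilon> a \<oplus>\<^bsub>K\<^esub> \<epsilon> b"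
  and \<epsilon>_smult: "k \<in> carrier K \<Longrightarrow> a \<in> carrier A \<Longrightarrow> \<epsilon> (k \<odot> a) = k \<otimes>\<^bsub>K\<^esub> \<epsilon> a"
  by (simp_all add: functional pairing.F_add_right pairing.F_smult_right)

lemma \<epsilon>_mult: "a \<in> carrier A \<Longrightarrow> b \<in> carrier A \<Longrightarrow> \<epsilon> (a \<otimes> b) = F a b"
proof -
  assume "a \<in> carrier A" "b \<in> carrier A"
  then have "F (\<one> \<otimes> a) b = F \<one> (a \<otimes> b)"
    using form unfolding Frobenius_form_def associative_form_def by blast
  then show ?thesis
    using \<open>a \<in> _\<close> \<open>b \<in> _\<close> by (simp add: functional)
qed

definition G where "G Y Z = \<epsilon> (reduced_rep A m (Y \<otimes>\<^bsub>Q\<^esub> Z) 0)"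

abbreviation rr where "rr \<equiv> reduced_rep A m"

lemma rr_closed: "Y \<in> carrier Q \<Longrightarrow> rr Y \<in> carrier S"
  by (auto elim!: Q_reduced)

text \<open>Polynomials of degree less than \<open>m\<close> are closed under sums, so adding
  representatives requires no reduction.\<close>

lemma rr_add:
  assumes "Y \<in> carrier Q" "Z \<in> carrier Q"
  shows "rr (Y \<oplus>\<^bsub>Q\<^esub> Z) = rr Y \<oplus>\<^bsub>S\<^esub> rr Z"
proof -
  obtain p where p: "p \<in> carrier S" "\<forall>i\<ge>m. p i = \<zero>" "Y = c p" "rr Y = p"
    by (rule Q_reduced[OF assms(1)])
  obtain q where q: "q \<in> carrier S" "\<forall>i\<ge>m. q i = \<zero>" "Z = c q" "rr Z = q"
    by (rule Q_reduced[OF assms(2)])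
  have "rr (c (p \<oplus>\<^bsub>S\<^esub> q)) = p \<oplus>\<^bsub>S\<^esub> q"
    by (rule reduced_rep_eq) (use p q in \<open>auto simp: coeff_add\<close>)
  then show ?thesis
    using p(1,4) q(1,4) by (simp add: p(3) q(3) Q_ops reduced_rep_eq[OF p(1,2)] reduced_rep_eq[OF q(1,2)])
qed

lemma rr_smult:
  assumes "k \<in> carrier K" "Y \<in> carrier Q"
  shows "rr (k \<odot>\<^bsub>Q\<^esub> Y) = k \<odot>\<^bsub>S\<^esub> rr Y"
proof -
  obtain p where p: "p \<in> carrier S" "\<forall>i\<ge>m. p i = \<zero>" "Y = c p" "rr Y = p"
    by (rule Q_reduced[OF assms(2)])
  have "rr (c (k \<odot>\<^bsub>S\<^esub> p)) = k \<odot>\<^bsub>S\<^esub> p"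
    by (rule reduced_rep_eq) (use p assms(1) in \<open>auto simp: coeff_smult\<close>)
  then show ?thesis
    using p(1,4) assms(1) by (simp add: p(3) Q_ops reduced_rep_eq[OF p(1,2)])
qed

lemma G_bilinear: "bilinear_form K Q G"
  unfolding bilinear_form_def G_def
proof (intro conjI ballI)
  fix Y Z W assume YZW: "Y \<in> carrier Q" "Z \<in> carrier Q" "W \<in> carrier Q"
  show "\<epsilon> (rr ((Y \<oplus>\<^bsub>Q\<^esub> Z) \<otimes>\<^bsub>Q\<^esub> W) 0) = \<epsilon> (rr (Y \<otimes>\<^bsub>Q\<^esub> W) 0) \<oplus>\<^bsub>K\<^esub> \<epsilon> (rr (Z \<otimes>\<^bsub>Q\<^esub> W) 0)"
    "\<epsilon> (rr (Y \<otimes>\<^bsub>Q\<^esub> (Z \<oplus>\<^bsub>Q\<^esub> W)) 0) = \<epsilon> (rr (Y \<otimes>\<^bsub>Q\<^esub> Z) 0) \<oplus>\<^bsub>K\<^esub> \<epsilon> (rr (Y \<otimes>\<^bsub>Q\<^esub> W) 0)"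
    using YZW by (simp_all add: Q.l_distr Q.r_distr rr_add rr_closed coeff_add \<epsilon>_add)
next
  fix k Y Z assume "k \<in> carrier K" "Y \<in> carrier Q" "Z \<in> carrier Q"
  then show "\<epsilon> (rr ((k \<odot>\<^bsub>Q\<^esub> Y) \<otimes>\<^bsub>Q\<^esub> Z) 0) = k \<otimes>\<^bsub>K\<^esub> \<epsilon> (rr (Y \<otimes>\<^bsub>Q\<^esub> Z) 0)"
    "\<epsilon> (rr (Y \<otimes>\<^bsub>Q\<^esub> (k \<odot>\<^bsub>Q\<^esub> Z)) 0) = k \<otimes>\<^bsub>K\<^esub> \<epsilon> (rr (Y \<otimes>\<^bsub>Q\<^esub> Z) 0)"
    by (simp_all add: Q.smult_assoc2 Q.smult_assoc3 rr_smult rr_closed coeff_smult \<epsilon>_smult)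
qed (simp add: rr_closed)

lemma G_assoc:
  "Y \<in> carrier Q \<Longrightarrow> Z \<in> carrier Q \<Longrightarrow> W \<in> carrier Q \<Longrightarrow> G (Y \<otimes>\<^bsub>Q\<^esub> Z) W = G Y (Z \<otimes>\<^bsub>Q\<^esub> W)"
  by (simp add: G_def Q.m_assoc)

text \<open>Induction over degree bounds \<open>n \<le> m\<close>. The bound makes
  \<open>a p\<close> already reduced, so pairing with a constant reads off \<open>F a (p 0)\<close>.
  Once \<open>p 0 = 0\<close>, \<open>p = x q\<close> with a smaller bound, and \<open>q\<close>
  stays in the kernel because its class is \<open>U\<close> times that of \<open>p\<close>.\<close>

lemma G_right_kernel:
  assumes "n \<le> m" "p \<in> carrier S" "\<forall>i\<ge>n. p i = \<zero>" "\<And>Y. Y \<in> carrier Q \<Longrightarrow> G Y (c p) = \<zero>\<^bsub>K\<^esub>"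
  shows "p = \<zero>\<^bsub>S\<^esub>"
  using assms
proof (induction n arbitrary: p)
  case 0
  then show ?case
    by (auto simp: coeff_zero)
next
  case (Suc n)
  have "F a (p 0) = \<zero>\<^bsub>K\<^esub>" if a: "a \<in> carrier A" for a
  proof -
    have aS: "monom a 0 \<in> carrier S"
      using a by (simp add: skew_closed)
    have "rr (c (monom a 0 \<star> p)) = monom a 0 \<star> p"
      by (rule reduced_rep_eq) (use a aS Suc.prems in \<open>auto simp: monom_mult\<close>)
    then have "G (c (monom a 0)) (c p) = \<epsilon> (a \<otimes> p 0)"
      using a aS Suc.prems(2) by (simp add: G_def Q_ops monom_mult)
    then show ?thesis
      using Suc.prems(2,4) a aS by (simp add: \<epsilon>_mult)
  qed
  then have p0: "p 0 = \<zero>"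
    using nondegenerate_pairing.nondegenerate_left[OF pairing.flip] Suc.prems(2) by simp
  obtain q where q: "q \<in> carrier S" "\<And>i. \<sigma> (q i) = p (Suc i)" "\<And>i. p (Suc i) = \<zero> \<Longrightarrow> q i = \<zero>"
    using exists_shift[OF Suc.prems(2)] by blast
  have pq: "p = X \<star> q"
    using q p0 by (auto simp: fun_eq_iff X_mult split: nat.split)
  obtain U where U: "U \<in> carrier Q" "U \<otimes>\<^bsub>Q\<^esub> c X = \<one>\<^bsub>Q\<^esub>"
    using X_left_inverse by blast
  have "G Y (c q) = \<zero>\<^bsub>K\<^esub>" if Y: "Y \<in> carrier Q" for Y
  proof -
    have "c p = c X \<otimes>\<^bsub>Q\<^esub> c q"
      using q X_closed by (simp add: pq Q_ops)
    then have "U \<otimes>\<^bsub>Q\<^esub> c p = c q"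
      using U q X_closed by (simp flip: Q.m_assoc)
    then have "G Y (c q) = G (Y \<otimes>\<^bsub>Q\<^esub> U) (c p)"
      using Y U Suc.prems(2) by (simp add: G_assoc)
    then show ?thesis
      using Suc.prems(4) Y U by simp
  qed
  then have "q = \<zero>\<^bsub>S\<^esub>"
    using Suc.prems(1,3) q(1,3) by (intro Suc.IH) auto
  then show ?case
    using X_closed by (simp add: pq)
qed

text \<open>Mirror image of \<open>G_right_kernel\<close>. Right multiplication by \<open>a\<close>
  twists the coefficients to \<open>p i \<otimes> (\<sigma> ^^ i) a\<close>, which leaves the
  constant one as \<open>p 0 \<otimes> a\<close>; splitting off \<open>x\<close> on the right is a
  plain shift without \<open>\<sigma>\<close>.\<close>

lemma G_left_kernel:
  assumes "n \<le> m" "p \<in> carrier S" "\<forall>i\<ge>n. p i = \<zero>" "\<And>Y. Y \<in> carrier Q \<Longrightarrow> G (c p) Y = \<zero>\<^bsub>K\<^esub>"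
  shows "p = \<zero>\<^bsub>S\<^esub>"
  using assms
proof (induction n arbitrary: p)
  case 0
  then show ?case
    by (auto simp: coeff_zero)
next
  case (Suc n)
  have "F (p 0) a = \<zero>\<^bsub>K\<^esub>" if a: "a \<in> carrier A" for a
  proof -
    have aS: "monom a 0 \<in> carrier S"
      using a by (simp add: skew_closed)
    have "rr (c (p \<star> monom a 0)) = p \<star> monom a 0"
      by (rule reduced_rep_eq) (use a aS Suc.prems in \<open>auto simp: mult_monom\<close>)
    then have "G (c p) (c (monom a 0)) = \<epsilon> (p 0 \<otimes> a)"
      using a aS Suc.prems(2) by (simp add: G_def Q_ops mult_monom)
    then show ?thesis
      using Suc.prems(2,4) a aS by (simp add: \<epsilon>_mult)
  qed
  then have p0: "p 0 = \<zero>"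
    using pairing.nondegenerate_left Suc.prems(2) by simp
  define q where "q i = p (Suc i)" for i
  have q0: "\<forall>i\<ge>n. q i = \<zero>"
    using Suc.prems(3) by (simp add: q_def)
  then have q: "q \<in> carrier S"
    using Suc.prems(2) by (auto simp: skew_poly_carrier_iff q_def)
  have pq: "p = q \<star> X"
    using q p0 by (auto simp: fun_eq_iff mult_X q_def split: nat.split)
  obtain V where V: "V \<in> carrier Q" "c X \<otimes>\<^bsub>Q\<^esub> V = \<one>\<^bsub>Q\<^esub>"
    using X_right_inverse by blast
  have "G (c q) Y = \<zero>\<^bsub>K\<^esub>" if Y: "Y \<in> carrier Q" for Y
  proof -
    have "c p = c q \<otimes>\<^bsub>Q\<^esub> c X"
      using q X_closed by (simp add: pq Q_ops)
    then have "c p \<otimes>\<^bsub>Q\<^esub> V = c q"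
      using V q X_closed by (simp add: Q.m_assoc)
    then have "G (c q) Y = G (c p) (V \<otimes>\<^bsub>Q\<^esub> Y)"
      using Y V Suc.prems(2) by (simp flip: G_assoc)
    then show ?thesis
      using Suc.prems(4) Y V by simp
  qed
  then have "q = \<zero>\<^bsub>S\<^esub>"
    using Suc.prems(1) q q0 by (intro Suc.IH) auto
  then show ?case
    using X_closed by (simp add: pq)
qed

lemma G_Frobenius_form: "Frobenius_form K Q G"
  unfolding Frobenius_form_def
proof (intro conjI)
  show "bilinear_form K Q G"
    by (rule G_bilinear)
  show "associative_form Q G"
    by (simp add: associative_form_def G_assoc)
  show "nondegenerate_form Q G"
  proof (rule Q.nondegenerate_formI[OF G_bilinear])
    fix Y assume Y: "Y \<in> carrier Q" and 0: "\<And>Z. Z \<in> carrier Q \<Longrightarrow> G Y Z = \<zero>\<^bsub>K\<^esub>"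
    from Y show "Y = \<zero>\<^bsub>Q\<^esub>"
    proof (rule Q_reduced)
      fix r assume "r \<in> carrier S" "\<forall>i\<ge>m. r i = \<zero>" "Y = c r"
      then show ?thesis
        using G_left_kernel[of m r] 0 by (simp add: Q_ops)
    qed
  next
    fix Y assume Y: "Y \<in> carrier Q" and 0: "\<And>Z. Z \<in> carrier Q \<Longrightarrow> G Z Y = \<zero>\<^bsub>K\<^esub>"
    from Y show "Y = \<zero>\<^bsub>Q\<^esub>"
    proof (rule Q_reduced)
      fix r assume "r \<in> carrier S" "\<forall>i\<ge>m. r i = \<zero>" "Y = c r"
      then show ?thesis
        using G_right_kernel[of m r] 0 by (simp add: Q_ops)
    qed
  qed
qed

end

theorem theorem22:
  fixes K :: "('k, 'y) ring_scheme"
    and A :: "('k, 'a, 'u) module_scheme"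
    and S :: "('k, nat \<Rightarrow> 'a) module"
    and R :: "('k, (nat \<Rightarrow> 'a) set) module"
    and \<epsilon> :: "'a \<Rightarrow> 'k" and \<sigma> :: "'a \<Rightarrow> 'a"
    and f :: "nat \<Rightarrow> 'a" and m :: nat
  assumes K: "cring K" "Frobenius_ring K"
    and A: "nonprojective_Frobenius_algebra K A"
    and \<epsilon>: "Frobenius_functional K A \<epsilon>"
    and \<sigma>: "algebra_automorphism K A \<sigma>"
    and S: "S = skew_poly A \<sigma>"
    and f: "f \<in> carrier S" "monic_of_degree A m f"
    and Sf_fS: "carrier S #>\<^bsub>S\<^esub> f = f <#\<^bsub>S\<^esub> carrier S"
    and f0: "f 0 \<in> Units A"
    and R: "R = quotient_module S (carrier S #>\<^bsub>S\<^esub> f)"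
  shows "nonprojective_Frobenius_algebra K R \<and>
    Frobenius_form K R (\<lambda>g h. \<epsilon> (reduced_rep A m (g \<otimes>\<^bsub>R\<^esub> h) 0)) \<and>
    Frobenius_ring R"
proof -
  obtain F where F: "Frobenius_form K A F" "\<And>b. b \<in> carrier A \<Longrightarrow> \<epsilon> b = F \<one>\<^bsub>A\<^esub> b"
    using \<epsilon> by (auto simp: Frobenius_functional_def)
  have alg: "assoc_algebra K A" and fg: "fin_gen_module K A"
    using A by (auto simp: nonprojective_Frobenius_algebra_def)
  interpret skew_quotient_form K A \<sigma> f m F \<epsilon>
    using alg \<sigma> f Sf_fS f0 F unfolding S
    by (intro skew_quotient_form.intro skew_quotient.intro skew_algebra.intro
        skew_algebra_axioms.intro skew_quotient_axioms.intro skew_quotient_form_axioms.intro)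
  have form: "Frobenius_form K R (\<lambda>g h. \<epsilon> (reduced_rep A m (g \<otimes>\<^bsub>R\<^esub> h) 0))"
    using G_Frobenius_form unfolding G_def[abs_def] R S .
  moreover have nonproj: "nonprojective_Frobenius_algebra K R"
    unfolding nonprojective_Frobenius_algebra_def
    using Q.assoc_algebra_axioms fin_gen_quotient[OF fg] form unfolding R S by blast
  moreover have "Frobenius_ring R"
    by (rule nonprojective_Frobenius_algebra_Frobenius_ring[OF K nonproj])
  ultimately show ?thesis
    by blast
qed

end
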